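(* In $\mathbb{R}^2$, \[ \sup\Big\{\frac{T(\Omega)\operatorname{cap}(\overline\Omega)}{P(\Omega)^5}:\ \Omega \text{ non-empty, open, bounded, connected}\Big\}=\frac{T(B_1)\operatorname{cap}(\overline{B_1})}{P(B_1)^5}, \] and $B_1$ is a maximiser.
   Context: Here $\operatorname{cap}$ denotes logarithmic capacity in $\mathbb{R}^2$: for compact $K$, $\operatorname{cap}(K)=e^{-V(K)}$ where $V(K)=\inf\{I(\mu):\mu$ a probability measure on $K\}$ and $I(\mu)=\iint_{K\times K}\log(1/|x-y|)\,\mu(dx)\mu(dy)$. For a non-empty open $\Omega$ of finite measure, $v_\Omega$ solves $-\Delta v=1$, $v\in H^1_0(\Omega)$, and $T(\Omega)=\int_\Omega v_\Omega$ is the torsional rigidity. $P(\cdot)$ is perimeter and $B_1$ is the open unit disc. *)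

theory Defs
  imports "HOL-Analysis.Analysis" "HOL-Probability.Probability"
begin

type_synonym pt = "real^2"

definition pd :: "2 \<Rightarrow> (pt \<Rightarrow> real) \<Rightarrow> pt \<Rightarrow> real" where
  "pd i f x = frechet_derivative f (at x) (axis i 1)"

fun iter_pd :: "2 list \<Rightarrow> (pt \<Rightarrow> real) \<Rightarrow> pt \<Rightarrow> real" where
  "iter_pd [] f = f"
| "iter_pd (i # is) f = pd i (iter_pd is f)"

definition smooth_fun :: "(pt \<Rightarrow> real) \<Rightarrow> bool" where
  "smooth_fun f \<longleftrightarrow> (\<forall>is. \<forall>x. iter_pd is f differentiable (at x))"

definition tsupport :: "(pt \<Rightarrow> 'b::zero) \<Rightarrow> pt set" where
  "tsupport f = closure {x. f x \<noteq> 0}"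

definition test_fun :: "pt set \<Rightarrow> (pt \<Rightarrow> real) \<Rightarrow> bool" where
  "test_fun \<Omega> \<phi> \<longleftrightarrow> smooth_fun \<phi> \<and> compact (tsupport \<phi>) \<and> tsupport \<phi> \<subseteq> \<Omega>"

definition grad :: "(pt \<Rightarrow> real) \<Rightarrow> pt \<Rightarrow> pt" where
  "grad f x = (\<chi> i. pd i f x)"

text \<open>v is the weak solution of -\<Delta>v = 1 in H^1_0(\<Omega>): v is the L^2-limit of test
  functions whose gradients converge in L^2 to g (the weak gradient of v), and
  \<integral> g\<cdot>\<nabla>\<psi> = \<integral> \<psi> for all test functions \<psi>.\<close>
definition torsion_fun :: "pt set \<Rightarrow> (pt \<Rightarrow> real) \<Rightarrow> bool" where
  "torsion_fun \<Omega> v \<longleftrightarrow> v \<in> borel_measurable lborel \<and>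
     (\<exists>g :: pt \<Rightarrow> pt. g \<in> borel_measurable lborel \<and>
        (\<exists>\<phi> :: nat \<Rightarrow> pt \<Rightarrow> real. (\<forall>n. test_fun \<Omega> (\<phi> n)) \<and>
           (\<lambda>n. \<integral>\<^sup>+ x. ennreal ((\<phi> n x - v x)\<^sup>2) \<partial>lborel) \<longlonglongrightarrow> 0 \<and>
           (\<lambda>n. \<integral>\<^sup>+ x. ennreal ((norm (grad (\<phi> n) x - g x))\<^sup>2) \<partial>lborel) \<longlonglongrightarrow> 0) \<and>
        (\<forall>\<psi>. test_fun \<Omega> \<psi> \<longrightarrow>
           (\<integral> x. g x \<bullet> grad \<psi> x \<partial>lborel) = (\<integral> x. \<psi> x \<partial>lborel)))"

definition torsion :: "pt set \<Rightarrow> real" where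
  "torsion \<Omega> = (THE t. \<exists>v. torsion_fun \<Omega> v \<and> t = (\<integral> x. v x \<partial>lborel))"

definition C1c_field :: "(pt \<Rightarrow> pt) \<Rightarrow> bool" where
  "C1c_field \<phi> \<longleftrightarrow> (\<forall>x. \<phi> differentiable (at x)) \<and>
     (\<forall>w. continuous_on UNIV (\<lambda>x. frechet_derivative \<phi> (at x) w)) \<and>
     compact (tsupport \<phi>)"

definition divergence :: "(pt \<Rightarrow> pt) \<Rightarrow> pt \<Rightarrow> real" where
  "divergence \<phi> x = (\<Sum>i\<in>UNIV. (frechet_derivative \<phi> (at x) (axis i 1)) $ i)"

definition perimeter :: "pt set \<Rightarrow> ereal" where
  "perimeter E = (SUP \<phi>\<in>{\<phi>. C1c_field \<phi> \<and> (\<forall>x. norm (\<phi> x) \<le> 1)}.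
      ereal (LINT x:E|lborel. divergence \<phi> x))"

definition prob_on :: "pt set \<Rightarrow> pt measure \<Rightarrow> bool" where
  "prob_on K \<mu> \<longleftrightarrow> sets \<mu> = sets lborel \<and> prob_space \<mu> \<and> emeasure \<mu> (UNIV - K) = 0"

text \<open>I(\<mu>) = \<integral>\<integral> log(1/|x-y|), split into positive part (which is +\<infinity> on the diagonal)
  and negative part.\<close>
definition log_energy :: "pt measure \<Rightarrow> ereal" where
  "log_energy \<mu> =
     enn2ereal (\<integral>\<^sup>+ p. (if fst p = snd p then \<infinity>
                         else ennreal (max 0 (- ln (dist (fst p) (snd p))))) \<partial>(\<mu> \<Otimes>\<^sub>M \<mu>))
   - enn2ereal (\<integral>\<^sup>+ p. (if fst p = snd p then 0
                         else ennreal (max 0 (ln (dist (fst p) (snd p))))) \<partial>(\<mu> \<Otimes>\<^sub>M \<mu>))"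

definition log_cap :: "pt set \<Rightarrow> real" where
  "log_cap K = (let V = (INF \<mu>\<in>{\<mu>. prob_on K \<mu>}. log_energy \<mu>)
                in if V = \<infinity> then 0 else exp (- real_of_ereal V))"

definition ratio :: "pt set \<Rightarrow> ereal" where
  "ratio \<Omega> = ereal (torsion \<Omega> * log_cap (closure \<Omega>)) / (perimeter \<Omega>) ^ 5"

end

theory Submission
  imports Defs
begin

text \<open>Write \<open>P\<close> for the perimeter of \<open>\<Omega>\<close>. The ratio is at most \<open>1 / (256 \<pi>\<^sup>4)\<close> because of three sharp
  inequalities, each of them an equality for the disc: \<open>4 \<pi> \<bar>\<Omega>\<bar> \<le> P\<^sup>2\<close>, \<open>8 \<pi> T(\<Omega>) \<le> \<bar>\<Omega>\<bar>\<^sup>2\<close> and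
  \<open>2 \<pi> cap(\<Omega>) \<le> P\<close>.

  The first two rest on the Sobolev inequality \<open>4 \<pi> \<parallel>f\<parallel>\<^sub>2\<^sup>2 \<le> \<parallel>\<nabla>f\<parallel>\<^sub>1\<^sup>2\<close> for \<open>f \<ge> 0\<close>, which is obtained by
  mass transport in one coordinate. Applied to mollified indicators it is the isoperimetric inequality.
  Applied to smooth truncations of a test function to the strips between its levels \<open>k h\<close> and
  \<open>(k + 1) h\<close> it gives, without any rearrangement,
  \<open>\<integral> \<phi> \<le> \<bar>\<Omega>\<bar> (\<integral> \<bar>\<nabla>\<phi>\<bar>\<^sup>2 / (8 \<pi>))\<^sup>1\<^sup>/\<^sup>2\<close>, and the torsion function is a limit of test functions.

  For the capacity, \<open>ln \<bar>x - y\<bar>\<close> is up to a constant the mean over all directions of the logarithm of the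
  projected distance. The projection to a direction is an interval of length \<open>w\<close>, on which the cosine
  expansion of the logarithm shows that the energy of any measure is at least \<open>- ln (w / 4)\<close>.
  Because \<open>\<Omega>\<close> is connected, the mean of \<open>w\<close> is at most \<open>P / \<pi>\<close> by the Cauchy-Crofton formula, and
  Jensen's inequality concludes. Finitely many equidistant directions are used throughout.\<close>

subsection \<open>Rotated coordinates\<close>

text \<open>The three bounds multiply to (P^2 / (4 pi))^2 / (8 pi) times P / (2 pi), which is P^5 /
  (256 pi^4). For the disc only one-sided estimates are proved, perimeter at most 2 pi and capacity
  at least 1; the general inequalities supply the other sides. \<open>perimeter\<close> is a
  supremum over vector fields and \<Omega> has no boundary regularity, so the perimeter and torsion
  estimates are proved for C1 functions of compact support, and Fatou's lemma or L2 convergence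
  carries them over to \<Omega>. \<open>torsion\<close> is a definite description, so bounding it
  requires existence and uniqueness; existence is the direct method, and the Saint-Venant bound
  makes the energy bounded below. The constant 8 pi is 4 pi from the Sobolev inequality times 2 from
  the discrete form of the integral of m dm over the level measures m. With finitely many directions
  no measurability in the angle arises. The logarithm is regularised by two radii below 1, \<rho> in
  the average over directions and r in a single projection, since the tail of its cosine series is
  geometric only there. The number of directions tends to infinity first, then r tends to 1.\<close>

definition rotv :: "real \<Rightarrow> real \<Rightarrow> real \<Rightarrow> pt" where
  "rotv \<theta> s t = vector [s * cos \<theta> - t * sin \<theta>, s * sin \<theta> + t * cos \<theta>]"

lemma rotv_nth [simp]:
  "rotv \<theta> s t $ 1 = s * cos \<theta> - t * sin \<theta>"
  "rotv \<theta> s t $ 2 = s * sin \<theta> + t * cos \<theta>"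
  by (simp_all add: rotv_def)

lemma pt_eq_iff: "(x::pt) = y \<longleftrightarrow> x $ 1 = y $ 1 \<and> x $ 2 = y $ 2"
  by (simp add: vec_eq_iff forall_2)

lemma inner_pt: "(x::pt) \<bullet> y = x $ 1 * y $ 1 + x $ 2 * y $ 2"
  by (simp add: inner_vec_def sum_2)

lemma norm_pt: "norm (x::pt) = sqrt ((x $ 1)\<^sup>2 + (x $ 2)\<^sup>2)"
  by (simp add: norm_vec_def L2_set_def sum_2)

lemma continuous_vec_pt:
  fixes f :: "'a::topological_space \<Rightarrow> pt"
  shows "continuous_on S (\<lambda>x. f x $ 1) \<Longrightarrow> continuous_on S (\<lambda>x. f x $ 2) \<Longrightarrow> continuous_on S f"
proof -
  assume a: "continuous_on S (\<lambda>x. f x $ 1)" "continuous_on S (\<lambda>x. f x $ 2)"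
  have "continuous_on S (\<lambda>x. \<chi> i. f x $ i)"
    using a by (intro continuous_on_vec_lambda) (metis (full_types) exhaust_2)
  then show ?thesis by simp
qed

lemma continuous_on_rotv [continuous_intros]:
  "continuous_on S f \<Longrightarrow> continuous_on S g \<Longrightarrow> continuous_on S (\<lambda>x. rotv \<theta> (f x) (g x))"
  by (rule continuous_vec_pt) (auto intro!: continuous_intros)

lemma rotv_measurable [measurable]:
  "case_prod (rotv \<theta>) \<in> borel_measurable (borel \<Otimes>\<^sub>M borel)"
  unfolding borel_prod split_beta
  by (intro borel_measurable_continuous_onI continuous_intros)

lemma Basis_pt: "(Basis :: pt set) = {axis 1 1, axis 2 1}"
proof -
  show ?thesis using exhaust_2 by (force simp: Basis_vec_def axis_eq_axis)
qed

lemma axis_12_neq: "axis 1 (1::real) \<noteq> (axis 2 1 :: pt)"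
  by (simp add: axis_eq_axis)

lemma inner_axis_pt [simp]: "x \<bullet> axis i 1 = (x :: pt) $ i"
  by (simp add: inner_axis)

lemma distr_rotv_0: "distr (lborel \<Otimes>\<^sub>M lborel) borel (case_prod (rotv 0)) = lborel"
proof (rule lborel_eqI[symmetric])
  fix l u :: pt assume *: "\<And>b. b \<in> Basis \<Longrightarrow> l \<bullet> b \<le> u \<bullet> b"
  then have le: "l $ 1 \<le> u $ 1" "l $ 2 \<le> u $ 2" by (force simp: Basis_pt)+
  have "case_prod (rotv 0) -` box l u = {l$1<..<u$1} \<times> {l$2<..<u$2}"
    by (auto simp: mem_box_cart forall_2)
  then have "emeasure (distr (lborel \<Otimes>\<^sub>M lborel) borel (case_prod (rotv 0))) (box l u) =
    emeasure (lborel \<Otimes>\<^sub>M lborel) ({l$1<..<u$1} \<times> {l$2<..<u$2})"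
    by (subst emeasure_distr) (auto simp: space_pair_measure)
  also have "\<dots> = emeasure lborel {l$1<..<u$1} * emeasure lborel {l$2<..<u$2}"
    by (rule lborel.emeasure_pair_measure_Times) auto
  also have "\<dots> = ennreal ((u$1 - l$1) * (u$2 - l$2))"
    using le by (simp add: ennreal_mult)
  finally show "emeasure (distr (lborel \<Otimes>\<^sub>M lborel) borel (case_prod (rotv 0))) (box l u) = (\<Prod>b\<in>Basis. (u - l) \<bullet> b)"
    using axis_12_neq by (simp add: Basis_pt)
qed simp

lemma cos_cos_sin_sin: "cos \<theta> * (cos \<theta> * y) + sin \<theta> * (sin \<theta> * y) = (y::real)"
proof -
  have "cos \<theta> * (cos \<theta> * y) + sin \<theta> * (sin \<theta> * y) = ((sin \<theta>)\<^sup>2 + (cos \<theta>)\<^sup>2) * y" by algebra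
  then show ?thesis by simp
qed

definition rotm :: "real \<Rightarrow> pt \<Rightarrow> pt" where "rotm \<theta> x = rotv \<theta> (x $ 1) (x $ 2)"

lemma rotm_rotm: "rotm (- \<theta>) (rotm \<theta> x) = x"
  by (simp add: rotm_def pt_eq_iff algebra_simps cos_cos_sin_sin)

lemma orthogonal_rotm: "orthogonal_transformation (rotm \<theta>)"
proof -
  have "linear (rotm \<theta>)"
    by (rule linearI) (auto simp: rotm_def pt_eq_iff algebra_simps)
  moreover have "norm (rotm \<theta> x) = norm x" for x
  proof -
    have "(x$1 * cos \<theta> - x$2 * sin \<theta>)\<^sup>2 + (x$1 * sin \<theta> + x$2 * cos \<theta>)\<^sup>2
        = ((x$1)\<^sup>2 + (x$2)\<^sup>2) * ((sin \<theta>)\<^sup>2 + (cos \<theta>)\<^sup>2)"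
      by algebra
    then show ?thesis by (simp add: norm_pt rotm_def)
  qed
  ultimately show ?thesis by (simp add: orthogonal_transformation)
qed

text \<open>A rotated box is no box, so its measure comes from the invariance of
  \<open>lebesgue\<close> under orthogonal maps; the rotated box is Borel, hence
  \<open>lborel\<close> gives it the same value.\<close>

lemma distr_rotm: "distr lborel borel (rotm \<theta>) = lborel"
proof (rule lborel_eqI[symmetric])
  have [measurable]: "rotm \<theta> \<in> borel_measurable borel" for \<theta>
    unfolding rotm_def by (intro borel_measurable_continuous_onI continuous_intros)
  fix l u :: pt assume *: "\<And>b. b \<in> Basis \<Longrightarrow> l \<bullet> b \<le> u \<bullet> b"
  have eq: "rotm \<theta> -` box l u = rotm (-\<theta>) ` box l u"
  proof -
    have "rotm \<theta> (rotm (- \<theta>) x) = x" for x using rotm_rotm[of "-\<theta>" x] by simp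
    then show ?thesis using rotm_rotm[of \<theta>] by (auto simp: image_iff) metis
  qed
  have bl: "box l u \<in> lmeasurable" by simp
  have m: "rotm (-\<theta>) ` box l u \<in> lmeasurable" "measure lebesgue (rotm (-\<theta>) ` box l u) = measure lebesgue (box l u)"
    using measurable_orthogonal_image[OF orthogonal_rotm bl] measure_orthogonal_image[OF orthogonal_rotm bl] by auto
  have b: "rotm (-\<theta>) ` box l u \<in> sets borel"
    unfolding eq[symmetric] using measurable_sets[of "rotm \<theta>" borel borel "box l u"] by simp
  have "emeasure (distr lborel borel (rotm \<theta>)) (box l u) = emeasure lborel (rotm (-\<theta>) ` box l u)"
    by (subst emeasure_distr) (auto simp: eq)
  also have "\<dots> = emeasure lebesgue (rotm (-\<theta>) ` box l u)" using b by simp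
  also have "\<dots> = emeasure lebesgue (box l u)"
    using m bl by (metis emeasure_eq_measure2)
  also have "\<dots> = emeasure lborel (box l u)" by simp
  also have "\<dots> = (\<Prod>b\<in>Basis. (u - l) \<bullet> b)" using * by (simp add: emeasure_lborel_box)
  finally show "emeasure (distr lborel borel (rotm \<theta>)) (box l u) = (\<Prod>b\<in>Basis. (u - l) \<bullet> b)" .
qed simp

lemma distr_rotv: "distr (lborel \<Otimes>\<^sub>M lborel) borel (case_prod (rotv \<theta>)) = lborel"
proof -
  have [measurable]: "rotm \<theta> \<in> borel_measurable borel" for \<theta>
    unfolding rotm_def by (intro borel_measurable_continuous_onI continuous_intros)
  have "case_prod (rotv \<theta>) = rotm \<theta> \<circ> case_prod (rotv 0)"
    by (auto simp: rotm_def)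
  then have "distr (lborel \<Otimes>\<^sub>M lborel) borel (case_prod (rotv \<theta>)) =
    distr (distr (lborel \<Otimes>\<^sub>M lborel) borel (case_prod (rotv 0))) borel (rotm \<theta>)"
    by (subst distr_distr) auto
  also have "\<dots> = lborel" by (simp add: distr_rotv_0 distr_rotm)
  finally show ?thesis .
qed

text \<open>Fubini in a rotated frame: s is the coordinate along the unit vector
  \<open>rotv \<theta> 1 0\<close>, and the inner integral runs along the line in direction
  \<open>rotv \<theta> 0 1\<close> at offset s.\<close>

lemma nn_integral_rotv:
  assumes [measurable]: "f \<in> borel_measurable borel"
  shows "(\<integral>\<^sup>+x. f x \<partial>lborel) = (\<integral>\<^sup>+s. \<integral>\<^sup>+t. f (rotv \<theta> s t) \<partial>lborel \<partial>lborel)"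
proof -
  have "(\<integral>\<^sup>+x. f x \<partial>lborel) = (\<integral>\<^sup>+x. f x \<partial>distr (lborel \<Otimes>\<^sub>M lborel) borel (case_prod (rotv \<theta>)))"
    by (simp add: distr_rotv)
  also have "\<dots> = (\<integral>\<^sup>+x. f (case_prod (rotv \<theta>) x) \<partial>(lborel \<Otimes>\<^sub>M lborel))"
    by (subst nn_integral_distr) auto
  also have "\<dots> = (\<integral>\<^sup>+s. \<integral>\<^sup>+t. f (rotv \<theta> s t) \<partial>lborel \<partial>lborel)"
    by (subst lborel.nn_integral_fst[symmetric]) (auto simp: split_beta)
  finally show ?thesis .
qed

lemma integral_rotv:
  fixes f :: "pt \<Rightarrow> 'b::{banach, second_countable_topology}"
  assumes f: "integrable lborel f"
  shows "(\<integral>x. f x \<partial>lborel) = (\<integral>s. \<integral>t. f (rotv \<theta> s t) \<partial>lborel \<partial>lborel)"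
proof -
  have [measurable]: "f \<in> borel_measurable borel" using f by auto
  have i: "integrable (lborel \<Otimes>\<^sub>M lborel) (\<lambda>x. f (case_prod (rotv \<theta>) x))"
    using f by (subst integrable_distr_eq[symmetric, where N=borel]) (auto simp: distr_rotv)
  have "(\<integral>x. f x \<partial>lborel) = (\<integral>x. f x \<partial>distr (lborel \<Otimes>\<^sub>M lborel) borel (case_prod (rotv \<theta>)))"
    by (simp add: distr_rotv)
  also have "\<dots> = (\<integral>x. f (case_prod (rotv \<theta>) x) \<partial>(lborel \<Otimes>\<^sub>M lborel))"
    by (subst integral_distr) auto
  also have "\<dots> = (\<integral>s. \<integral>t. f (rotv \<theta> s t) \<partial>lborel \<partial>lborel)"
    using i by (subst lborel_pair.integral_fst'[symmetric]) (auto simp: split_beta)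
  finally show ?thesis .
qed

lemma norm_rotv: "norm (rotv \<theta> s t) = sqrt (s\<^sup>2 + t\<^sup>2)"
proof -
  have "(s * cos \<theta> - t * sin \<theta>)\<^sup>2 + (s * sin \<theta> + t * cos \<theta>)\<^sup>2 = (s\<^sup>2 + t\<^sup>2) * ((sin \<theta>)\<^sup>2 + (cos \<theta>)\<^sup>2)"
    by algebra
  then show ?thesis by (simp add: norm_pt)
qed

lemma norm_rotv_ge: "\<bar>s\<bar> \<le> norm (rotv \<theta> s t)" "\<bar>t\<bar> \<le> norm (rotv \<theta> s t)"
  unfolding norm_rotv by (simp_all add: real_le_rsqrt)

lemma rotv_surj: "x = rotv \<theta> (x \<bullet> rotv \<theta> 1 0) (x \<bullet> rotv \<theta> 0 1)"
  by (simp add: pt_eq_iff inner_pt algebra_simps cos_cos_sin_sin)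

lemma inner_rotv: "rotv \<theta> s t \<bullet> rotv \<theta> 1 0 = s" "rotv \<theta> s t \<bullet> rotv \<theta> 0 1 = t"
  using cos_cos_sin_sin[of \<theta>] by (simp_all add: inner_pt algebra_simps)

subsection \<open>Compactly supported functions of class C1\<close>

lemma integrable_bounded_support:
  fixes f :: "'a::euclidean_space \<Rightarrow> 'b::{banach, second_countable_topology}"
  assumes "continuous_on UNIV f" "\<And>x. R < norm x \<Longrightarrow> f x = 0"
  shows "integrable lborel f"
proof -
  have "integrable lborel (\<lambda>x. indicator (cball 0 R) x *\<^sub>R f x)"
    using assms by (intro borel_integrable_compact) (auto intro: continuous_on_subset)
  also have "(\<lambda>x. indicator (cball 0 R) x *\<^sub>R f x) = f"
    using assms(2) by (force simp: indicator_def fun_eq_iff)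
  finally show ?thesis .
qed

text \<open>The common class for test functions, mollified indicators, truncations and components of
  fields. Vanishing outside a ball, rather than compactness of \<open>tsupport\<close>, is preserved
  by products and compositions without any argument on closures.\<close>

definition C1c :: "(pt \<Rightarrow> real) \<Rightarrow> bool" where
  "C1c f \<longleftrightarrow> (\<forall>x. f differentiable (at x)) \<and> continuous_on UNIV (grad f) \<and>
     (\<exists>R. \<forall>x. R < norm x \<longrightarrow> f x = 0)"

lemma inner_grad: "f differentiable (at x) \<Longrightarrow> grad f x \<bullet> w = frechet_derivative f (at x) w"
proof -
  assume "f differentiable (at x)"
  then have l: "linear (frechet_derivative f (at x))"
    by (rule linear_frechet_derivative)
  have "w = (w $ 1) *\<^sub>R axis 1 1 + (w $ 2) *\<^sub>R axis 2 1"
    by (simp add: pt_eq_iff axis_def)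
  then have "frechet_derivative f (at x) w = w $ 1 * frechet_derivative f (at x) (axis 1 1)
      + w $ 2 * frechet_derivative f (at x) (axis 2 1)"
    using linear_add[OF l] linear_cmul[OF l] by (metis real_scaleR_def)
  then show ?thesis by (simp add: inner_pt grad_def pd_def)
qed

lemma grad_has_derivative: "f differentiable (at x) \<Longrightarrow> (f has_derivative (\<lambda>w. grad f x \<bullet> w)) (at x)"
  using inner_grad frechet_derivative_works by (metis (no_types, lifting) ext)

lemma grad_unique: "(f has_derivative (\<lambda>w. v \<bullet> w)) (at x) \<Longrightarrow> grad f x = v"
  using frechet_derivative_at[of f "\<lambda>w. v \<bullet> w" x, symmetric]
  by (simp add: grad_def pd_def)

lemma C1cI:
  assumes "\<And>x. (f has_derivative (\<lambda>w. v x \<bullet> w)) (at x)" "continuous_on UNIV v"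
    "\<And>x. R < norm x \<Longrightarrow> f x = 0"
  shows "C1c f" "grad f x = v x"
  using assms grad_unique[OF assms(1)]
  by (auto simp: C1c_def differentiable_def cong: continuous_on_cong)

context
  fixes f assumes f: "C1c f"
begin

lemma C1c_has_derivative: "(f has_derivative (\<lambda>w. grad f x \<bullet> w)) (at x)"
  using f grad_has_derivative by (auto simp: C1c_def)

lemma C1c_continuous: "continuous_on S f"
  using C1c_has_derivative by (meson continuous_at_imp_continuous_on has_derivative_continuous)

lemma C1c_continuous_grad: "continuous_on S (grad f)"
  using f by (auto simp: C1c_def intro: continuous_on_subset)

lemma C1c_support:
  obtains R where "R > 0" "\<And>x. R < norm x \<Longrightarrow> f x = 0" "\<And>x. R < norm x \<Longrightarrow> grad f x = 0"
proof -
  obtain R where R: "\<And>x. R < norm x \<Longrightarrow> f x = 0" using f by (auto simp: C1c_def)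
  have "grad f x = 0" if "max R 1 < norm x" for x
  proof -
    have o: "open {x::pt. R < norm x}" by (intro open_Collect_less continuous_intros)
    have "(f has_derivative (\<lambda>w. 0)) (at x)"
      by (rule has_derivative_transform_within_open[where f="\<lambda>_. 0", OF _ o]) (use that R in auto)
    then show ?thesis using grad_unique[of f 0] by simp
  qed
  then show ?thesis using R that[of "max R 1"] by auto
qed

lemma C1c_measurable: "f \<in> borel_measurable borel" "grad f \<in> borel_measurable borel"
  using C1c_continuous C1c_continuous_grad by (auto intro: borel_measurable_continuous_onI)

lemma C1c_integrable:
  fixes g :: "pt \<Rightarrow> 'b::{banach, second_countable_topology}"
  assumes "continuous_on UNIV g" "\<And>x. f x = 0 \<Longrightarrow> grad f x = 0 \<Longrightarrow> g x = 0"
  shows "integrable lborel g"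
proof -
  obtain R where "R > 0" "\<And>x. R < norm x \<Longrightarrow> f x = 0" "\<And>x. R < norm x \<Longrightarrow> grad f x = 0"
    using C1c_support by blast
  then show ?thesis by (intro integrable_bounded_support[of g R] assms)
qed

lemma C1c_vector_derivative:
  "((\<lambda>t. f (rotv \<theta> s t)) has_vector_derivative grad f (rotv \<theta> s t) \<bullet> rotv \<theta> 0 1) (at t)"
proof -
  have 1: "((\<lambda>t. rotv \<theta> s 0 + t *\<^sub>R rotv \<theta> 0 1) has_derivative (\<lambda>h. h *\<^sub>R rotv \<theta> 0 1)) (at t)"
    by (auto intro!: derivative_eq_intros)
  have eq: "rotv \<theta> s 0 + t *\<^sub>R rotv \<theta> 0 1 = rotv \<theta> s t" for t by (simp add: pt_eq_iff algebra_simps)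
  have "((\<lambda>t. f (rotv \<theta> s t)) has_derivative (\<lambda>h. grad f (rotv \<theta> s t) \<bullet> (h *\<^sub>R rotv \<theta> 0 1))) (at t)"
    using has_derivative_compose[OF 1, of f, OF C1c_has_derivative] by (simp add: eq)
  then show ?thesis by (simp add: has_vector_derivative_def)
qed

lemma C1c_line_continuous: "continuous_on S (\<lambda>t. grad f (rotv \<theta> s t) \<bullet> rotv \<theta> 0 1)"
  by (intro continuous_intros continuous_on_compose2[OF C1c_continuous_grad[of UNIV]]) auto

lemma C1c_line_integrable: "integrable lborel (\<lambda>t. grad f (rotv \<theta> s t) \<bullet> rotv \<theta> 0 1)"
proof -
  obtain R where R: "R > 0" "\<And>x. R < norm x \<Longrightarrow> f x = 0" "\<And>x. R < norm x \<Longrightarrow> grad f x = 0" using C1c_support by blast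
  show ?thesis
    using R(3) norm_rotv_ge(2)[of _ \<theta> s]
    by (intro integrable_bounded_support[of _ R] C1c_line_continuous) (auto, metis inner_zero_left less_le_trans)
qed

lemma C1c_line_FTC:
  assumes "a \<le> b"
  shows "(\<integral>t. indicator {a..b} t * (grad f (rotv \<theta> s t) \<bullet> rotv \<theta> 0 1) \<partial>lborel) = f (rotv \<theta> s b) - f (rotv \<theta> s a)"
  using integral_FTC_atLeastAtMost[OF assms, of "\<lambda>t. f (rotv \<theta> s t)" "\<lambda>t. grad f (rotv \<theta> s t) \<bullet> rotv \<theta> 0 1"]
    C1c_vector_derivative C1c_line_continuous
  by (auto intro: has_vector_derivative_at_within)

lemma C1c_line_integral: "(\<integral>t. grad f (rotv \<theta> s t) \<bullet> rotv \<theta> 0 1 \<partial>lborel) = 0"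
proof -
  obtain R where R: "R > 0" "\<And>x. R < norm x \<Longrightarrow> f x = 0" "\<And>x. R < norm x \<Longrightarrow> grad f x = 0" using C1c_support by blast
  have z: "f (rotv \<theta> s t) = 0" "grad f (rotv \<theta> s t) = 0" if "R < \<bar>t\<bar>" for t
    using R norm_rotv_ge(2)[of t \<theta> s] that by auto
  have "(\<integral>t. grad f (rotv \<theta> s t) \<bullet> rotv \<theta> 0 1 \<partial>lborel) =
    (\<integral>t. indicator {-(R+1)..R+1} t * (grad f (rotv \<theta> s t) \<bullet> rotv \<theta> 0 1) \<partial>lborel)"
  proof (intro Bochner_Integration.integral_cong refl)
    fix t show "grad f (rotv \<theta> s t) \<bullet> rotv \<theta> 0 1 = indicator {-(R+1)..R+1} t * (grad f (rotv \<theta> s t) \<bullet> rotv \<theta> 0 1)"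
      using z(2)[of t] by (cases "R < \<bar>t\<bar>") (auto simp: indicator_def)
  qed
  also have "\<dots> = 0" using C1c_line_FTC[of "-(R+1)" "R+1" \<theta> s] z R(1) by simp
  finally show ?thesis .
qed

text \<open>Along a line f has to rise from 0 to its value at t0 and to fall back to 0, and each of
  the two costs that value in variation. This is the factor 2 in the Cauchy-Crofton bound.\<close>

lemma C1c_line_nn_integral:
  "ennreal (2 * f (rotv \<theta> s t0)) \<le> (\<integral>\<^sup>+t. ennreal \<bar>grad f (rotv \<theta> s t) \<bullet> rotv \<theta> 0 1\<bar> \<partial>lborel)"
proof -
  let ?g = "\<lambda>t. grad f (rotv \<theta> s t) \<bullet> rotv \<theta> 0 1"
  obtain R where R: "R > 0" "\<And>x. R < norm x \<Longrightarrow> f x = 0" "\<And>x. R < norm x \<Longrightarrow> grad f x = 0" using C1c_support by blast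
  have z: "f (rotv \<theta> s t) = 0" if "R < \<bar>t\<bar>" for t
    using R norm_rotv_ge(2)[of t \<theta> s] that by auto
  define b where "b = max (R + 1) (\<bar>t0\<bar>)"
  have b: "-b \<le> t0" "t0 \<le> b" "f (rotv \<theta> s b) = 0" "f (rotv \<theta> s (-b)) = 0"
    unfolding b_def using R(1) by (auto intro!: z)
  have i: "integrable lborel (\<lambda>t. indicator A t * ?g t)" if "A \<in> sets borel" for A
    using integrable_mult_indicator[OF _ C1c_line_integrable[of \<theta> s], of A] that by simp
  have "2 * f (rotv \<theta> s t0) = (\<integral>t. indicator {-b..t0} t * ?g t \<partial>lborel) - (\<integral>t. indicator {t0..b} t * ?g t \<partial>lborel)"
    using C1c_line_FTC[OF b(1), of \<theta> s] C1c_line_FTC[OF b(2), of \<theta> s] b by simp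
  also have "\<dots> = (\<integral>t. indicator {-b..t0} t * ?g t - indicator {t0..b} t * ?g t \<partial>lborel)"
    by (rule Bochner_Integration.integral_diff[symmetric]) (auto intro!: i)
  also have "\<dots> \<le> (\<integral>t. \<bar>?g t\<bar> \<partial>lborel)"
    by (intro integral_mono Bochner_Integration.integrable_diff i integrable_abs C1c_line_integrable)
      (auto simp: indicator_def)
  finally show ?thesis
    using C1c_line_integrable[of \<theta> s]
    by (subst nn_integral_eq_integral) (auto intro: ennreal_leI)
qed

lemma C1c_integral_inner_grad: "(\<integral>x. grad f x \<bullet> rotv \<theta> 0 1 \<partial>lborel) = 0"
proof -
  have "integrable lborel (\<lambda>x. grad f x \<bullet> rotv \<theta> 0 1)"
    by (intro C1c_integrable continuous_intros C1c_continuous_grad) auto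
  from integral_rotv[OF this, of \<theta>] show ?thesis
    by (simp add: C1c_line_integral)
qed

lemma C1c_integral_grad_nth: "(\<integral>x. grad f x $ i \<partial>lborel) = 0"
proof -
  have "rotv (-pi/2) 0 1 = (axis 1 1 :: pt)" "rotv 0 0 1 = (axis 2 1 :: pt)"
    by (auto simp: pt_eq_iff axis_def)
  then show ?thesis
    using C1c_integral_inner_grad[of "-pi/2"] C1c_integral_inner_grad[of 0] exhaust_2[of i] by auto
qed

end

subsection \<open>The sharp L1 Sobolev inequality in the plane\<close>

text \<open>\<open>disc_frac t\<close> is the fraction of the area of the unit disc lying in \<open>{x. x\<^sub>1 < - cos t}\<close>.\<close>

definition disc_frac :: "real \<Rightarrow> real" where
  "disc_frac t = (t - sin t * cos t) / pi"

definition disc_angle :: "real \<Rightarrow> real" where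
  "disc_angle = inv_into {0..pi} disc_frac"

lemma disc_frac_DERIV: "(disc_frac has_real_derivative 2 * (sin t)\<^sup>2 / pi) (at t)"
proof -
  have "1 - (cos t * cos t - sin t * sin t) = 2 * (sin t)\<^sup>2"
    using sin_cos_squared_add[of t] by (simp add: power2_eq_square)
  then show ?thesis unfolding disc_frac_def
    by (auto intro!: derivative_eq_intros simp: algebra_simps)
qed

lemma disc_frac_continuous: "continuous_on S disc_frac"
  unfolding disc_frac_def by (intro continuous_intros) auto

lemma disc_frac_strict:
  assumes "0 \<le> x" "x < y" "y \<le> pi"
  shows "disc_frac x < disc_frac y"
proof (rule DERIV_pos_imp_increasing_open[where f=disc_frac])
  fix t assume "x < t" "t < y"
  then have "sin t > 0" using assms by (intro sin_gt_zero) auto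
  then show "\<exists>d. (disc_frac has_real_derivative d) (at t) \<and> 0 < d"
    using disc_frac_DERIV by (intro exI[of _ "2 * (sin t)\<^sup>2 / pi"]) auto
qed (use assms in \<open>auto intro: disc_frac_continuous\<close>)

lemma disc_frac_inj: "inj_on disc_frac {0..pi}"
  by (rule linorder_inj_onI) (use disc_frac_strict in \<open>force+\<close>)

lemma disc_frac_0_pi: "disc_frac 0 = 0" "disc_frac pi = 1"
  by (auto simp: disc_frac_def)

lemma disc_frac_image: "disc_frac ` {0..pi} = {0..1}"
proof safe
  fix x assume x: "x \<in> {0..pi}"
  have "disc_frac 0 \<le> disc_frac x" using disc_frac_strict[of 0 x] x by (cases "x = 0") auto
  moreover have "disc_frac x \<le> disc_frac pi" using disc_frac_strict[of x pi] x by (cases "x = pi") auto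
  ultimately show "disc_frac x \<in> {0..1}" by (simp add: disc_frac_0_pi)
next
  fix y :: real assume "y \<in> {0..1}"
  then show "y \<in> disc_frac ` {0..pi}"
    using IVT'[of disc_frac 0 y pi] disc_frac_continuous disc_frac_0_pi by auto
qed

lemma disc_angle: "y \<in> {0..1} \<Longrightarrow> disc_angle y \<in> {0..pi}" "y \<in> {0..1} \<Longrightarrow> disc_frac (disc_angle y) = y"
  unfolding disc_angle_def by (metis disc_frac_image inv_into_into, metis disc_frac_image f_inv_into_f)

lemma disc_angle_continuous: "continuous_on {0..1} disc_angle"
  unfolding disc_frac_image[symmetric]
  by (intro continuous_on_inv disc_frac_continuous) (auto simp: disc_angle_def inv_into_f_f[OF disc_frac_inj])

text \<open>Inverse function rule. The ends 0 and 1 are excluded because the sine vanishes there and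
  the derivative blows up; \<open>disc_angle\<close> is merely continuous at them.\<close>

lemma disc_angle_DERIV:
  assumes "0 < y" "y < 1"
  shows "0 < sin (disc_angle y)"
    "(disc_angle has_real_derivative pi / (2 * (sin (disc_angle y))\<^sup>2)) (at y)"
proof -
  have "disc_angle y \<noteq> 0" "disc_angle y \<noteq> pi" "disc_angle y \<in> {0..pi}"
    using disc_angle[of y] assms disc_frac_0_pi by auto
  then show s: "0 < sin (disc_angle y)" by (intro sin_gt_zero) auto
  have "isCont disc_angle y"
    using disc_angle_continuous assms by (auto simp: continuous_on_interior)
  then have "(disc_angle has_real_derivative inverse (2 * (sin (disc_angle y))\<^sup>2 / pi)) (at y)"
    using s assms disc_angle
    by (intro DERIV_inverse_function[where f=disc_frac and a=0 and b=1] disc_frac_DERIV) auto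
  then show "(disc_angle has_real_derivative pi / (2 * (sin (disc_angle y))\<^sup>2)) (at y)" by simp
qed

lemma lborel_integral_Icc:
  fixes g :: "real \<Rightarrow> real"
  assumes "continuous_on UNIV g" "\<And>t. R < \<bar>t\<bar> \<Longrightarrow> g t = 0"
  shows "(\<integral>t. g t \<partial>lborel) = integral {-R..R} g"
proof -
  have "(\<integral>t. g t \<partial>lborel) = (LINT t:{-R..R}|lborel. g t)"
    unfolding set_lebesgue_integral_def
  proof (intro Bochner_Integration.integral_cong refl)
    fix t show "g t = indicator {-R..R} t *\<^sub>R g t"
      using assms(2)[of t] by (cases "R < \<bar>t\<bar>") (auto simp: indicator_def)
  qed
  also have "\<dots> = integral {-R..R} g"
    by (intro set_borel_integral_eq_integral borel_integrable_atLeastAtMost')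
      (use assms(1) continuous_on_subset in blast)
  finally show ?thesis .
qed

lemma continuous_section_integral:
  fixes F :: "pt \<Rightarrow> real"
  assumes F: "continuous_on UNIV F"
  shows "continuous_on S (\<lambda>a. integral {-R..R} (\<lambda>b. F (rotv \<theta> a b)))"
proof -
  have c: "continuous_on (S \<times> cbox (-R) R) (\<lambda>(a, b). F (rotv \<theta> a b))"
    unfolding split_beta
    by (intro continuous_on_compose2[OF F] continuous_intros) auto
  show ?thesis using integral_continuous_on_param[OF c] by simp
qed

lemma lborel_integral_box:
  fixes F :: "pt \<Rightarrow> real"
  assumes F: "continuous_on UNIV F" and z: "\<And>x. R < norm x \<Longrightarrow> F x = 0"
  shows "(\<integral>x. F x \<partial>lborel) = integral {-R..R} (\<lambda>a. integral {-R..R} (\<lambda>b. F (rotv 0 a b)))"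
proof -
  have 1: "(\<integral>t. F (rotv 0 s t) \<partial>lborel) = integral {-R..R} (\<lambda>b. F (rotv 0 s b))" for s
    using norm_rotv_ge(2)[of _ 0 s] z
    by (intro lborel_integral_Icc continuous_on_compose2[OF F] continuous_intros) (auto intro: less_le_trans)
  have "(\<integral>x. F x \<partial>lborel) = (\<integral>s. \<integral>t. F (rotv 0 s t) \<partial>lborel \<partial>lborel)"
    by (intro integral_rotv integrable_bounded_support[OF F z])
  also have "\<dots> = integral {-R..R} (\<lambda>a. integral {-R..R} (\<lambda>b. F (rotv 0 a b)))"
    unfolding 1
  proof (intro lborel_integral_Icc continuous_section_integral F)
    fix t :: real assume "R < \<bar>t\<bar>"
    then have "F (rotv 0 t b) = 0" for b using z norm_rotv_ge(1)[of t 0 b] by auto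
    then show "integral {-R..R} (\<lambda>b. F (rotv 0 t b)) = 0" by simp
  qed
  finally show ?thesis .
qed

text \<open>Covers the points where the transported density vanishes: there the angle may fail to be
  differentiable, but it enters only through a bounded factor next to a function with a zero of
  higher order.\<close>

lemma DERIV_mult_bounded_at_zero:
  fixes H k :: "real \<Rightarrow> real"
  assumes H: "(H has_real_derivative 0) (at a)" and "H a = 0" and k: "\<And>x. \<bar>k x\<bar> \<le> 1"
  shows "((\<lambda>x. H x * k x) has_real_derivative 0) (at a)"
proof -
  have l: "((\<lambda>x. (H x - H a) / (x - a)) \<longlongrightarrow> 0) (at a)"
    using H by (simp add: has_field_derivative_iff)
  have "((\<lambda>x. (H x * k x - H a * k a) / (x - a)) \<longlongrightarrow> 0) (at a)"
  proof (rule Lim_null_comparison)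
    show "((\<lambda>x. \<bar>(H x - H a) / (x - a)\<bar>) \<longlongrightarrow> 0) (at a)" using l by (rule tendsto_rabs_zero)
    show "\<forall>\<^sub>F x in at a. norm ((H x * k x - H a * k a) / (x - a)) \<le> \<bar>(H x - H a) / (x - a)\<bar>"
    proof (rule always_eventually, rule allI)
      fix x
      have "\<bar>H x\<bar> * \<bar>k x\<bar> \<le> \<bar>H x\<bar> * 1" by (intro mult_left_mono k) auto
      then show "norm ((H x * k x - H a * k a) / (x - a)) \<le> \<bar>(H x - H a) / (x - a)\<bar>"
        using \<open>H a = 0\<close> by (simp add: abs_mult divide_right_mono)
    qed
  qed
  then show ?thesis by (simp add: has_field_derivative_iff)
qed

lemma section_derivative:
  assumes f: "C1c f"
  shows "((\<lambda>a. integral {-R..R} (\<lambda>b. f (rotv 0 a b))) has_real_derivative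
    integral {-R..R} (\<lambda>b. grad f (rotv 0 a b) $ 1)) (at a)"
proof -
  have d: "((\<lambda>a. f (rotv 0 a b)) has_real_derivative grad f (rotv 0 a b) $ 1) (at a)" for a b
  proof -
    have 1: "((\<lambda>a. rotv 0 0 b + a *\<^sub>R axis 1 1) has_derivative (\<lambda>h. h *\<^sub>R axis 1 1)) (at a)"
      by (auto intro!: derivative_eq_intros)
    have eq: "rotv 0 0 b + a *\<^sub>R axis 1 1 = rotv 0 a b" for a by (simp add: pt_eq_iff axis_def)
    show ?thesis
      using has_derivative_compose[OF 1, of f, OF C1c_has_derivative[OF f]]
      by (simp add: eq has_field_derivative_def mult.commute[of "grad f (rotv 0 a b) $ 1"] mult_commute_abs)
  qed
  have "((\<lambda>a. integral (cbox (-R) R) (\<lambda>b. f (rotv 0 a b))) has_field_derivative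
    integral (cbox (-R) R) (\<lambda>b. grad f (rotv 0 a b) $ 1)) (at a within UNIV)"
  proof (rule leibniz_rule_field_derivative)
    show "(\<lambda>b. f (rotv 0 a b)) integrable_on cbox (-R) R" for a
      by (intro integrable_continuous continuous_on_compose2[OF C1c_continuous[OF f, of UNIV]] continuous_intros) auto
    show "continuous_on (UNIV \<times> cbox (-R) R) (\<lambda>(a, b). grad f (rotv 0 a b) $ 1)"
      unfolding split_beta
      by (intro continuous_intros continuous_on_compose2[OF C1c_continuous_grad[OF f, of UNIV]]) auto
  qed (use d in auto)
  then show ?thesis by simp
qed

text \<open>Rise and fall along the section again, as an integral over the compact interval used for
  the sections below.\<close>

lemma section_sup_bound:
  assumes f: "C1c f" and z: "\<And>x. R \<le> norm x \<Longrightarrow> f x = 0" "R > 0" and b: "b \<in> {-R..R}"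
  shows "2 * f (rotv 0 a b) \<le> integral {-R..R} (\<lambda>b. \<bar>grad f (rotv 0 a b) $ 2\<bar>)"
proof -
  let ?g = "\<lambda>b. grad f (rotv 0 a b) $ 2"
  have g: "?g t = grad f (rotv 0 a t) \<bullet> rotv 0 0 1" for t by (simp add: inner_pt)
  have cg: "continuous_on S ?g" for S unfolding g by (rule C1c_line_continuous[OF f])
  have ends: "f (rotv 0 a R) = 0" "f (rotv 0 a (-R)) = 0"
    using norm_rotv_ge(2)[of R 0 a] norm_rotv_ge(2)[of "-R" 0 a] z by auto
  have ftc: "(?g has_integral f (rotv 0 a y) - f (rotv 0 a x)) {x..y}" if "x \<le> y" for x y
    unfolding g using that C1c_vector_derivative[OF f]
    by (intro fundamental_theorem_of_calculus) (auto intro: has_vector_derivative_at_within)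
  have i: "\<bar>integral {x..y} ?g\<bar> \<le> integral {x..y} (\<lambda>b. \<bar>?g b\<bar>)" for x y
  proof -
    have "norm (integral {x..y} ?g) \<le> integral {x..y} (\<lambda>b. \<bar>?g b\<bar>)"
      by (intro integral_norm_bound_integral integrable_continuous_interval continuous_intros cg) auto
    then show ?thesis by simp
  qed
  have "integral {-R..b} ?g = f (rotv 0 a b)" "integral {b..R} ?g = - f (rotv 0 a b)"
    using ftc[of "-R" b] ftc[of b R] b ends by (auto intro: integral_unique)
  then have "2 * f (rotv 0 a b) \<le> integral {-R..b} (\<lambda>b. \<bar>?g b\<bar>) + integral {b..R} (\<lambda>b. \<bar>?g b\<bar>)"
    using i[of "-R" b] i[of b R] by linarith
  also have "\<dots> = integral {-R..R} (\<lambda>b. \<bar>?g b\<bar>)"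
    using b by (intro Henstock_Kurzweil_Integration.integral_combine integrable_continuous_interval continuous_intros cg) auto
  finally show ?thesis .
qed

text \<open>Cauchy-Schwarz against a unit vector, with the discarded square written out. The modulus
  is on the second coordinate only: the sign of the first is needed for the integration by parts,
  while the second enters through its total variation.\<close>

lemma rotation_le_norm:
  fixes v :: pt
  assumes "0 \<le> sin t"
  shows "cos t * v $ 1 + sin t * \<bar>v $ 2\<bar> \<le> norm v"
proof -
  have "(cos t * v $ 1 + sin t * \<bar>v $ 2\<bar>)\<^sup>2 + (sin t * v $ 1 - cos t * \<bar>v $ 2\<bar>)\<^sup>2
    = ((sin t)\<^sup>2 + (cos t)\<^sup>2) * ((v $ 1)\<^sup>2 + \<bar>v $ 2\<bar>\<^sup>2)" by algebra
  then have "(cos t * v $ 1 + sin t * \<bar>v $ 2\<bar>)\<^sup>2 \<le> (v $ 1)\<^sup>2 + (v $ 2)\<^sup>2"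
    by simp (metis le_add_same_cancel1 zero_le_power2)
  then show ?thesis unfolding norm_pt by (rule real_le_rsqrt)
qed

lemma two_sqrt_mult_le:
  fixes p m q r :: real
  assumes "0 \<le> p" "p * m\<^sup>2 \<le> q * r" "0 \<le> q" "0 \<le> r"
  shows "2 * sqrt p * m \<le> q + r"
proof (rule power2_le_imp_le)
  have "(2 * sqrt p * m)\<^sup>2 = 4 * (p * m\<^sup>2)" using assms(1) by (simp add: power_mult_distrib)
  moreover have "4 * (q * r) \<le> (q + r)\<^sup>2"
    using zero_le_power2[of "q - r"] by (simp add: power2_diff power2_sum)
  ultimately show "(2 * sqrt p * m)\<^sup>2 \<le> (q + r)\<^sup>2" using assms(2) by linarith
qed (use assms in auto)

text \<open>Push the density \<open>f\<^sup>2\<close> forward to the unit disc along the first coordinate: \<open>\<tau> a\<close> is the angle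
  of the point of the circle above the image of \<open>a\<close>, and \<open>(cos \<tau>, sin \<tau>)\<close> calibrates the gradient.\<close>

theorem sobolev_L1:
  assumes f: "C1c f" and nonneg: "\<And>x. 0 \<le> f x"
  shows "4 * pi * (\<integral>x. (f x)\<^sup>2 \<partial>lborel) \<le> (\<integral>x. norm (grad f x) \<partial>lborel)\<^sup>2"
proof -
  obtain R0 where R0: "R0 > 0" "\<And>x. R0 < norm x \<Longrightarrow> f x = 0" "\<And>x. R0 < norm x \<Longrightarrow> grad f x = 0"
    using C1c_support[OF f] by blast
  \<comment> \<open>The extra 1 makes f vanish on the sphere of radius R itself, so all sections are
    0 at both ends of the interval.\<close>
  define R where "R = R0 + 1"
  have R: "R > 0" "\<And>x. R \<le> norm x \<Longrightarrow> f x = 0" "\<And>x. R \<le> norm x \<Longrightarrow> grad f x = 0"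
    using R0 by (auto simp: R_def)
  let ?I = "{-R..R}"
  define H where "H a = integral ?I (\<lambda>b. f (rotv 0 a b))" for a
  define H' where "H' a = integral ?I (\<lambda>b. grad f (rotv 0 a b) $ 1)" for a
  define K where "K a = integral ?I (\<lambda>b. \<bar>grad f (rotv 0 a b) $ 2\<bar>)" for a
  define m where "m a = integral ?I (\<lambda>b. (f (rotv 0 a b))\<^sup>2)" for a
  define B where "B a = integral ?I (\<lambda>b. norm (grad f (rotv 0 a b)))" for a
  define c where "c = integral ?I m"
  have cf: "continuous_on S (\<lambda>b. f (rotv 0 a b))" for a S
    by (intro continuous_on_compose2[OF C1c_continuous[OF f, of UNIV]] continuous_intros) auto
  have cg: "continuous_on S (\<lambda>b. grad f (rotv 0 a b))" for a S
    by (intro continuous_on_compose2[OF C1c_continuous_grad[OF f, of UNIV]] continuous_intros) auto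
  note ic = integrable_continuous_interval
  have int2: "(\<integral>x. (f x)\<^sup>2 \<partial>lborel) = c" unfolding c_def m_def
    using R by (intro lborel_integral_box continuous_intros C1c_continuous[OF f]) auto
  have intn: "(\<integral>x. norm (grad f x) \<partial>lborel) = integral ?I B" unfolding B_def
    using R by (intro lborel_integral_box continuous_intros C1c_continuous_grad[OF f]) auto
  have cm: "continuous_on S m" and cB: "continuous_on S B" for S
    unfolding m_def B_def
    by (intro continuous_section_integral continuous_intros C1c_continuous[OF f] C1c_continuous_grad[OF f])+
  have m0: "0 \<le> m a" and H0: "0 \<le> H a" and K0: "0 \<le> K a" and B0: "0 \<le> B a" for a
    unfolding m_def H_def K_def B_def
    by (intro integral_nonneg ic continuous_intros cf cg; simp add: nonneg)+
  have H'1: "(H has_real_derivative H' a) (at a)" for a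
    unfolding H_def[abs_def] H'_def by (rule section_derivative[OF f])
  \<comment> \<open>On one section f^2 is at most f times its maximum, and the maximum is at most K
    a / 2.\<close>
  have mKH: "m a \<le> K a * H a / 2" for a
  proof -
    have "m a \<le> integral ?I (\<lambda>b. (K a / 2) * f (rotv 0 a b))" unfolding m_def
    proof (intro integral_le ic continuous_intros cf)
      fix b assume "b \<in> ?I"
      then have "2 * f (rotv 0 a b) \<le> K a"
        unfolding K_def using R by (intro section_sup_bound[OF f]) auto
      then show "(f (rotv 0 a b))\<^sup>2 \<le> K a / 2 * f (rotv 0 a b)"
        unfolding power2_eq_square using nonneg by (intro mult_right_mono) auto
    qed
    then show ?thesis by (simp add: H_def)
  qed
  have mH: "H a = 0" "H' a = 0" if "m a = 0" for a
  proof -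
    have "\<forall>b\<in>?I. (f (rotv 0 a b))\<^sup>2 = 0"
      using that R(1) unfolding m_def
      by (subst (asm) integral_eq_0_iff) (auto intro!: continuous_intros cf)
    then have "H a = integral ?I (\<lambda>_. 0)" unfolding H_def by (intro integral_cong) auto
    then show "H a = 0" by simp
    \<comment> \<open>H is nonnegative, so a zero of H is a minimum.\<close>
    then show "H' a = 0" using H0 by (intro DERIV_local_min[OF H'1, of 1]) auto
  qed
  have c0: "0 \<le> c" unfolding c_def by (intro integral_nonneg ic cm) (use m0 in auto)
  show ?thesis
  proof (cases "c = 0")
    case True then show ?thesis by (simp add: int2)
  next
    case False
    with c0 have c: "c > 0" by simp
    define M where "M a = integral {-R..a} m / c" for a
    define \<tau> where "\<tau> a = disc_angle (M a)" for a
    have split: "integral {-R..a} m + integral {a..R} m = c" if "a \<in> ?I" for a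
      unfolding c_def using that by (intro Henstock_Kurzweil_Integration.integral_combine ic cm) auto
    have Mnn: "0 \<le> integral {x..y} m" for x y
      by (intro integral_nonneg ic cm) (use m0 in auto)
    have M01: "M a \<in> {0..1}" if "a \<in> ?I" for a
      using split[OF that] Mnn[of "-R" a] Mnn[of a R] c by (auto simp: M_def field_simps)
    have M_pos: "0 < M a" "M a < 1" if "a \<in> {-R<..<R}" "m a > 0" for a
    proof -
      have "integral {-R..a} m \<noteq> 0" "integral {a..R} m \<noteq> 0"
        using that integral_eq_0_iff[OF cm, of "-R" a] integral_eq_0_iff[OF cm, of a R] m0
        by (auto intro!: bexI[of _ a])
      then show "0 < M a" "M a < 1"
        using split[of a] Mnn[of "-R" a] Mnn[of a R] c that by (auto simp: M_def field_simps)
    qed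
    have M_DERIV: "(M has_real_derivative m a / c) (at a)" if "a \<in> {-R<..<R}" for a
    proof -
      have "((\<lambda>x. integral {-R..x} m) has_real_derivative m a) (at a within ?I)"
        using that by (intro integral_has_real_derivative cm) auto
      then have "((\<lambda>x. integral {-R..x} m) has_real_derivative m a) (at a)"
        using that at_within_interior[of a ?I] by simp
      then show ?thesis unfolding M_def[abs_def] by (rule DERIV_cdivide)
    qed
    have cM: "continuous_on ?I M" unfolding M_def[abs_def]
      by (intro continuous_intros indefinite_integral_continuous_1 ic cm) (use c in auto)
    have c\<tau>: "continuous_on ?I \<tau>" unfolding \<tau>_def[abs_def]
      by (rule continuous_on_compose2[OF disc_angle_continuous cM]) (use M01 in auto)
    have sin\<tau>: "0 \<le> sin (\<tau> a)" if "a \<in> ?I" for a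
      using disc_angle(1)[OF M01[OF that]] by (auto simp: \<tau>_def intro: sin_ge_zero)
    \<comment> \<open>The derivative of H cos \<tau>. Where m a = 0 the formula may be meaningless,
      since M a can be 0 or 1 there; H has a double zero at such a point and the derivative is
      0.\<close>
    define D where "D a = (if m a = 0 then 0 else
      H' a * cos (\<tau> a) - H a * (sin (\<tau> a) * (pi / (2 * (sin (\<tau> a))\<^sup>2) * (m a / c))))" for a
    have D: "((\<lambda>a. H a * cos (\<tau> a)) has_real_derivative D a) (at a)" if a: "a \<in> {-R<..<R}" for a
    proof (cases "m a = 0")
      case True
      have "((\<lambda>a. H a * cos (\<tau> a)) has_real_derivative 0) (at a)"
        using H'1[of a] mH[OF True] by (intro DERIV_mult_bounded_at_zero) auto
      then show ?thesis using True by (simp add: D_def)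
    next
      case False
      then have "m a > 0" using m0[of a] by auto
      note Mp = M_pos[OF a this]
      have "(\<tau> has_real_derivative pi / (2 * (sin (\<tau> a))\<^sup>2) * (m a / c)) (at a)"
        unfolding \<tau>_def using DERIV_chain2[OF disc_angle_DERIV(2)[OF Mp] M_DERIV[OF a]] .
      then show ?thesis using False
        by (auto intro!: derivative_eq_intros H'1 simp: D_def)
    qed
    have HR: "H R = 0" "H (-R) = 0"
    proof -
      have "f (rotv 0 R b) = 0" "f (rotv 0 (-R) b) = 0" for b
        using R norm_rotv_ge(1)[of R 0 b] norm_rotv_ge(1)[of "-R" 0 b] by auto
      then show "H R = 0" "H (-R) = 0" by (simp_all add: H_def)
    qed
    have cH: "continuous_on S H" for S
      using H'1 by (meson DERIV_isCont continuous_at_imp_continuous_on)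
    have "(D has_integral H R * cos (\<tau> R) - H (-R) * cos (\<tau> (-R))) ?I"
      using R(1) D
      by (intro fundamental_theorem_of_calculus_interior continuous_intros cH c\<tau>)
        (auto simp: has_real_derivative_iff_has_vector_derivative)
    then have D_int: "(D has_integral 0) ?I" by (simp add: HR)
    \<comment> \<open>This is what the choice of \<tau> is made for: its derivative carries 1 /
      sin^2 \<tau>, so ?q has sin \<tau> in the denominator and ?r has it in the numerator. The
      product is free of \<tau>, and the arithmetic-geometric mean inequality bounds the sum below
      by a multiple of m a.\<close>
    have key: "D a + 2 * sqrt (pi / c) * m a \<le> B a" if a: "a \<in> ?I" for a
    proof (cases "m a = 0")
      case True then show ?thesis using B0 by (simp add: D_def)
    next
      case False
      then have mp: "m a > 0" using m0[of a] by auto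
      have aI: "a \<in> {-R<..<R}"
      proof -
        have "f (rotv 0 R b) = 0" "f (rotv 0 (-R) b) = 0" for b
          using R norm_rotv_ge(1)[of R 0 b] norm_rotv_ge(1)[of "-R" 0 b] by auto
        then have "m R = 0" "m (-R) = 0" by (simp_all add: m_def)
        then show ?thesis using a False by (auto simp: less_le)
      qed
      have s: "0 < sin (\<tau> a)"
        unfolding \<tau>_def using disc_angle_DERIV(1) M_pos[OF aI mp] by auto
      let ?q = "H a * pi * m a / (2 * c * sin (\<tau> a))" and ?r = "sin (\<tau> a) * K a"
      have Deq: "D a = cos (\<tau> a) * H' a - ?q"
        using False s by (simp add: D_def power2_eq_square ac_simps)
      have "cos (\<tau> a) * H' a + sin (\<tau> a) * K a =
         integral ?I (\<lambda>b. cos (\<tau> a) * grad f (rotv 0 a b) $ 1 + sin (\<tau> a) * \<bar>grad f (rotv 0 a b) $ 2\<bar>)"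
        unfolding H'_def K_def
        by (subst Henstock_Kurzweil_Integration.integral_add)
          (auto intro!: ic continuous_intros cg)
      also have "\<dots> \<le> B a" unfolding B_def
        using s by (intro integral_le ic continuous_intros cg rotation_le_norm) auto
      finally have 1: "cos (\<tau> a) * H' a + ?r \<le> B a" .
      have qr: "0 \<le> ?q" "0 \<le> ?r" using H0[of a] K0[of a] m0[of a] c s by auto
      have "?q * ?r = pi / c * m a * (K a * H a / 2)" using s by (simp add: field_simps)
      also have "\<dots> \<ge> pi / c * m a * m a" using mKH[of a] m0[of a] c by (intro mult_left_mono) auto
      finally have 2: "pi / c * (m a)\<^sup>2 \<le> ?q * ?r" by (simp add: power2_eq_square mult.assoc)
      have "2 * sqrt (pi / c) * m a \<le> ?q + ?r"
        using 2 qr m0[of a] c by (intro two_sqrt_mult_le) auto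
      then show ?thesis using 1 Deq by linarith
    qed
    \<comment> \<open>D integrates to 0 because H vanishes at both ends, which leaves 2 sqrt (pi c)
      as a lower bound for the integral of the gradient.\<close>
    have "((\<lambda>a. D a + 2 * sqrt (pi / c) * m a) has_integral 0 + 2 * sqrt (pi / c) * c) ?I"
      using integrable_integral[OF ic[OF cm, of "-R" R]]
      by (intro has_integral_add D_int has_integral_mult_right) (simp add: c_def)
    then have "2 * sqrt (pi / c) * c \<le> integral ?I B"
      using key integrable_integral[OF ic[OF cB, of "-R" R]] by (auto intro: has_integral_le)
    then have "(2 * sqrt (pi / c) * c)\<^sup>2 \<le> (integral ?I B)\<^sup>2"
      using c by (intro power_mono) auto
    moreover have "(2 * sqrt (pi / c) * c)\<^sup>2 = 4 * pi * c"
    proof -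
      have "(2 * sqrt (pi / c) * c)\<^sup>2 = 4 * (pi / c) * c\<^sup>2" using c by (simp add: power_mult_distrib)
      then show ?thesis using c by (simp add: power2_eq_square)
    qed
    ultimately show ?thesis by (simp add: int2 intn)
  qed
qed

subsection \<open>Smooth bumps\<close>

text \<open>The powers in the denominator close the family under differentiation up to linear
  combinations. At 0 the difference quotient of \<open>bump j\<close> is
  \<open>bump (Suc j)\<close>, so the limit there is the same for all j.\<close>

definition bump :: "nat \<Rightarrow> real \<Rightarrow> real" where
  "bump j u = (if 0 < u then exp (- 1 / u) / u ^ j else 0)"

lemma bump_nonneg: "0 \<le> bump j u"
  by (simp add: bump_def)

lemma bump_tendsto_0: "(bump j \<longlongrightarrow> 0) (at 0)"
proof (rule filterlim_split_at)
  show "(bump j \<longlongrightarrow> 0) (at_left 0)"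
    by (rule tendsto_eventually) (auto simp: bump_def eventually_at_filter)
  have "((\<lambda>u. inverse u ^ j / exp (inverse u)) \<longlongrightarrow> 0) (at_right (0::real))"
    by (rule filterlim_compose[OF tendsto_power_div_exp_0 filterlim_inverse_at_top_right])
  then show "(bump j \<longlongrightarrow> 0) (at_right 0)"
    by (rule Lim_transform_eventually)
      (auto simp: bump_def eventually_at_filter exp_minus field_simps)
qed

lemma bump_DERIV: "(bump j has_real_derivative (bump (j + 2) u - j * bump (j + 1) u)) (at u)"
proof -
  consider "u > 0" | "u < 0" | "u = 0" by linarith
  then show ?thesis
  proof cases
    case 1
    have "((\<lambda>u. exp (- 1 / u) * inverse u ^ j) has_real_derivative
        exp (- 1 / u) * (1 / u\<^sup>2) * inverse u ^ j
        + exp (- 1 / u) * (j * inverse u ^ (j - 1) * - ((inverse u)\<^sup>2))) (at u)"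
      using 1 by (auto intro!: derivative_eq_intros simp: power2_eq_square divide_inverse)
    moreover have "exp (- 1 / u) * (1 / u\<^sup>2) * inverse u ^ j
        + exp (- 1 / u) * (j * inverse u ^ (j - 1) * - ((inverse u)\<^sup>2))
      = bump (j + 2) u - j * bump (j + 1) u"
      using 1 by (cases j) (auto simp: bump_def field_simps power2_eq_square)
    ultimately have "((\<lambda>u. exp (- 1 / u) * inverse u ^ j) has_real_derivative
      (bump (j + 2) u - j * bump (j + 1) u)) (at u)" by simp
    then show ?thesis
      by (rule has_field_derivative_transform_within_open[of _ _ _ "{0<..}"]) (use 1 in \<open>auto simp: bump_def field_simps\<close>)
  next
    case 2
    have "((\<lambda>u. 0) has_real_derivative (bump (j + 2) u - j * bump (j + 1) u)) (at u)"
      using 2 by (simp add: bump_def)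
    then show ?thesis
      by (rule has_field_derivative_transform_within_open[of _ _ _ "{..<0}"]) (use 2 in \<open>auto simp: bump_def\<close>)
  next
    case 3
    have "((\<lambda>h. bump j h / h) \<longlongrightarrow> 0) (at 0)"
      by (rule Lim_transform_eventually[OF bump_tendsto_0[of "Suc j"]])
        (auto simp: bump_def eventually_at_filter)
    then show ?thesis using 3 by (simp add: has_field_derivative_iff bump_def)
  qed
qed

text \<open>Polynomials and bumps of one fixed radial argument. The algebra is closed under partial
  derivatives, which gives smoothness in the sense of \<open>iter_pd\<close> by induction over the
  list of directions, without formulas for higher derivatives.\<close>

inductive_set bump_algebra :: "real \<Rightarrow> real \<Rightarrow> (pt \<Rightarrow> real) set" for a b where
  const: "(\<lambda>_. c) \<in> bump_algebra a b"
| coord: "(\<lambda>x. x $ i) \<in> bump_algebra a b"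
| add: "f \<in> bump_algebra a b \<Longrightarrow> g \<in> bump_algebra a b \<Longrightarrow> (\<lambda>x. f x + g x) \<in> bump_algebra a b"
| mult: "f \<in> bump_algebra a b \<Longrightarrow> g \<in> bump_algebra a b \<Longrightarrow> (\<lambda>x. f x * g x) \<in> bump_algebra a b"
| bump: "(\<lambda>x. bump j (a + b * (x \<bullet> x))) \<in> bump_algebra a b"

lemma bump_radial_derivative:
  "((\<lambda>x. bump j (a + b * (x \<bullet> x))) has_derivative
    (\<lambda>w. ((bump (j + 2) (a + b * (x \<bullet> x)) - j * bump (j + 1) (a + b * (x \<bullet> x))) * (2 * b)) *\<^sub>R x \<bullet> w)) (at (x::pt))"
proof -
  have "((\<lambda>x. a + b * (x \<bullet> x)) has_derivative (\<lambda>w. 2 * b * (x \<bullet> w))) (at x)"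
    by (auto intro!: derivative_eq_intros simp: inner_commute algebra_simps)
  from has_derivative_compose[OF this bump_DERIV[of j, unfolded has_field_derivative_def]]
  show ?thesis by (simp add: algebra_simps)
qed

lemma bump_algebra_derivative:
  assumes "f \<in> bump_algebra a b"
  shows "\<exists>f'. (\<forall>x. (f has_derivative (\<lambda>w. f' x \<bullet> w)) (at x)) \<and> (\<forall>i. (\<lambda>x. f' x $ i) \<in> bump_algebra a b)"
  using assms
proof induction
  case (const c)
  show ?case by (rule exI[of _ "\<lambda>_. 0"]) (auto intro: bump_algebra.const)
next
  case (coord i)
  have "(\<lambda>x. axis i 1 $ j) \<in> bump_algebra a b" for j by (rule bump_algebra.const)
  moreover have "((\<lambda>x. x $ i) has_derivative (\<lambda>w. axis i 1 \<bullet> w)) (at x)" for x :: pt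
    using bounded_linear_imp_has_derivative[OF bounded_linear_vec_nth] by (simp add: inner_commute[of "axis i 1"])
  ultimately show ?case by (intro exI[of _ "\<lambda>_. axis i 1"]) auto
next
  case (add f g)
  then obtain f' g' where *: "\<And>x. (f has_derivative (\<lambda>w. f' x \<bullet> w)) (at x)" "\<And>i. (\<lambda>x. f' x $ i) \<in> bump_algebra a b"
    "\<And>x. (g has_derivative (\<lambda>w. g' x \<bullet> w)) (at x)" "\<And>i. (\<lambda>x. g' x $ i) \<in> bump_algebra a b" by blast
  show ?case
    by (rule exI[of _ "\<lambda>x. f' x + g' x"])
      (auto intro!: derivative_eq_intros * bump_algebra.add simp: inner_add_left)
next
  case (mult f g)
  then obtain f' g' where *: "\<And>x. (f has_derivative (\<lambda>w. f' x \<bullet> w)) (at x)" "\<And>i. (\<lambda>x. f' x $ i) \<in> bump_algebra a b"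
    "\<And>x. (g has_derivative (\<lambda>w. g' x \<bullet> w)) (at x)" "\<And>i. (\<lambda>x. g' x $ i) \<in> bump_algebra a b" by blast
  show ?case
    by (rule exI[of _ "\<lambda>x. f x *\<^sub>R g' x + g x *\<^sub>R f' x"])
      (auto intro!: derivative_eq_intros * bump_algebra.add bump_algebra.mult mult.hyps
        simp: inner_add_left algebra_simps)
next
  case (bump j)
  let ?f' = "\<lambda>x::pt. ((bump (j + 2) (a + b * (x \<bullet> x)) - j * bump (j + 1) (a + b * (x \<bullet> x))) * (2 * b)) *\<^sub>R x"
  have "(\<lambda>x. ((bump (j + 2) (a + b * (x \<bullet> x)) + (- real j) * bump (j + 1) (a + b * (x \<bullet> x))) * (2 * b)) * x $ i)
     \<in> bump_algebra a b" for i
    by (intro bump_algebra.intros)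
  then show ?case 
    by (intro exI[of _ ?f'] conjI allI bump_radial_derivative) simp
qed

lemma bump_algebra_smooth:
  assumes "f \<in> bump_algebra a b" shows "smooth_fun f"
proof -
  have pd: "pd i f \<in> bump_algebra a b" if f: "f \<in> bump_algebra a b" for f i
  proof -
    obtain f' where f': "\<And>x. (f has_derivative (\<lambda>w. f' x \<bullet> w)) (at x)" "\<And>i. (\<lambda>x. f' x $ i) \<in> bump_algebra a b"
      using bump_algebra_derivative[OF f] by blast
    have "pd i f = (\<lambda>x. f' x $ i)"
    proof
      fix x show "pd i f x = f' x $ i"
        using frechet_derivative_at[OF f'(1)[of x], symmetric] by (simp add: pd_def)
    qed
    then show ?thesis using f'(2) by simp
  qed
  have "iter_pd is f \<in> bump_algebra a b" for "is"
    by (induction "is") (auto simp: assms pd)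
  then show ?thesis unfolding smooth_fun_def differentiable_def
    using bump_algebra_derivative by blast
qed

lemma test_fun_C1c:
  assumes "test_fun \<Omega> \<phi>" shows "C1c \<phi>"
proof -
  have s: "iter_pd is \<phi> differentiable (at x)" for "is" x
    using assms by (auto simp: test_fun_def smooth_fun_def)
  have "continuous_on UNIV (pd i \<phi>)" for i
    using s[of "[i]"] by (auto simp: differentiable_on_def intro!: differentiable_imp_continuous_on)
  then have "continuous_on UNIV (grad \<phi>)"
    unfolding grad_def[abs_def] by (intro continuous_on_vec_lambda) auto
  moreover have "bounded (tsupport \<phi>)" using assms by (auto simp: test_fun_def compact_imp_bounded)
  then obtain R where "\<And>x. x \<in> tsupport \<phi> \<Longrightarrow> norm x \<le> R" by (auto simp: bounded_iff)
  then have "\<phi> x = 0" if "R < norm x" for x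
    using that closure_subset[of "{x. \<phi> x \<noteq> 0}"] by (force simp: tsupport_def)
  ultimately show ?thesis using s[of "[]"] by (auto simp: C1c_def)
qed

lemma test_fun_zero_outside:
  assumes "test_fun \<Omega> \<phi>" "x \<notin> \<Omega>" shows "\<phi> x = 0" "grad \<phi> x = 0"
proof -
  have x: "x \<notin> tsupport \<phi>" using assms by (auto simp: test_fun_def)
  then show "\<phi> x = 0" using closure_subset[of "{x. \<phi> x \<noteq> 0}"] by (auto simp: tsupport_def)
  have o: "open (- tsupport \<phi>)" by (auto simp: tsupport_def)
  have "(\<phi> has_derivative (\<lambda>w. 0)) (at x)"
    by (rule has_derivative_transform_within_open[where f="\<lambda>_. 0", OF _ o])
      (use x closure_subset[of "{x. \<phi> x \<noteq> 0}"] in \<open>auto simp: tsupport_def\<close>)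
  then show "grad \<phi> x = 0" using grad_unique[of \<phi> 0] by simp
qed

lemma test_funI:
  assumes "smooth_fun \<phi>" "closed K" "bounded K" "\<And>x. x \<notin> K \<Longrightarrow> \<phi> x = 0" "K \<subseteq> \<Omega>"
  shows "test_fun \<Omega> \<phi>"
proof -
  have "tsupport \<phi> \<subseteq> K" unfolding tsupport_def
    using assms by (intro closure_minimal) auto
  then show ?thesis using assms
    by (auto simp: test_fun_def tsupport_def compact_eq_bounded_closed intro: bounded_subset)
qed

lemma integral_pos_continuous:
  fixes f :: "pt \<Rightarrow> real"
  assumes "continuous_on UNIV f" "integrable lborel f" "\<And>x. 0 \<le> f x" "f a > 0"
  shows "0 < (\<integral>x. f x \<partial>lborel)"
proof -
  have "open {x. f x > f a / 2}" by (intro open_Collect_less continuous_intros assms)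
  then obtain e where e: "e > 0" "ball a e \<subseteq> {x. f x > f a / 2}"
    using assms(4) by (force simp: open_contains_ball)
  have "0 < measure lborel (ball a e) * (f a / 2)"
    using content_ball_pos[OF e(1), of a] assms(4) by simp
  also have "\<dots> = (\<integral>x. indicator (ball a e) x * (f a / 2) \<partial>lborel)" by simp
  also have "\<dots> \<le> (\<integral>x. f x \<partial>lborel)"
  proof (rule integral_mono[OF _ assms(2)])
    show "integrable lborel (\<lambda>x. indicator (ball a e) x * (f a / 2))"
      by (intro integrable_mult_left integrable_real_indicator emeasure_bounded_finite) auto
  qed (use e assms in \<open>auto simp: indicator_def intro: less_imp_le\<close>)
  finally show ?thesis .
qed

text \<open>Evenness of \<rho>, and with it oddness of its gradient, is what lets a convolution be
  moved from one factor of an integral to the other.\<close>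

lemma mollifier_exists:
  assumes "\<epsilon> > 0"
  obtains \<rho> where "C1c \<rho>" "\<And>x. 0 \<le> \<rho> x" "\<And>x. \<epsilon> \<le> norm x \<Longrightarrow> \<rho> x = 0"
    "\<And>x. \<rho> (- x) = \<rho> x" "\<And>x. grad \<rho> (- x) = - grad \<rho> x" "(\<integral>x. \<rho> x \<partial>lborel) = 1"
proof -
  define b where "b x = bump 0 (\<epsilon>\<^sup>2 + (-1) * (x \<bullet> x))" for x :: pt
  have zero: "b x = 0" if "\<epsilon> \<le> norm x" for x
    using that assms power_mono[of \<epsilon> "norm x" 2] by (simp add: b_def bump_def dot_square_norm not_less)
  have "test_fun UNIV b"
  proof (rule test_funI[where K="cball 0 \<epsilon>"])
    show "smooth_fun b" unfolding b_def by (rule bump_algebra_smooth[OF bump_algebra.bump])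
  qed (use zero in auto)
  then have b: "C1c b" by (rule test_fun_C1c)
  define c where "c = (\<integral>x. b x \<partial>lborel)"
  have bi: "integrable lborel b"
    by (rule C1c_integrable[OF b C1c_continuous[OF b]])
  have c: "c > 0" unfolding c_def
    using assms by (intro integral_pos_continuous[of _ 0] C1c_continuous[OF b] bi) (auto simp: b_def bump_def)
  define \<rho> where "\<rho> x = b x / c" for x
  have \<rho>d: "(\<rho> has_derivative (\<lambda>w. (grad b x /\<^sub>R c) \<bullet> w)) (at x)" for x
    unfolding \<rho>_def using c
    by (auto intro!: derivative_eq_intros C1c_has_derivative[OF b] simp: field_simps)
  have \<rho>: "C1c \<rho>" "grad \<rho> x = grad b x /\<^sub>R c" for x
    using zero by (auto intro!: C1cI[OF \<rho>d, of \<epsilon>] continuous_intros C1c_continuous_grad[OF b] simp: \<rho>_def)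
  have even: "\<rho> (- x) = \<rho> x" for x by (simp add: \<rho>_def b_def)
  have "((\<lambda>x. \<rho> (- x)) has_derivative (\<lambda>w. (- grad \<rho> (- x)) \<bullet> w)) (at x)" for x
    using has_derivative_compose[of uminus uminus x UNIV \<rho>, OF _ C1c_has_derivative[OF \<rho>(1)]]
    by (auto intro!: derivative_eq_intros)
  then have "grad \<rho> x = - grad \<rho> (- x)" for x by (intro grad_unique) (simp add: even)
  then have odd: "grad \<rho> (- x) = - grad \<rho> x" for x by (metis minus_minus)
  have "(\<integral>x. \<rho> x \<partial>lborel) = 1" using c by (simp add: \<rho>_def c_def)
  then show ?thesis
    using \<rho> even odd c zero by (intro that[of \<rho>]) (auto simp: \<rho>_def b_def bump_nonneg)
qed

subsection \<open>Convolution with a C1 kernel\<close>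

lemma uniformly_continuous_bounded_support:
  fixes f :: "'a::euclidean_space \<Rightarrow> 'b::real_normed_vector"
  assumes "continuous_on UNIV f" "\<And>x. R < norm x \<Longrightarrow> f x = 0" "e > 0"
  obtains d where "d > 0" "\<And>x y. norm (x - y) < d \<Longrightarrow> norm (f x - f y) < e"
proof -
  have "uniformly_continuous_on (cball 0 (R + 1)) f"
    using assms(1) by (intro compact_uniformly_continuous) (auto intro: continuous_on_subset)
  then obtain d where d: "d > 0"
    "\<And>x y. x \<in> cball 0 (R+1) \<Longrightarrow> y \<in> cball 0 (R+1) \<Longrightarrow> dist x y < d \<Longrightarrow> dist (f x) (f y) < e"
    unfolding uniformly_continuous_on_def using assms(3) by meson
  have "norm (f x - f y) < e" if "norm (x - y) < min d 1" for x y
  proof (cases "norm x \<le> R + 1 \<and> norm y \<le> R + 1")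
    case True then show ?thesis using d(2)[of x y] that by (simp add: dist_norm)
  next
    case False
    have "norm x - norm y < 1" "norm y - norm x < 1"
      using that norm_triangle_ineq2[of x y] norm_triangle_ineq2[of y x] by (auto simp: norm_minus_commute)
    then show ?thesis using False assms by auto
  qed
  then show ?thesis using d(1) that[of "min d 1"] by auto
qed

text \<open>Uniformity in z allows differentiation under the convolution integral with a factor that
  is merely integrable.\<close>

lemma C1c_uniform_remainder:
  assumes f: "C1c f" and "e > 0"
  obtains d where "d > 0" "\<And>z w. norm w < d \<Longrightarrow> \<bar>f (z + w) - f z - grad f z \<bullet> w\<bar> \<le> e * norm w"
proof -
  obtain R where R: "\<And>x. R < norm x \<Longrightarrow> grad f x = 0" using C1c_support[OF f] by metis
  obtain d where d: "d > 0" "\<And>x y. norm (x - y) < d \<Longrightarrow> norm (grad f x - grad f y) < e"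
    using uniformly_continuous_bounded_support[OF C1c_continuous_grad[OF f] R \<open>e > 0\<close>] by blast
  have "\<bar>f (z + w) - f z - grad f z \<bullet> w\<bar> \<le> e * norm w" if w: "norm w < d" for z w
  proof -
    have "norm (f (z + w) - f z - grad f z \<bullet> ((z + w) - z)) \<le> norm ((z + w) - z) * e"
    proof (rule differentiable_bound_linearization[where S="cball z (norm w)" and f'="\<lambda>x w. grad f x \<bullet> w" and ?x0.0=z])
      fix t :: real assume "t \<in> {0..1}"
      then show "z + t *\<^sub>R (z + w - z) \<in> cball z (norm w)"
        by (auto simp: dist_norm mult_left_le_one_le)
    next
      fix x assume "x \<in> cball z (norm w)"
      then have "norm (grad f x - grad f z) < e" using w d(2)[of x z] by (simp add: dist_norm norm_minus_commute)
      then have "norm ((grad f x - grad f z) \<bullet> v) \<le> e * norm v" for v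
        using Cauchy_Schwarz_ineq2[of "grad f x - grad f z" v] mult_right_mono[of "norm (grad f x - grad f z)" e "norm v"]
        by simp
      then show "onorm ((\<lambda>w. grad f x \<bullet> w) - (\<lambda>w. grad f z \<bullet> w)) \<le> e"
        by (intro onorm_le) (simp add: inner_diff_left)
    qed (auto intro: has_derivative_at_withinI C1c_has_derivative[OF f])
    then show ?thesis by (simp add: mult.commute)
  qed
  then show ?thesis using d(1) that by blast
qed

lemma bounded_support_bound:
  fixes f :: "'a::euclidean_space \<Rightarrow> 'b::real_normed_vector"
  assumes "continuous_on UNIV f" "\<And>x. R < norm x \<Longrightarrow> f x = 0"
  obtains B where "\<And>x. norm (f x) \<le> B" "0 \<le> B"
proof -
  have "compact (f ` cball 0 R)"
    by (intro compact_continuous_image compact_cball) (use assms(1) continuous_on_subset in blast)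
  then have "bounded (f ` cball 0 R)" by (rule compact_imp_bounded)
  then obtain B where B: "\<forall>y\<in>f ` cball 0 R. norm y \<le> B" by (auto simp: bounded_iff)
  have "norm (f x) \<le> max B 0" for x
  proof (cases "norm x \<le> R")
    case True
    then have "f x \<in> f ` cball 0 R" by auto
    then show ?thesis using B by (metis max.coboundedI1)
  qed (use assms(2)[of x] in auto)
  then show ?thesis by (rule that) simp
qed

lemma integrable_kernel:
  fixes k :: "pt \<Rightarrow> real" and u :: "pt \<Rightarrow> 'b::{banach, second_countable_topology}"
  assumes k: "continuous_on UNIV k" "\<And>x. R < norm x \<Longrightarrow> k x = 0" and u: "integrable lborel u"
  shows "integrable lborel (\<lambda>y. k (z - y) *\<^sub>R u y)"
proof -
  obtain B where B: "\<And>x. norm (k x) \<le> B"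
    using bounded_support_bound[OF k] by blast
  have [measurable]: "k \<in> borel_measurable borel" by (rule borel_measurable_continuous_onI[OF k(1)])
  have [measurable]: "u \<in> borel_measurable borel" using u by auto
  show ?thesis
  proof (rule Bochner_Integration.integrable_bound)
    show "integrable lborel (\<lambda>y. B * norm (u y))" using u by simp
    show "AE y in lborel. norm (k (z - y) *\<^sub>R u y) \<le> norm (B * norm (u y))"
    proof (rule AE_I2)
      fix y
      have "norm (k (z - y)) * norm (u y) \<le> B * norm (u y)" by (intro mult_right_mono B) auto
      also have "\<dots> \<le> norm (B * norm (u y))" by simp
      finally show "norm (k (z - y) *\<^sub>R u y) \<le> norm (B * norm (u y))" by simp
    qed
  qed measurable
qed

lemma integral_norm_le:
  fixes f :: "'a \<Rightarrow> 'b::{banach, second_countable_topology}"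
  assumes "integrable M f" "integrable M g" "\<And>x. norm (f x) \<le> g x"
  shows "norm (\<integral>x. f x \<partial>M) \<le> (\<integral>x. g x \<partial>M)"
  by (rule order_trans[OF integral_norm_bound integral_mono]) (use assms in auto)

lemma convolution_continuous:
  fixes k :: "pt \<Rightarrow> real" and u :: "pt \<Rightarrow> 'b::{banach, second_countable_topology}"
  assumes k: "continuous_on UNIV k" "\<And>x. R < norm x \<Longrightarrow> k x = 0" and u: "integrable lborel u"
  shows "continuous_on S (\<lambda>z. \<integral>y. k (z - y) *\<^sub>R u y \<partial>lborel)"
proof -
  note i = integrable_kernel[OF k u]
  define U where "U = (\<integral>y. norm (u y) \<partial>lborel)"
  have U: "U \<ge> 0" by (simp add: U_def)
  have "continuous_on UNIV (\<lambda>z. \<integral>y. k (z - y) *\<^sub>R u y \<partial>lborel)"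
    unfolding continuous_on_iff
  proof (intro ballI allI impI)
    fix z :: pt and e :: real assume "e > 0"
    \<comment> \<open>The summand 1 keeps the quotient meaningful when u vanishes almost
      everywhere.\<close>
    then have "e / (U + 1) > 0" using U by (intro divide_pos_pos add_nonneg_pos) auto
    from uniformly_continuous_bounded_support[OF k this]
    obtain d where d: "d > 0" "\<And>x y. norm (x - y) < d \<Longrightarrow> norm (k x - k y) < e / (U + 1)" by blast
    have "dist (\<integral>y. k (x - y) *\<^sub>R u y \<partial>lborel) (\<integral>y. k (z - y) *\<^sub>R u y \<partial>lborel) < e"
      if x: "dist x z < d" for x
    proof -
      have "dist (\<integral>y. k (x - y) *\<^sub>R u y \<partial>lborel) (\<integral>y. k (z - y) *\<^sub>R u y \<partial>lborel)
         = norm (\<integral>y. (k (x - y) - k (z - y)) *\<^sub>R u y \<partial>lborel)"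
        by (simp add: dist_norm scaleR_diff_left Bochner_Integration.integral_diff[OF i i])
      also have "\<dots> \<le> (\<integral>y. e / (U + 1) * norm (u y) \<partial>lborel)"
      proof (rule integral_norm_le)
        show "integrable lborel (\<lambda>y. (k (x - y) - k (z - y)) *\<^sub>R u y)"
          unfolding scaleR_diff_left by (intro Bochner_Integration.integrable_diff i)
        fix y
        have "norm (k (x - y) - k (z - y)) \<le> e / (U + 1)" using d(2)[of "x - y" "z - y"] x by (simp add: dist_norm)
        then show "norm ((k (x - y) - k (z - y)) *\<^sub>R u y) \<le> e / (U + 1) * norm (u y)"
          unfolding norm_scaleR real_norm_def by (rule mult_right_mono) auto
      qed (use u in auto)
      also have "\<dots> = e * (U / (U + 1))" by (simp add: U_def)
      also have "\<dots> < e" using U \<open>e > 0\<close> by (simp add: field_simps)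
      finally show ?thesis .
    qed
    then show "\<exists>d>0. \<forall>x\<in>UNIV. dist x z < d \<longrightarrow>
       dist (\<integral>y. k (x - y) *\<^sub>R u y \<partial>lborel) (\<integral>y. k (z - y) *\<^sub>R u y \<partial>lborel) < e"
      using d(1) by blast
  qed
  then show ?thesis using continuous_on_subset by blast
qed

lemma convolution_derivative:
  fixes u :: "pt \<Rightarrow> 'b::{banach, second_countable_topology}"
  assumes \<rho>: "C1c \<rho>" and u: "integrable lborel u"
  shows "((\<lambda>z. \<integral>y. \<rho> (z - y) *\<^sub>R u y \<partial>lborel) has_derivative
    (\<lambda>w. \<integral>y. (grad \<rho> (z - y) \<bullet> w) *\<^sub>R u y \<partial>lborel)) (at z)"
proof -
  obtain R where R: "\<And>x. R < norm x \<Longrightarrow> \<rho> x = 0" "\<And>x. R < norm x \<Longrightarrow> grad \<rho> x = 0" using C1c_support[OF \<rho>] by metis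
  have i1: "integrable lborel (\<lambda>y. \<rho> (z - y) *\<^sub>R u y)" for z
    by (intro integrable_kernel[OF C1c_continuous[OF \<rho>] R(1) u])
  have i2: "integrable lborel (\<lambda>y. (grad \<rho> (z - y) \<bullet> w) *\<^sub>R u y)" for z w
    by (rule integrable_kernel[of "\<lambda>x. grad \<rho> x \<bullet> w" R]) (auto intro!: continuous_intros C1c_continuous_grad[OF \<rho>] simp: R u)
  define U where "U = (\<integral>y. norm (u y) \<partial>lborel)"
  have U: "U \<ge> 0" by (simp add: U_def)
  have lin: "linear (\<lambda>w. \<integral>y. (grad \<rho> (z - y) \<bullet> w) *\<^sub>R u y \<partial>lborel)"
  proof (rule linearI)
    fix v w show "(\<integral>y. (grad \<rho> (z - y) \<bullet> (v + w)) *\<^sub>R u y \<partial>lborel) =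
      (\<integral>y. (grad \<rho> (z - y) \<bullet> v) *\<^sub>R u y \<partial>lborel) + (\<integral>y. (grad \<rho> (z - y) \<bullet> w) *\<^sub>R u y \<partial>lborel)"
      by (simp add: inner_add_right scaleR_add_left Bochner_Integration.integral_add[OF i2 i2])
  next
    fix c w show "(\<integral>y. (grad \<rho> (z - y) \<bullet> (c *\<^sub>R w)) *\<^sub>R u y \<partial>lborel) = c *\<^sub>R (\<integral>y. (grad \<rho> (z - y) \<bullet> w) *\<^sub>R u y \<partial>lborel)"
      by (simp flip: scaleR_scaleR)
  qed
  show ?thesis unfolding has_derivative_at_alt
  proof (intro conjI allI impI)
    show "bounded_linear (\<lambda>w. \<integral>y. (grad \<rho> (z - y) \<bullet> w) *\<^sub>R u y \<partial>lborel)"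
      using lin by (simp add: linear_conv_bounded_linear)
    fix e :: real assume "e > 0"
    then have "e / (U + 1) > 0" using U by (intro divide_pos_pos add_nonneg_pos) auto
    from C1c_uniform_remainder[OF \<rho> this]
    obtain d where d: "d > 0" "\<And>z w. norm w < d \<Longrightarrow> \<bar>\<rho> (z + w) - \<rho> z - grad \<rho> z \<bullet> w\<bar> \<le> e / (U + 1) * norm w" by blast
    have "norm ((\<integral>y. \<rho> (x - y) *\<^sub>R u y \<partial>lborel) - (\<integral>y. \<rho> (z - y) *\<^sub>R u y \<partial>lborel) -
       (\<integral>y. (grad \<rho> (z - y) \<bullet> (x - z)) *\<^sub>R u y \<partial>lborel)) \<le> e * norm (x - z)" if x: "norm (x - z) < d" for x
    proof -
      have eq: "(\<integral>y. \<rho> (x - y) *\<^sub>R u y \<partial>lborel) - (\<integral>y. \<rho> (z - y) *\<^sub>R u y \<partial>lborel) -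
       (\<integral>y. (grad \<rho> (z - y) \<bullet> (x - z)) *\<^sub>R u y \<partial>lborel) =
       (\<integral>y. (\<rho> (x - y) - \<rho> (z - y) - grad \<rho> (z - y) \<bullet> (x - z)) *\<^sub>R u y \<partial>lborel)"
        unfolding scaleR_diff_left
        by (simp only: Bochner_Integration.integral_diff i1 i2 Bochner_Integration.integrable_diff)
      have "norm (\<integral>y. (\<rho> (x - y) - \<rho> (z - y) - grad \<rho> (z - y) \<bullet> (x - z)) *\<^sub>R u y \<partial>lborel)
        \<le> (\<integral>y. e / (U + 1) * norm (x - z) * norm (u y) \<partial>lborel)"
      proof (rule integral_norm_le)
        show "integrable lborel (\<lambda>y. (\<rho> (x - y) - \<rho> (z - y) - grad \<rho> (z - y) \<bullet> (x - z)) *\<^sub>R u y)"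
          unfolding scaleR_diff_left by (intro Bochner_Integration.integrable_diff i1 i2)
        fix y
        have "\<bar>\<rho> (x - y) - \<rho> (z - y) - grad \<rho> (z - y) \<bullet> (x - z)\<bar> \<le> e / (U + 1) * norm (x - z)"
          using d(2)[OF x, of "z - y"] by (simp add: algebra_simps)
        then show "norm ((\<rho> (x - y) - \<rho> (z - y) - grad \<rho> (z - y) \<bullet> (x - z)) *\<^sub>R u y) \<le> e / (U + 1) * norm (x - z) * norm (u y)"
          unfolding norm_scaleR real_norm_def by (rule mult_right_mono) auto
      qed (use u in auto)
      also have "\<dots> = (e * norm (x - z)) * (U / (U + 1))" by (simp add: U_def)
      also have "\<dots> \<le> (e * norm (x - z)) * 1"
        using U \<open>e > 0\<close> by (intro mult_left_mono) (auto simp: field_simps)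
      finally show ?thesis unfolding eq by simp
    qed
    then show "\<exists>d>0. \<forall>x. norm (x - z) < d \<longrightarrow> norm ((\<integral>y. \<rho> (x - y) *\<^sub>R u y \<partial>lborel) - (\<integral>y. \<rho> (z - y) *\<^sub>R u y \<partial>lborel) -
       (\<integral>y. (grad \<rho> (z - y) \<bullet> (x - z)) *\<^sub>R u y \<partial>lborel)) \<le> e * norm (x - z)"
      using d(1) by blast
  qed
qed

lemma distr_reflect: "distr lborel borel (\<lambda>x. z - x) = (lborel :: pt measure)"
  using lborel_affine[of "-1" z] by (simp add: density_1)

lemma integral_reflect:
  fixes f :: "pt \<Rightarrow> 'b::{banach, second_countable_topology}"
  assumes "f \<in> borel_measurable borel"
  shows "(\<integral>x. f (z - x) \<partial>lborel) = (\<integral>x. f x \<partial>lborel)"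
  using integral_distr[of "\<lambda>x. z - x" lborel borel f] assms by (simp add: distr_reflect)

subsection \<open>Perimeter\<close>

text \<open>Mollification does not increase total variation. The integral of |grad f| is that of
  grad f against its unit direction \<eta>; Fubini moves the mollifier from the indicator onto
  \<eta>, and the mollified \<eta>, up to sign, is a C1 field of length at most 1, hence a
  competitor in \<open>perimeter\<close>.\<close>

lemma smoothed_indicator:
  assumes \<Omega>: "open \<Omega>" "bounded \<Omega>" and "\<epsilon> > 0"
  obtains f where "C1c f" "\<And>x. 0 \<le> f x" "\<And>x. ball x \<epsilon> \<subseteq> \<Omega> \<Longrightarrow> f x = 1"
    "ereal (\<integral>x. norm (grad f x) \<partial>lborel) \<le> perimeter \<Omega>"
proof -
  obtain \<rho> where \<rho>: "C1c \<rho>" "\<And>x. 0 \<le> \<rho> x" "\<And>x. \<epsilon> \<le> norm x \<Longrightarrow> \<rho> x = 0"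
    "\<And>x. \<rho> (- x) = \<rho> x" "\<And>x. grad \<rho> (- x) = - grad \<rho> x" "(\<integral>x. \<rho> x \<partial>lborel) = 1"
    using mollifier_exists[OF \<open>\<epsilon> > 0\<close>] by metis
  obtain R\<rho> where R\<rho>: "\<And>x. R\<rho> < norm x \<Longrightarrow> \<rho> x = 0" "\<And>x. R\<rho> < norm x \<Longrightarrow> grad \<rho> x = 0"
    using C1c_support[OF \<rho>(1)] by metis
  obtain R\<Omega> where R\<Omega>: "\<And>x. x \<in> \<Omega> \<Longrightarrow> norm x \<le> R\<Omega>" using \<Omega>(2) by (auto simp: bounded_iff)
  have [measurable]: "\<Omega> \<in> sets borel" using \<Omega>(1) by simp
  note [measurable] = C1c_measurable[OF \<rho>(1)]
  define u where "u = (indicator \<Omega> :: pt \<Rightarrow> real)"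
  have [measurable]: "u \<in> borel_measurable borel" by (simp add: u_def)
  have u: "integrable lborel u"
    unfolding u_def by (intro integrable_real_indicator emeasure_bounded_finite \<Omega>) simp
  have cg: "continuous_on UNIV (\<lambda>x. grad \<rho> x \<bullet> w)" for w
    by (intro continuous_intros C1c_continuous_grad[OF \<rho>(1)])
  have gR: "grad \<rho> x \<bullet> w = 0" if "R\<rho> < norm x" for x w using R\<rho>(2)[OF that] by simp
  define f where "f z = (\<integral>y. \<rho> (z - y) *\<^sub>R u y \<partial>lborel)" for z
  define v :: "pt \<Rightarrow> pt" where "v z = (\<chi> i. \<integral>y. (grad \<rho> (z - y) \<bullet> axis i 1) *\<^sub>R u y \<partial>lborel)" for z
  have int_g: "integrable lborel (\<lambda>y. (grad \<rho> (z - y) \<bullet> w) *\<^sub>R h y)" if "integrable lborel h" for z w and h :: "pt \<Rightarrow> 'b::{banach, second_countable_topology}"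
    using integrable_kernel[OF cg[of w] gR that] by auto
  have int_r: "integrable lborel (\<lambda>y. \<rho> (z - y) *\<^sub>R h y)" if "integrable lborel h" for z and h :: "pt \<Rightarrow> 'b::{banach, second_countable_topology}"
    using integrable_kernel[OF C1c_continuous[OF \<rho>(1)] R\<rho>(1) that] by auto
  have int_1: "integrable lborel (\<lambda>y. \<rho> (z - y))" for z
    using integrable_distr_eq[of "\<lambda>x. z - x" lborel borel \<rho>] C1c_integrable[OF \<rho>(1) C1c_continuous[OF \<rho>(1)]]
    by (simp add: distr_reflect)
  have one: "(\<integral>y. \<rho> (z - y) \<partial>lborel) = 1" for z using integral_reflect[of \<rho> z] \<rho>(6) by simp
  have v_inner: "v z \<bullet> w = (\<integral>y. (grad \<rho> (z - y) \<bullet> w) *\<^sub>R u y \<partial>lborel)" for z w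
  proof -
    have "(grad \<rho> (z - y) \<bullet> w) *\<^sub>R u y = (grad \<rho> (z - y) \<bullet> axis 1 1) *\<^sub>R u y * w $ 1
      + (grad \<rho> (z - y) \<bullet> axis 2 1) *\<^sub>R u y * w $ 2" for y by (simp add: inner_pt algebra_simps axis_def)
    then show ?thesis
      by (simp only: Bochner_Integration.integral_add int_g[OF u] integrable_mult_left integral_mult_left)
        (simp add: v_def inner_pt)
  qed
  have fd: "(f has_derivative (\<lambda>w. v z \<bullet> w)) (at z)" for z
    unfolding f_def v_inner by (rule convolution_derivative[OF \<rho>(1) u])
  have cv: "continuous_on UNIV v" unfolding v_def[abs_def]
    by (intro continuous_on_vec_lambda convolution_continuous[OF cg gR u])
  have fz: "f x = 0" if "R\<Omega> + \<epsilon> < norm x" for x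
  proof -
    have "\<rho> (x - y) *\<^sub>R u y = 0" for y
    proof (cases "y \<in> \<Omega>")
      case True
      then have "\<epsilon> \<le> norm (x - y)" using R\<Omega>[OF True] that norm_triangle_ineq2[of x y] by linarith
      then show ?thesis using \<rho>(3) by simp
    qed (simp add: u_def)
    then show ?thesis unfolding f_def by (simp only: integral_zero)
  qed
  have f: "C1c f" "grad f x = v x" for x
    using C1cI[OF fd cv fz] by auto
  have f0: "0 \<le> f x" for x unfolding f_def
    by (intro integral_nonneg_AE AE_I2) (simp add: \<rho>(2) u_def)
  have f1: "f x = 1" if "ball x \<epsilon> \<subseteq> \<Omega>" for x
  proof -
    have "\<rho> (x - y) *\<^sub>R u y = \<rho> (x - y)" for y
    proof (cases "y \<in> \<Omega>")
      case False
      then have "y \<notin> ball x \<epsilon>" using that by auto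
      then show ?thesis using \<rho>(3)[of "x - y"] by (simp add: dist_norm)
    qed (simp add: u_def)
    then show ?thesis unfolding f_def by (simp only: one)
  qed
  obtain R where R: "R > 0" "\<And>x. R < norm x \<Longrightarrow> v x = 0" using C1c_support[OF f(1)] f(2) by metis
  have [measurable]: "v \<in> borel_measurable borel" by (rule borel_measurable_continuous_onI[OF cv])
  \<comment> \<open>Where v vanishes the value is 0, because \<open>inverse 0 = 0\<close>. In
    general \<eta> is discontinuous and no admissible field itself.\<close>
  define \<eta> where "\<eta> x = v x /\<^sub>R norm (v x)" for x
  have [measurable]: "\<eta> \<in> borel_measurable borel" unfolding \<eta>_def[abs_def] by measurable
  have \<eta>1: "norm (\<eta> x) \<le> 1" for x
    by (cases "v x = 0") (simp_all add: \<eta>_def)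
  have \<eta>v: "v x \<bullet> \<eta> x = norm (v x)" for x
    by (cases "v x = 0") (simp_all add: \<eta>_def dot_square_norm power2_eq_square)
  have \<eta>0: "\<eta> x = 0" if "R < norm x" for x using R(2)[OF that] by (simp add: \<eta>_def)
  have icb: "integrable lborel (indicator (cball 0 R) :: pt \<Rightarrow> real)"
    by (intro integrable_real_indicator emeasure_bounded_finite bounded_cball) simp
  have \<eta>: "integrable lborel \<eta>"
  proof (rule Bochner_Integration.integrable_bound[OF icb])
    show "AE x in lborel. norm (\<eta> x) \<le> norm (indicator (cball 0 R) x :: real)"
      using \<eta>1 \<eta>0 by (intro AE_I2) (auto simp: indicator_def not_le)
  qed simp
  \<comment> \<open>The sign anticipates that \<open>grad \<rho>\<close> is odd. The bound on X
    follows from |\<eta>| \<le> 1 and the total mass 1 of the nonnegative \<rho>.\<close>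
  define X where "X y = - (\<integral>x. \<rho> (y - x) *\<^sub>R \<eta> x \<partial>lborel)" for y
  have Xd: "(X has_derivative (\<lambda>w. - (\<integral>x. (grad \<rho> (y - x) \<bullet> w) *\<^sub>R \<eta> x \<partial>lborel))) (at y)" for y
    unfolding X_def by (intro has_derivative_minus convolution_derivative[OF \<rho>(1) \<eta>])
  have frX: "frechet_derivative X (at y) w = - (\<integral>x. (grad \<rho> (y - x) \<bullet> w) *\<^sub>R \<eta> x \<partial>lborel)" for y w
    using fun_cong[OF frechet_derivative_at[OF Xd[of y]], of w] by simp
  have X0: "X y = 0" if "R + \<epsilon> < norm y" for y
  proof -
    have "\<rho> (y - x) *\<^sub>R \<eta> x = 0" for x
    proof (cases "norm x \<le> R")
      case True
      then have "\<epsilon> \<le> norm (y - x)" using that norm_triangle_ineq2[of y x] by linarith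
      then show ?thesis using \<rho>(3) by simp
    qed (use \<eta>0 in auto)
    then show ?thesis unfolding X_def by (simp only: integral_zero minus_zero)
  qed
  have X1: "norm (X y) \<le> 1" for y
  proof -
    have "norm (\<integral>x. \<rho> (y - x) *\<^sub>R \<eta> x \<partial>lborel) \<le> (\<integral>x. \<rho> (y - x) \<partial>lborel)"
    proof (rule integral_norm_le[OF int_r[OF \<eta>] int_1])
      fix x show "norm (\<rho> (y - x) *\<^sub>R \<eta> x) \<le> \<rho> (y - x)"
        using mult_left_le[OF \<eta>1[of x] \<rho>(2)[of "y - x"]] \<rho>(2)[of "y - x"] by simp
    qed
    then show ?thesis by (simp add: X_def one)
  qed
  have "tsupport X \<subseteq> cball 0 (R + \<epsilon>)" unfolding tsupport_def
    using X0 by (intro closure_minimal) (auto, meson not_le)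
  then have "compact (tsupport X)"
    by (auto simp: tsupport_def compact_eq_bounded_closed intro: bounded_subset[OF bounded_cball])
  moreover have "continuous_on UNIV (\<lambda>y. frechet_derivative X (at y) w)" for w
    unfolding frX by (intro continuous_intros convolution_continuous[OF cg gR \<eta>])
  ultimately have X: "C1c_field X" using Xd unfolding C1c_field_def differentiable_def by blast
  have divX: "divergence X y = - (\<integral>x. grad \<rho> (y - x) \<bullet> \<eta> x \<partial>lborel)" for y
  proof -
    define I where "I i = (\<integral>x. grad \<rho> (y - x) $ i * \<eta> x $ i \<partial>lborel)" for i
    have comp: "(\<integral>x. (grad \<rho> (y - x) \<bullet> axis i 1) *\<^sub>R \<eta> x \<partial>lborel) $ i = I i" for i
      using integral_inner_left[OF int_g[OF \<eta>, of y "axis i 1"], of "axis i 1"] by (simp add: I_def)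
    have int: "integrable lborel (\<lambda>x. grad \<rho> (y - x) $ i * \<eta> x $ i)" for i
      using integrable_inner_left[OF int_g[OF \<eta>, of y "axis i 1"], of "axis i 1"] by simp
    have "divergence X y = - I 1 - I 2"
      unfolding divergence_def frX sum_2 vector_uminus_component comp by simp
    moreover have "(\<integral>x. grad \<rho> (y - x) \<bullet> \<eta> x \<partial>lborel) = I 1 + I 2"
      unfolding inner_pt I_def by (rule Bochner_Integration.integral_add[OF int int])
    ultimately show ?thesis by simp
  qed
  obtain B where B: "\<And>x. norm (grad \<rho> x) \<le> B" "B \<ge> 0"
    using bounded_support_bound[OF C1c_continuous_grad[OF \<rho>(1)] R\<rho>(2)] by blast
  define C where "C = cball (0::pt) R"
  define F where "F x y = u y * (grad \<rho> (y - x) \<bullet> \<eta> x)" for x y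
  have F0: "F x y = 0" if "x \<notin> C \<or> y \<notin> \<Omega>" for x y
    using that \<eta>0[of x] by (auto simp: F_def u_def C_def)
  have FB: "\<bar>F x y\<bar> \<le> B" for x y
  proof -
    have "\<bar>grad \<rho> (y - x) \<bullet> \<eta> x\<bar> \<le> norm (grad \<rho> (y - x)) * norm (\<eta> x)" by (rule Cauchy_Schwarz_ineq2)
    also have "\<dots> \<le> B * 1" by (intro mult_mono B \<eta>1) auto
    finally show ?thesis using B(2) by (simp add: F_def u_def indicator_def)
  qed
  have F: "integrable (lborel \<Otimes>\<^sub>M lborel) (case_prod F)"
  proof (rule integrableI_bounded_set[where A="C \<times> \<Omega>" and B=B])
    show "emeasure (lborel \<Otimes>\<^sub>M lborel) (C \<times> \<Omega>) < \<infinity>"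
      using emeasure_bounded_finite[OF \<Omega>(2)] emeasure_bounded_finite[OF bounded_cball[of "0::pt" R, folded C_def]]
      by (subst lborel.emeasure_pair_measure_Times) (auto simp: ennreal_mult_less_top C_def)
    show "AE p in lborel \<Otimes>\<^sub>M lborel. p \<in> C \<times> \<Omega> \<longrightarrow> norm (case_prod F p) \<le> B"
      by (rule AE_I2) (simp add: FB split_beta)
    show "AE p in lborel \<Otimes>\<^sub>M lborel. p \<notin> C \<times> \<Omega> \<longrightarrow> case_prod F p = 0"
    proof (rule AE_I2)
      fix p show "p \<notin> C \<times> \<Omega> \<longrightarrow> case_prod F p = 0"
        using F0[of "fst p" "snd p"] by (cases p) auto
    qed
    have "(\<lambda>p. u (snd p) * (grad \<rho> (snd p - fst p) \<bullet> \<eta> (fst p))) \<in> borel_measurable (borel \<Otimes>\<^sub>M borel)"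
      by measurable
    then show "case_prod F \<in> borel_measurable (lborel \<Otimes>\<^sub>M lborel)"
      unfolding measurable_cong_sets[OF sets_pair_measure_cong[OF sets_lborel sets_lborel] refl]
      by (simp add: F_def split_beta')
    show "C \<times> \<Omega> \<in> sets (lborel \<Otimes>\<^sub>M lborel)" by (intro pair_measureI) (simp_all add: C_def)
  qed
  have uX: "u y * divergence X y = - (\<integral>x. F x y \<partial>lborel)" for y
    unfolding divX F_def by simp
  have "(LINT y:\<Omega>|lborel. divergence X y) = - (\<integral>y. \<integral>x. F x y \<partial>lborel \<partial>lborel)"
    unfolding set_lebesgue_integral_def real_scaleR_def u_def[symmetric] uX by (rule integral_minus)
  also have "(\<integral>y. \<integral>x. F x y \<partial>lborel \<partial>lborel) = (\<integral>x. \<integral>y. F x y \<partial>lborel \<partial>lborel)"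
    by (rule lborel_pair.Fubini_integral[OF F])
  also have "(\<lambda>x. \<integral>y. F x y \<partial>lborel) = (\<lambda>x. - norm (v x))"
  proof
    fix x
    \<comment> \<open>Oddness of the gradient turns the convolution in y - x into the one in x - y
      that defines v.\<close>
    have "F x y = - ((grad \<rho> (x - y) \<bullet> \<eta> x) *\<^sub>R u y)" for y using \<rho>(5)[of "x - y"] by (simp add: F_def)
    then have "(\<integral>y. F x y \<partial>lborel) = - (v x \<bullet> \<eta> x)" unfolding v_inner by simp
    then show "(\<integral>y. F x y \<partial>lborel) = - norm (v x)" by (simp add: \<eta>v)
  qed
  finally have "(LINT y:\<Omega>|lborel. divergence X y) = (\<integral>x. norm (grad f x) \<partial>lborel)" by (simp add: f(2))
  then have "ereal (\<integral>x. norm (grad f x) \<partial>lborel) \<le> perimeter \<Omega>"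
    unfolding perimeter_def using X X1 by (intro SUP_upper2[of X]) auto
  then show ?thesis using f(1) f0 f1 by (intro that[of f])
qed

lemma smoothed_indicators:
  assumes \<Omega>: "open \<Omega>" "bounded \<Omega>" and P: "perimeter \<Omega> = ereal P"
  obtains f where "\<And>n. C1c (f n)" "\<And>n x. 0 \<le> f n x" "\<And>x. x \<in> \<Omega> \<Longrightarrow> \<forall>\<^sub>F n::nat in sequentially. f n x = 1"
    "\<And>n. (\<integral>x. norm (grad (f n) x) \<partial>lborel) \<le> P"
proof -
  define Q where "Q n f \<longleftrightarrow> C1c f \<and> (\<forall>x. 0 \<le> f x) \<and> (\<forall>x. ball x (1 / real (Suc n)) \<subseteq> \<Omega> \<longrightarrow> f x = 1) \<and>
    (\<integral>x. norm (grad f x) \<partial>lborel) \<le> P" for n f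
  have "\<exists>f. Q n f" for n
  proof -
    have "0 < 1 / real (Suc n)" by simp
    from smoothed_indicator[OF \<Omega> this] obtain f where
      "C1c f" "\<And>x. 0 \<le> f x" "\<And>x. ball x (1 / real (Suc n)) \<subseteq> \<Omega> \<Longrightarrow> f x = 1"
      "ereal (\<integral>x. norm (grad f x) \<partial>lborel) \<le> perimeter \<Omega>" by blast
    then show ?thesis using P by (intro exI[of _ f]) (auto simp: Q_def)
  qed
  then obtain f where "\<And>n. Q n (f n)" by metis
  then have f: "\<And>n. C1c (f n)" "\<And>n x. 0 \<le> f n x"
    "\<And>n x. ball x (1 / real (Suc n)) \<subseteq> \<Omega> \<Longrightarrow> f n x = 1" "\<And>n. (\<integral>x. norm (grad (f n) x) \<partial>lborel) \<le> P"
    by (simp_all add: Q_def)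
  have "\<forall>\<^sub>F n in sequentially. f n x = 1" if x: "x \<in> \<Omega>" for x
  proof -
    obtain e where e: "e > 0" "ball x e \<subseteq> \<Omega>" by (rule openE[OF \<Omega>(1) x])
    have "\<forall>\<^sub>F n in sequentially. 1 / real (Suc n) < e"
      using order_tendstoD(2)[OF LIMSEQ_inverse_real_of_nat e(1)] by (simp add: inverse_eq_divide)
    then show ?thesis
    proof eventually_elim
      case (elim n)
      then have "ball x (1 / real (Suc n)) \<subseteq> ball x e" by (intro subset_ball) simp
      then show ?case using e(2) by (intro f(3)) blast
    qed
  qed
  with f(1,2,4) show ?thesis by (intro that[of f])
qed

text \<open>Transfers a uniform bound from approximations to the limit. It asks only for an eventual
  lower bound at each point, so nothing needs to be known about the mollified indicators outside
  \<Omega>.\<close>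

lemma fatou_bound:
  assumes [measurable]: "\<And>n. g n \<in> borel_measurable M"
    and "\<And>x. x \<in> space M \<Longrightarrow> \<forall>\<^sub>F n in sequentially. c x \<le> g n x" "\<And>n. (\<integral>\<^sup>+x. g n x \<partial>M) \<le> B"
  shows "(\<integral>\<^sup>+x. c x \<partial>M) \<le> (B :: ennreal)"
proof -
  have "(\<integral>\<^sup>+x. c x \<partial>M) \<le> (\<integral>\<^sup>+x. liminf (\<lambda>n. g n x) \<partial>M)"
    by (intro nn_integral_mono Liminf_bounded assms)
  also have "\<dots> \<le> liminf (\<lambda>n. \<integral>\<^sup>+x. g n x \<partial>M)" by (rule nn_integral_liminf) simp
  also have "\<dots> \<le> limsup (\<lambda>n. \<integral>\<^sup>+x. g n x \<partial>M)" by (rule Liminf_le_Limsup) simp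
  also have "\<dots> \<le> B" by (intro Limsup_bounded always_eventually allI assms)
  finally show ?thesis .
qed

lemma perimeter_nonneg: "0 \<le> perimeter E"
proof -
  have "tsupport (\<lambda>_. 0 :: pt) = {}" by (simp add: tsupport_def)
  then have "C1c_field (\<lambda>_. 0)" "divergence (\<lambda>_. 0) x = 0" for x
    using frechet_derivative_const[of "0::pt"] by (auto simp: C1c_field_def divergence_def)
  then have "ereal 0 \<le> perimeter E" unfolding perimeter_def
    by (intro SUP_upper2[of "\<lambda>_. 0"]) (auto simp: set_lebesgue_integral_def)
  then show ?thesis by (simp add: zero_ereal_def)
qed

theorem isoperimetric:
  assumes \<Omega>: "open \<Omega>" "bounded \<Omega>" and P: "perimeter \<Omega> = ereal P"
  shows "4 * pi * measure lborel \<Omega> \<le> P\<^sup>2"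
proof -
  obtain f where f: "\<And>n. C1c (f n)" "\<And>n x. 0 \<le> f n x" "\<And>x. x \<in> \<Omega> \<Longrightarrow> \<forall>\<^sub>F n::nat in sequentially. f n x = 1"
    "\<And>n. (\<integral>x. norm (grad (f n) x) \<partial>lborel) \<le> P" using smoothed_indicators[OF assms] by metis
  have [measurable]: "f n \<in> borel_measurable borel" for n using C1c_measurable[OF f(1)] by simp
  have "(\<integral>\<^sup>+x. indicator \<Omega> x \<partial>lborel) \<le> ennreal (P\<^sup>2 / (4 * pi))"
  proof (rule fatou_bound[where g="\<lambda>n x. ennreal ((f n x)\<^sup>2)"])
    fix x :: pt show "\<forall>\<^sub>F n in sequentially. indicator \<Omega> x \<le> ennreal ((f n x)\<^sup>2)"
    proof (cases "x \<in> \<Omega>")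
      case True
      from f(3)[OF this] show ?thesis by eventually_elim (use True in auto)
    qed simp
  next
    fix n
    have "integrable lborel (\<lambda>x. (f n x)\<^sup>2)"
      by (intro C1c_integrable[OF f(1)] continuous_intros C1c_continuous[OF f(1)]) simp
    moreover have "(\<integral>x. norm (grad (f n) x) \<partial>lborel)\<^sup>2 \<le> P\<^sup>2" using f(4) by (intro power_mono) auto
    then have "(\<integral>x. (f n x)\<^sup>2 \<partial>lborel) \<le> P\<^sup>2 / (4 * pi)"
      using sobolev_L1[OF f(1) f(2), of n] by (simp add: field_simps)
    ultimately show "(\<integral>\<^sup>+x. ennreal ((f n x)\<^sup>2) \<partial>lborel) \<le> ennreal (P\<^sup>2 / (4 * pi))"
      by (simp add: nn_integral_eq_integral ennreal_leI)
  qed measurable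
  then have "emeasure lborel \<Omega> \<le> ennreal (P\<^sup>2 / (4 * pi))" using \<Omega>(1) by simp
  moreover have "emeasure lborel \<Omega> < \<infinity>" using \<Omega> by (intro emeasure_bounded_finite)
  ultimately have "measure lborel \<Omega> \<le> P\<^sup>2 / (4 * pi)"
    by (simp add: emeasure_eq_ennreal_measure)
  then show ?thesis by (simp add: field_simps)
qed

section \<open>Equidistant directions, widths of projections and the Cauchy-Crofton bound\<close>

lemma sum_abs_sin_equidistant:
  assumes N: "N > 0"
  shows "(\<Sum>k<N. \<bar>sin (z - pi * real k / real N)\<bar>) \<le> 1 / sin (pi / (2 * real N))"
proof -
  define h where "h = pi / real N"
  have h: "h > 0" "real N * h = pi" using N by (auto simp: h_def)
  define S where "S z = (\<Sum>k<N. \<bar>sin (z - real k * h)\<bar>)" for z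
  \<comment> \<open>A shift by one step drops the last summand and adds a new first one; the two
    arguments differ by pi, which the modulus does not see.\<close>
  have per: "S (z + h) = S z" for z
  proof -
    obtain M where M: "N = Suc M" using N by (cases N) auto
    have "z + h = (z - real M * h) + pi" using h(2) by (simp add: M algebra_simps)
    then have "sin (z + h) = - sin (z - real M * h)" by (simp only: sin_periodic_pi)
    then have "\<bar>sin (z + h)\<bar> = \<bar>sin (z - real M * h)\<bar>" by simp
    moreover have "S (z + h) = \<bar>sin (z + h)\<bar> + (\<Sum>k<M. \<bar>sin (z - real k * h)\<bar>)"
      unfolding S_def M by (subst sum.lessThan_Suc_shift) (simp add: algebra_simps)
    ultimately show ?thesis by (simp add: S_def M)
  qed
  have perj: "S (z + of_int j * h) = S z" for j z
  proof (induction j arbitrary: z rule: int_induct[of _ 0])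
    case (step1 i)
    then show ?case using per[of "z + of_int i * h"] by (simp add: algebra_simps)
  next
    case (step2 i)
    then show ?case using per[of "z + of_int (i - 1) * h"] by (simp add: algebra_simps)
  qed simp
  have hp: "h \<le> pi" using N by (simp add: h_def divide_le_eq)
  have sp: "sin (h / 2) > 0" using h hp by (intro sin_gt_zero) auto
  \<comment> \<open>In this window all N arguments lie between 0 and pi, so the moduli disappear;
    multiplied by 2 sin (h / 2) the sum telescopes to a difference of two cosines. By periodicity
    every z can be moved into the window.\<close>
  have base: "S x \<le> 1 / sin (h / 2)" if x: "pi - h \<le> x" "x < pi" for x
  proof -
    have "2 * sin (h / 2) * \<bar>sin (x - real k * h)\<bar> = cos (x - real (Suc k) * h + h / 2) - cos (x - real k * h + h / 2)"
      if "k < N" for k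
    proof -
      have "real k * h \<le> (real N - 1) * h" using that h(1) by (intro mult_right_mono) auto
      then have "0 \<le> x - real k * h" using h(2) x by (simp add: algebra_simps)
      moreover have "x - real k * h \<le> pi" using x h(1) by (meson diff_le_self less_imp_le mult_nonneg_nonneg of_nat_0_le_iff order_trans diff_left_mono le_diff_eq add_increasing2 diff_le_eq)
      ultimately have "\<bar>sin (x - real k * h)\<bar> = sin (x - real k * h)" using sin_ge_zero by simp
      moreover have "2 * sin b * sin a = cos (a - b) - cos (a + b)" for a b :: real
        by (simp add: cos_diff cos_add)
      from this[of "h/2" "x - real k * h"] have "2 * sin (h / 2) * sin (x - real k * h) = cos (x - real (Suc k) * h + h / 2) - cos (x - real k * h + h / 2)"
        by (simp add: algebra_simps)
      ultimately show ?thesis by simp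
    qed
    then have "2 * sin (h / 2) * S x = (\<Sum>k<N. cos (x - real (Suc k) * h + h / 2) - cos (x - real k * h + h / 2))"
      by (simp add: S_def sum_distrib_left)
    also have "\<dots> = cos (x - real N * h + h / 2) - cos (x + h / 2)"
      by (subst sum_lessThan_telescope) simp
    also have "\<dots> \<le> 2" using cos_le_one[of "x - real N * h + h / 2"] cos_ge_minus_one[of "x + h / 2"] by linarith
    finally show ?thesis using sp by (simp add: field_simps)
  qed
  define j where "j = \<lfloor>(z - (pi - h)) / h\<rfloor>"
  have "of_int j * h \<le> z - (pi - h)" "z - (pi - h) < (of_int j + 1) * h"
    using h(1) by (simp_all add: j_def flip: pos_le_divide_eq pos_divide_less_eq)
  then have "pi - h \<le> z + of_int (- j) * h" "z + of_int (- j) * h < pi" by (auto simp: algebra_simps)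
  from base[OF this] perj have "S z \<le> 1 / sin (h / 2)" by metis
  then show ?thesis by (simp add: S_def h_def mult.commute)
qed

lemma polar_coordinates: obtains t where "(v::pt) = rotv t (norm v) 0"
proof (cases "v = 0")
  case True then show ?thesis using that[of 0] by (simp add: pt_eq_iff)
next
  case False
  then have n: "norm v > 0" by simp
  have "(v $ 1 / norm v)\<^sup>2 + (v $ 2 / norm v)\<^sup>2 = ((v $ 1)\<^sup>2 + (v $ 2)\<^sup>2) / (norm v)\<^sup>2"
    by (simp add: power_divide add_divide_distrib)
  also have "(v $ 1)\<^sup>2 + (v $ 2)\<^sup>2 = (norm v)\<^sup>2" by (simp add: norm_pt)
  also have "(norm v)\<^sup>2 / (norm v)\<^sup>2 = 1" using n by simp
  finally obtain t where "v $ 1 / norm v = cos t" "v $ 2 / norm v = sin t"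
    using sincos_total_2pi by metis
  then have "v $ 1 = norm v * cos t" "v $ 2 = norm v * sin t"
    using n by (simp_all add: nonzero_divide_eq_eq mult.commute)
  then show ?thesis by (intro that[of t]) (simp add: pt_eq_iff)
qed

lemma sum_abs_inner_equidistant:
  assumes "N > 0"
  shows "(\<Sum>k<N. \<bar>v \<bullet> rotv (pi * real k / real N) 0 1\<bar>) \<le> norm v / sin (pi / (2 * real N))"
proof -
  obtain t where t: "v = rotv t (norm v) 0" using polar_coordinates .
  have "\<bar>v \<bullet> rotv \<theta> 0 1\<bar> = norm v * \<bar>sin (t - \<theta>)\<bar>" for \<theta>
  proof -
    have "v \<bullet> rotv \<theta> 0 1 = norm v * sin (t - \<theta>)" by (subst t) (simp add: inner_pt sin_diff algebra_simps)
    then show ?thesis by (simp add: abs_mult)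
  qed
  then have "(\<Sum>k<N. \<bar>v \<bullet> rotv (pi * real k / real N) 0 1\<bar>) = norm v * (\<Sum>k<N. \<bar>sin (t - pi * real k / real N)\<bar>)"
    by (simp add: sum_distrib_left)
  also have "\<dots> \<le> norm v * (1 / sin (pi / (2 * real N)))"
    by (intro mult_left_mono sum_abs_sin_equidistant assms) auto
  finally show ?thesis by simp
qed

definition proj_inf :: "pt set \<Rightarrow> real \<Rightarrow> real" where
  "proj_inf \<Omega> \<theta> = Inf ((\<lambda>x. x \<bullet> rotv \<theta> 1 0) ` \<Omega>)"

definition proj_sup :: "pt set \<Rightarrow> real \<Rightarrow> real" where
  "proj_sup \<Omega> \<theta> = Sup ((\<lambda>x. x \<bullet> rotv \<theta> 1 0) ` \<Omega>)"

lemma proj_bdd: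
  assumes "bounded \<Omega>"
  shows "bdd_above ((\<lambda>x. x \<bullet> rotv \<theta> 1 0) ` \<Omega>)" "bdd_below ((\<lambda>x. x \<bullet> rotv \<theta> 1 0) ` \<Omega>)"
proof -
  have "bounded ((\<lambda>x. x \<bullet> rotv \<theta> 1 0) ` \<Omega>)"
    by (rule bounded_linear_image[OF assms bounded_linear_inner_left])
  then show "bdd_above ((\<lambda>x. x \<bullet> rotv \<theta> 1 0) ` \<Omega>)" "bdd_below ((\<lambda>x. x \<bullet> rotv \<theta> 1 0) ` \<Omega>)"
    by (auto intro: bounded_imp_bdd_above bounded_imp_bdd_below)
qed

lemma proj_bounds:
  assumes "bounded \<Omega>" "x \<in> closure \<Omega>"
  shows "proj_inf \<Omega> \<theta> \<le> x \<bullet> rotv \<theta> 1 0" "x \<bullet> rotv \<theta> 1 0 \<le> proj_sup \<Omega> \<theta>"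
proof -
  have "closure \<Omega> \<subseteq> {x. proj_inf \<Omega> \<theta> \<le> x \<bullet> rotv \<theta> 1 0 \<and> x \<bullet> rotv \<theta> 1 0 \<le> proj_sup \<Omega> \<theta>}"
  proof (rule closure_minimal)
    show "closed {x. proj_inf \<Omega> \<theta> \<le> x \<bullet> rotv \<theta> 1 0 \<and> x \<bullet> rotv \<theta> 1 0 \<le> proj_sup \<Omega> \<theta>}"
      by (intro closed_Collect_conj closed_Collect_le continuous_intros)
  qed (auto simp: proj_inf_def proj_sup_def intro!: cInf_lower cSup_upper proj_bdd assms)
  then show "proj_inf \<Omega> \<theta> \<le> x \<bullet> rotv \<theta> 1 0" "x \<bullet> rotv \<theta> 1 0 \<le> proj_sup \<Omega> \<theta>"
    using assms(2) by auto
qed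

text \<open>The use of connectedness: the projection is an interval, so its length is the difference
  of \<open>proj_sup\<close> and \<open>proj_inf\<close> and every line over its interior meets
  \<Omega>.\<close>

lemma proj_surj:
  assumes "bounded \<Omega>" "connected \<Omega>" "\<Omega> \<noteq> {}" and s: "proj_inf \<Omega> \<theta> < s" "s < proj_sup \<Omega> \<theta>"
  obtains t where "rotv \<theta> s t \<in> \<Omega>"
proof -
  let ?A = "(\<lambda>x. x \<bullet> rotv \<theta> 1 0) ` \<Omega>"
  have "connected ?A" by (intro connected_continuous_image continuous_intros assms)
  moreover obtain a where "a \<in> ?A" "a < s"
    using cInf_lessD[of ?A s] s assms by (auto simp: proj_inf_def)
  moreover obtain b where "b \<in> ?A" "s < b"
    using less_cSupE[of s ?A] s assms by (auto simp: proj_sup_def)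
  ultimately have "s \<in> ?A" by (meson connectedD_interval less_imp_le)
  then obtain x where "x \<in> \<Omega>" "s = x \<bullet> rotv \<theta> 1 0" by auto
  then show ?thesis using rotv_surj[of x \<theta>] that by metis
qed

text \<open>Each line over the projection carries variation at least 2 of the smoothed indicators.
  Fubini gives back the gradient integrated over the plane, where the sum over directions is
  compared with the norm at each point. The factor 1 / sin (pi / (2 N)) is asymptotically 2 N / pi,
  N times the mean of |cos|.\<close>

theorem crofton_bound:
  assumes \<Omega>: "open \<Omega>" "bounded \<Omega>" "connected \<Omega>" "\<Omega> \<noteq> {}" and P: "perimeter \<Omega> = ereal P" and N: "N > 0"
  shows "(\<Sum>k<N. 2 * (proj_sup \<Omega> (pi * real k / real N) - proj_inf \<Omega> (pi * real k / real N)))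
     \<le> P / sin (pi / (2 * real N))"
proof -
  obtain f where f: "\<And>n. C1c (f n)" "\<And>n x. 0 \<le> f n x" "\<And>x. x \<in> \<Omega> \<Longrightarrow> \<forall>\<^sub>F n::nat in sequentially. f n x = 1"
    "\<And>n. (\<integral>x. norm (grad (f n) x) \<partial>lborel) \<le> P" using smoothed_indicators[OF \<Omega>(1,2) P] by metis
  note [measurable] = C1c_measurable[OF f(1)]
  define \<theta> where "\<theta> k = pi * real k / real N" for k
  let ?J = "\<lambda>k. {proj_inf \<Omega> (\<theta> k)<..<proj_sup \<Omega> (\<theta> k)}"
  let ?g = "\<lambda>n k s. \<integral>\<^sup>+t. ennreal \<bar>grad (f n) (rotv (\<theta> k) s t) \<bullet> rotv (\<theta> k) 0 1\<bar> \<partial>lborel"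
  have sp: "sin (pi / (2 * real N)) > 0"
    using N by (intro sin_gt_zero) (auto simp: field_simps intro: less_le_trans[of pi "2 * pi"])
  have w: "proj_inf \<Omega> (\<theta> k) \<le> proj_sup \<Omega> (\<theta> k)" for k
    using \<Omega>(4) proj_bounds[OF \<Omega>(2), of _ "\<theta> k"] closure_subset by fastforce
  have gm [measurable]: "?g n k \<in> borel_measurable lborel" for n k
  proof -
    have [measurable]: "case_prod (rotv (\<theta> k)) \<in> lborel \<Otimes>\<^sub>M lborel \<rightarrow>\<^sub>M borel" by simp
    have "(\<lambda>p. ennreal \<bar>grad (f n) (case_prod (rotv (\<theta> k)) p) \<bullet> rotv (\<theta> k) 0 1\<bar>) \<in> borel_measurable (lborel \<Otimes>\<^sub>M lborel)"
      by measurable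
    then show ?thesis by (intro lborel.borel_measurable_nn_integral) (simp add: split_beta')
  qed
  have "(\<integral>\<^sup>+s. (\<Sum>k<N. 2 * indicator (?J k) s) \<partial>lborel) \<le> ennreal (P / sin (pi / (2 * real N)))"
  proof (rule fatou_bound[where g="\<lambda>n s. \<Sum>k<N. ?g n k s"])
    fix s :: real
    have "\<forall>\<^sub>F n in sequentially. \<forall>k\<in>{..<N}. 2 * indicator (?J k) s \<le> ?g n k s"
    proof (rule eventually_ball_finite)
      show "\<forall>k\<in>{..<N}. \<forall>\<^sub>F n in sequentially. 2 * indicator (?J k) s \<le> ?g n k s"
      proof
        fix k
        show "\<forall>\<^sub>F n in sequentially. 2 * indicator (?J k) s \<le> ?g n k s"
        proof (cases "s \<in> ?J k")
          case True
          then obtain t where "rotv (\<theta> k) s t \<in> \<Omega>" using proj_surj[OF \<Omega>(2,3,4)] by auto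
          from f(3)[OF this] show ?thesis
          proof eventually_elim
            case (elim n)
            then show ?case using C1c_line_nn_integral[OF f(1)[of n], of "\<theta> k" s t] True by simp
          qed
        qed simp
      qed
    qed simp
    then show "\<forall>\<^sub>F n in sequentially. (\<Sum>k<N. 2 * indicator (?J k) s) \<le> (\<Sum>k<N. ?g n k s)"
      by eventually_elim (rule sum_mono, blast)
  next
    fix n
    have ig: "integrable lborel (\<lambda>x. norm (grad (f n) x))" "integrable lborel (\<lambda>x. \<bar>grad (f n) x \<bullet> w\<bar>)" for w
      by (intro C1c_integrable[OF f(1)[of n]] continuous_intros C1c_continuous_grad[OF f(1)]; simp)+
    have "(\<integral>\<^sup>+s. (\<Sum>k<N. ?g n k s) \<partial>lborel) = (\<Sum>k<N. \<integral>\<^sup>+s. ?g n k s \<partial>lborel)"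
      by (rule nn_integral_sum) simp
    also have "\<dots> = (\<Sum>k<N. \<integral>\<^sup>+x. ennreal \<bar>grad (f n) x \<bullet> rotv (\<theta> k) 0 1\<bar> \<partial>lborel)"
      by (intro sum.cong refl nn_integral_rotv[symmetric]) measurable
    also have "\<dots> = (\<integral>\<^sup>+x. (\<Sum>k<N. ennreal \<bar>grad (f n) x \<bullet> rotv (\<theta> k) 0 1\<bar>) \<partial>lborel)"
      by (rule nn_integral_sum[symmetric]) measurable
    also have "\<dots> \<le> (\<integral>\<^sup>+x. ennreal (norm (grad (f n) x) / sin (pi / (2 * real N))) \<partial>lborel)"
      using sum_abs_inner_equidistant[OF N] unfolding \<theta>_def
      by (intro nn_integral_mono) (auto simp: sum_ennreal intro: ennreal_leI)
    also have "\<dots> = ennreal ((\<integral>x. norm (grad (f n) x) \<partial>lborel) / sin (pi / (2 * real N)))"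
      using ig sp by (subst nn_integral_eq_integral) auto
    also have "\<dots> \<le> ennreal (P / sin (pi / (2 * real N)))"
      using f(4)[of n] sp by (intro ennreal_leI divide_right_mono) auto
    finally show "(\<integral>\<^sup>+s. (\<Sum>k<N. ?g n k s) \<partial>lborel) \<le> ennreal (P / sin (pi / (2 * real N)))" .
  qed simp
  also have "(\<integral>\<^sup>+s. (\<Sum>k<N. 2 * indicator (?J k) s) \<partial>lborel) = (\<Sum>k<N. 2 * emeasure lborel (?J k))"
    by (subst nn_integral_sum) (auto simp: nn_integral_cmult)
  also have "\<dots> = (\<Sum>k<N. ennreal (2 * (proj_sup \<Omega> (\<theta> k) - proj_inf \<Omega> (\<theta> k))))"
    using w by (intro sum.cong refl) (simp add: ennreal_mult del: right_diff_distrib_numeral)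
  also have "\<dots> = ennreal (\<Sum>k<N. 2 * (proj_sup \<Omega> (\<theta> k) - proj_inf \<Omega> (\<theta> k)))"
    using w by (intro sum_ennreal) simp
  finally show ?thesis
    using P perimeter_nonneg[of \<Omega>] sp by (subst (asm) ennreal_le_iff) (auto simp: \<theta>_def)
qed

subsection \<open>Logarithmic capacity\<close>

text \<open>\<open>log_dist r \<phi>\<close> is \<open>ln \<bar>1 - r e\<^sup>i\<^sup>\<phi>\<bar>\<close>.\<close>

definition log_dist :: "real \<Rightarrow> real \<Rightarrow> real" where
  "log_dist r \<phi> = ln (1 - 2 * r * cos \<phi> + r\<^sup>2) / 2"

lemma log_dist_arg_pos:
  fixes r \<phi> :: real
  assumes "0 \<le> r" "r < 1" shows "(1 - r)\<^sup>2 \<le> 1 - 2 * r * cos \<phi> + r\<^sup>2" "0 < 1 - 2 * r * cos \<phi> + r\<^sup>2"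
proof -
  have "r * cos \<phi> \<le> r * 1" using assms by (intro mult_left_mono) auto
  then show *: "(1 - r)\<^sup>2 \<le> 1 - 2 * r * cos \<phi> + r\<^sup>2" by (simp add: power2_diff)
  have "0 < (1 - r)\<^sup>2" using assms by simp
  with * show "0 < 1 - 2 * r * cos \<phi> + r\<^sup>2" by linarith
qed

lemma log_dist_measurable [measurable]: "log_dist r \<in> borel_measurable borel"
  unfolding log_dist_def[abs_def] by measurable

lemma log_dist_bounded:
  fixes r :: real
  assumes "0 \<le> r" "r < 1"
  obtains B where "\<And>\<phi>. \<bar>log_dist r \<phi>\<bar> \<le> B"
proof -
  have "\<bar>log_dist r \<phi>\<bar> \<le> \<bar>ln ((1 - r)\<^sup>2)\<bar> + \<bar>ln 4\<bar>" for \<phi>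
  proof -
    note p = log_dist_arg_pos[OF assms, of \<phi>]
    have "r * (- cos \<phi>) \<le> r * 1" using assms cos_ge_minus_one[of \<phi>]
      by (intro mult_left_mono) auto
    moreover have "r\<^sup>2 \<le> 1" using assms by (simp add: power_le_one)
    ultimately have "1 - 2 * r * cos \<phi> + r\<^sup>2 \<le> 4" using assms by simp
    then have "ln (1 - 2 * r * cos \<phi> + r\<^sup>2) \<le> ln 4" using p by simp
    moreover have "ln ((1 - r)\<^sup>2) \<le> ln (1 - 2 * r * cos \<phi> + r\<^sup>2)" using p assms by (intro ln_mono) auto
    ultimately show ?thesis unfolding log_dist_def by linarith
  qed
  then show ?thesis using that by blast
qed

text \<open>Real part of the power series of Ln (1 - w) at w = r e^(i \<phi>). The term n = 0 is 0
  because division by 0 gives 0; all later sums over n < N rely on this as well.\<close>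

lemma log_dist_sums:
  fixes r \<phi> :: real
  assumes "0 \<le> r" "r < 1"
  shows "(\<lambda>n. - (r ^ n * cos (n * \<phi>) / n)) sums log_dist r \<phi>"
proof -
  define w where "w = of_real r * cis \<phi>"
  have nw: "cmod (- w) < 1" using assms by (simp add: w_def norm_mult)
  have "(\<lambda>n. - (w ^ n) / of_nat n) sums Ln (1 - w)" using Ln_series'[OF nw] by simp
  then have "(\<lambda>n. Re (- (w ^ n) / of_nat n)) sums Re (Ln (1 - w))" by (rule sums_Re)
  moreover have "Re (- (w ^ n) / of_nat n) = - (r ^ n * cos (n * \<phi>) / n)" for n
  proof -
    have "w ^ n = of_real (r ^ n) * cis (n * \<phi>)"
      by (simp only: w_def power_mult_distrib Complex.DeMoivre of_real_power)
    then have "Re (w ^ n) = r ^ n * cos (n * \<phi>)" by simp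
    then show ?thesis unfolding Re_divide_of_nat by simp
  qed
  moreover have "Re (Ln (1 - w)) = log_dist r \<phi>"
  proof -
    have eq: "(cmod (1 - w))\<^sup>2 = 1 - 2 * r * cos \<phi> + r\<^sup>2"
    proof -
      have "(cmod (1 - w))\<^sup>2 = (1 - r * cos \<phi>)\<^sup>2 + (r * sin \<phi>)\<^sup>2" by (simp add: cmod_power2 w_def)
      also have "\<dots> = 1 - 2 * r * cos \<phi> + r\<^sup>2 * ((sin \<phi>)\<^sup>2 + (cos \<phi>)\<^sup>2)" by algebra
      finally show ?thesis by simp
    qed
    then have "0 < (cmod (1 - w))\<^sup>2" using log_dist_arg_pos(2)[OF assms, of \<phi>] by (simp only:)
    then have "cmod (1 - w) > 0" by simp
    moreover have "log_dist r \<phi> = ln (cmod (1 - w))"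
      unfolding log_dist_def eq[symmetric] using \<open>cmod (1 - w) > 0\<close> by (simp only: ln_realpow)
    moreover have "1 - w \<noteq> 0" using \<open>cmod (1 - w) > 0\<close> by auto
    ultimately show ?thesis using Re_Ln[of "1 - w"] by simp
  qed
  ultimately show ?thesis by (simp only:)
qed

lemma log_dist_approx:
  fixes r \<phi> :: real
  assumes "0 \<le> r" "r < 1"
  shows "\<bar>log_dist r \<phi> + (\<Sum>n<N. r ^ n * cos (n * \<phi>) / n)\<bar> \<le> r ^ N / (1 - r)"
proof -
  let ?f = "\<lambda>n. - (r ^ n * cos (n * \<phi>) / n)"
  have "(\<lambda>n. ?f (n + N)) sums (log_dist r \<phi> - (\<Sum>n<N. ?f n))"
    by (rule sums_split_initial_segment[OF log_dist_sums[OF assms]])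
  moreover have "(\<lambda>n. r ^ (n + N)) sums (r ^ N / (1 - r))"
    using sums_mult[OF geometric_sums[of r], of "r ^ N"] assms by (simp add: power_add mult.commute)
  moreover have "norm (?f (n + N)) \<le> r ^ (n + N)" for n
  proof (cases "n + N = 0")
    case False
    have "\<bar>cos (real (n + N) * \<phi>)\<bar> / real (n + N) \<le> 1 / 1"
      using False by (intro frac_le) auto
    then have "r ^ (n + N) * (\<bar>cos (real (n + N) * \<phi>)\<bar> / real (n + N)) \<le> r ^ (n + N) * 1"
      using assms by (intro mult_left_mono) auto
    then show ?thesis using assms by (simp add: abs_mult)
  qed auto
  ultimately have "norm (log_dist r \<phi> - (\<Sum>n<N. ?f n)) \<le> r ^ N / (1 - r)"
    using norm_suminf_le[of "\<lambda>n. ?f (n + N)" "\<lambda>n. r ^ (n + N)"] by (simp add: sums_iff)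
  then show ?thesis by (simp add: sum_negf)
qed

text \<open>Geometric sum over the powers of an N-th root of unity, which differs from 1 because n
  is no multiple of N.\<close>

lemma sum_cos_equidistant:
  fixes \<phi> :: real
  assumes "0 < n" "n < N"
  shows "(\<Sum>k<N. cos (real n * (\<phi> + 2 * pi * real k / real N))) = 0"
proof -
  define \<omega> where "\<omega> = cis (2 * pi * real n / real N)"
  have N: "N > 0" using assms by simp
  have "\<omega> \<noteq> 1"
  proof
    assume "\<omega> = 1"
    then have "cos (2 * pi * real n / real N) = 1" by (simp add: \<omega>_def complex_eq_iff)
    then obtain j :: int where "2 * pi * real n / real N = real_of_int j * 2 * pi"
      using cos_one_2pi_int by blast
    then have "2 * pi * (real n / real N) = 2 * pi * real_of_int j" by simp
    then have "real n / real N = real_of_int j" by (simp only: mult_cancel_left) simp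
    moreover have "0 < real n / real N" "real n / real N < 1" using assms by auto
    ultimately show False by (metis of_int_0_less_iff of_int_less_1_iff zless_imp_add1_zle linorder_not_less add_0)
  qed
  moreover have "\<omega> ^ N = 1" 
  proof -
    have "real N * (2 * pi * real n / real N) = 2 * pi * real n" using N by simp
    then have "\<omega> ^ N = cis (2 * pi * real n)" by (simp only: \<omega>_def Complex.DeMoivre)
    then show ?thesis by (simp add: cis_multiple_2pi)
  qed
  ultimately have "(\<Sum>k<N. \<omega> ^ k) = 0" by (simp add: geometric_sum)
  then have "Re (cis (real n * \<phi>) * (\<Sum>k<N. \<omega> ^ k)) = 0" by simp
  moreover have "cis (real n * \<phi>) * \<omega> ^ k = cis (real n * (\<phi> + 2 * pi * real k / real N))" for k
    by (simp add: \<omega>_def Complex.DeMoivre cis_mult algebra_simps)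
  ultimately show ?thesis by (simp add: sum_distrib_left)
qed

text \<open>Discrete mean value property of ln |1 - w|: N equidistant angles annihilate the
  frequencies 0 < n < N exactly, and only the tail from N on is left as an error for each
  angle.\<close>

lemma sum_log_dist_equidistant:
  fixes r \<phi> :: real
  assumes "0 \<le> r" "r < 1" "N > 0"
  shows "- real N * (r ^ N / (1 - r)) \<le> (\<Sum>k<N. log_dist r (\<phi> + 2 * pi * real k / real N))"
proof -
  let ?\<phi> = "\<lambda>k. \<phi> + 2 * pi * real k / real N"
  have "(\<Sum>k<N. - (\<Sum>n<N. r ^ n * cos (n * ?\<phi> k) / n) - r ^ N / (1 - r)) \<le> (\<Sum>k<N. log_dist r (?\<phi> k))"
  proof (rule sum_mono)
    fix k show "- (\<Sum>n<N. r ^ n * cos (n * ?\<phi> k) / n) - r ^ N / (1 - r) \<le> log_dist r (?\<phi> k)"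
      using log_dist_approx[OF assms(1,2), of "?\<phi> k" N] by linarith
  qed
  moreover have "(\<Sum>k<N. \<Sum>n<N. r ^ n * cos (n * ?\<phi> k) / n) = (\<Sum>n<N. \<Sum>k<N. r ^ n * cos (n * ?\<phi> k) / n)"
    by (rule sum.swap)
  moreover have "(\<Sum>k<N. r ^ n * cos (n * ?\<phi> k) / n) = 0" if "n < N" for n
  proof (cases "n = 0")
    case False
    have "(\<Sum>k<N. r ^ n * cos (n * ?\<phi> k) / n) = r ^ n / n * (\<Sum>k<N. cos (n * ?\<phi> k))"
      by (simp add: sum_distrib_left)
    then show ?thesis using sum_cos_equidistant[of n N \<phi>] that False by simp
  qed simp
  ultimately show ?thesis by (simp add: sum_subtractf sum_negf)
qed

text \<open>Since 2 |cos a| = |1 + e^(2 i a)|, doubling the angle turns N directions in a half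
  circle into N equidistant points of the full circle, and the logarithm of a projection becomes
  that of the norm plus a \<open>log_dist\<close>. The radius \<rho> keeps the logarithm finite for
  directions orthogonal to z; the price is an additive term, made independent of z by the bound
  D.\<close>

lemma ln_norm_le_average:
  assumes "0 \<le> \<rho>" "\<rho> < 1" "N > 0" and z: "z \<noteq> (0::pt)" "norm z \<le> D"
  shows "2 * ln (norm z) \<le> 2 * (\<rho> ^ N / (1 - \<rho>)) +
    (\<Sum>k<N. ln (4 * (z \<bullet> rotv (pi * real k / real N) 1 0)\<^sup>2 + ((1 - \<rho>) * D)\<^sup>2)) / N"
proof -
  obtain t where t: "z = rotv t (norm z) 0" using polar_coordinates .
  let ?\<theta> = "\<lambda>k. pi * real k / real N"
  \<comment> \<open>Up to sign this is 2 (t - \<theta>) + pi with \<theta> the k-th direction, the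
    summand pi changing 1 + e^(2 i a) into the form 1 - e^(i \<phi>).\<close>
  let ?\<phi> = "\<lambda>k. (- 2 * t - pi) + 2 * pi * real k / real N"
  have n: "norm z > 0" using z by simp
  have "2 * ln (norm z) + 2 * log_dist \<rho> (?\<phi> k) \<le> ln (4 * (z \<bullet> rotv (?\<theta> k) 1 0)\<^sup>2 + ((1 - \<rho>) * D)\<^sup>2)" for k
  proof -
    have zi: "z \<bullet> rotv (?\<theta> k) 1 0 = norm z * cos (t - ?\<theta> k)"
      by (subst t) (simp add: inner_pt cos_diff algebra_simps)
    have "cos (?\<phi> k) = cos (2 * (t - ?\<theta> k) + pi)"
      by (subst cos_minus[symmetric]) (simp add: algebra_simps)
    also have "\<dots> = - cos (2 * (t - ?\<theta> k))" by (simp only: cos_periodic_pi)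
    also have "\<dots> = 1 - 2 * (cos (t - ?\<theta> k))\<^sup>2" by (simp only: cos_double_cos minus_diff_eq)
    finally have c0: "cos (?\<phi> k) = 1 - 2 * (cos (t - ?\<theta> k))\<^sup>2" .
    have c: "1 - 2 * \<rho> * cos (?\<phi> k) + \<rho>\<^sup>2 = (1 - \<rho>)\<^sup>2 + 4 * \<rho> * (cos (t - ?\<theta> k))\<^sup>2"
      unfolding c0 by algebra
    have pos: "0 < 1 - 2 * \<rho> * cos (?\<phi> k) + \<rho>\<^sup>2" using log_dist_arg_pos assms by simp
    have "2 * ln (norm z) + 2 * log_dist \<rho> (?\<phi> k) = ln ((norm z)\<^sup>2 * (1 - 2 * \<rho> * cos (?\<phi> k) + \<rho>\<^sup>2))"
      using pos n by (simp add: ln_mult log_dist_def ln_realpow)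
    also have "\<dots> \<le> ln (4 * (z \<bullet> rotv (?\<theta> k) 1 0)\<^sup>2 + ((1 - \<rho>) * D)\<^sup>2)"
    proof (rule ln_mono)
      show "0 < (norm z)\<^sup>2 * (1 - 2 * \<rho> * cos (?\<phi> k) + \<rho>\<^sup>2)" using pos n by simp
      have "(norm z)\<^sup>2 * (1 - \<rho>)\<^sup>2 \<le> D\<^sup>2 * (1 - \<rho>)\<^sup>2" using z by (intro mult_right_mono power_mono) auto
      moreover have "\<rho> * ((norm z)\<^sup>2 * (cos (t - ?\<theta> k))\<^sup>2) \<le> 1 * ((norm z)\<^sup>2 * (cos (t - ?\<theta> k))\<^sup>2)"
        using assms by (intro mult_right_mono) auto
      moreover have "(norm z)\<^sup>2 * (1 - 2 * \<rho> * cos (?\<phi> k) + \<rho>\<^sup>2)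
          = (norm z)\<^sup>2 * (1 - \<rho>)\<^sup>2 + 4 * (\<rho> * ((norm z)\<^sup>2 * (cos (t - ?\<theta> k))\<^sup>2))"
        unfolding c by algebra
      moreover have "4 * (z \<bullet> rotv (?\<theta> k) 1 0)\<^sup>2 + ((1 - \<rho>) * D)\<^sup>2
          = 4 * ((norm z)\<^sup>2 * (cos (t - ?\<theta> k))\<^sup>2) + D\<^sup>2 * (1 - \<rho>)\<^sup>2"
        unfolding zi by algebra
      ultimately show "(norm z)\<^sup>2 * (1 - 2 * \<rho> * cos (?\<phi> k) + \<rho>\<^sup>2) \<le> 4 * (z \<bullet> rotv (?\<theta> k) 1 0)\<^sup>2 + ((1 - \<rho>) * D)\<^sup>2"
        by linarith
    qed
    finally show ?thesis .
  qed
  then have "(\<Sum>k<N. 2 * ln (norm z) + 2 * log_dist \<rho> (?\<phi> k)) \<le>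
      (\<Sum>k<N. ln (4 * (z \<bullet> rotv (?\<theta> k) 1 0)\<^sup>2 + ((1 - \<rho>) * D)\<^sup>2))" (is "_ \<le> ?S") by (intro sum_mono)
  then have "real N * (2 * ln (norm z)) + 2 * (\<Sum>k<N. log_dist \<rho> (?\<phi> k)) \<le> ?S"
    by (simp add: sum.distrib sum_distrib_left)
  then have "real N * (2 * ln (norm z)) - 2 * (real N * (\<rho> ^ N / (1 - \<rho>))) \<le> ?S"
    using sum_log_dist_equidistant[OF assms(1,2,3), of "- 2 * t - pi"] by linarith
  then have "real N * (2 * ln (norm z) - 2 * (\<rho> ^ N / (1 - \<rho>))) \<le> ?S"
    by (simp only: right_diff_distrib mult.left_commute[of "real N" 2])
  then have "2 * ln (norm z) - 2 * (\<rho> ^ N / (1 - \<rho>)) \<le> ?S / N"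
    using assms(3) by (simp add: pos_le_divide_eq mult.commute)
  then show ?thesis by linarith
qed

text \<open>The arguments of the logarithms on the right are \<open>\<bar>1 - r e\<^sup>i\<^sup>(\<^sup>\<alpha>\<^sup>-\<^sup>\<beta>\<^sup>)\<bar>\<^sup>2\<close> and \<open>\<bar>1 - r e\<^sup>i\<^sup>(\<^sup>\<alpha>\<^sup>+\<^sup>\<beta>\<^sup>)\<bar>\<^sup>2\<close>; for \<open>r = 1\<close> their product is
  \<open>4 (cos \<alpha> - cos \<beta>)\<^sup>2\<close>.\<close>

lemma log_dist_product_ge:
  fixes r \<alpha> \<beta> :: real
  assumes "0 < r" "r < 1"
  shows "ln (4 * r\<^sup>2 * (cos \<alpha> - cos \<beta>)\<^sup>2 + (1 - r) ^ 4) \<le> 2 * (log_dist r (\<alpha> - \<beta>) + log_dist r (\<alpha> + \<beta>))"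
proof -
  let ?a = "1 - 2 * r * cos (\<alpha> - \<beta>) + r\<^sup>2" and ?b = "1 - 2 * r * cos (\<alpha> + \<beta>) + r\<^sup>2"
  have pos: "0 < ?a" "0 < ?b" using log_dist_arg_pos assms by simp_all
  define x y where "x = cos \<alpha>" and "y = cos \<beta>"
  have s: "cos (\<alpha> - \<beta>) + cos (\<alpha> + \<beta>) = 2 * x * y" by (simp add: cos_diff cos_add x_def y_def)
  have p: "cos (\<alpha> - \<beta>) * cos (\<alpha> + \<beta>) = x\<^sup>2 + y\<^sup>2 - 1"
  proof -
    have "cos (\<alpha> - \<beta>) * cos (\<alpha> + \<beta>) = x\<^sup>2 * y\<^sup>2 - (sin \<alpha>)\<^sup>2 * (sin \<beta>)\<^sup>2"
      unfolding cos_diff cos_add x_def y_def by algebra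
    also have "\<dots> = x\<^sup>2 + y\<^sup>2 - 1" unfolding sin_squared_eq x_def y_def by algebra
    finally show ?thesis .
  qed
  have "?a * ?b = (1 + r\<^sup>2)\<^sup>2 - 2 * r * (1 + r\<^sup>2) * (cos (\<alpha> - \<beta>) + cos (\<alpha> + \<beta>)) + 4 * r\<^sup>2 * (cos (\<alpha> - \<beta>) * cos (\<alpha> + \<beta>))"
    by algebra
  also have "\<dots> = 4 * r\<^sup>2 * (x - y)\<^sup>2 + (1 - r)\<^sup>2 * ((1 + r)\<^sup>2 - 4 * r * (x * y))"
    unfolding s p by algebra
  also have "\<dots> \<ge> 4 * r\<^sup>2 * (x - y)\<^sup>2 + (1 - r)\<^sup>2 * (1 - r)\<^sup>2"
  proof -
    have "\<bar>x * y\<bar> \<le> 1 * 1" unfolding abs_mult by (intro mult_mono) (auto simp: x_def y_def)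
    then have "r * (x * y) \<le> r * 1" using assms by (intro mult_left_mono) auto
    then have "(1 - r)\<^sup>2 \<le> (1 + r)\<^sup>2 - 4 * r * (x * y)" by (simp add: power2_diff power2_sum)
    then show ?thesis by (intro add_left_mono mult_left_mono) auto
  qed
  finally have "4 * r\<^sup>2 * (x - y)\<^sup>2 + (1 - r) ^ 4 \<le> ?a * ?b" by (simp flip: power_add)
  moreover have "0 < 4 * r\<^sup>2 * (x - y)\<^sup>2 + (1 - r) ^ 4" using assms by (intro add_nonneg_pos) auto
  ultimately have "ln (4 * r\<^sup>2 * (x - y)\<^sup>2 + (1 - r) ^ 4) \<le> ln (?a * ?b)" by (intro ln_mono) auto
  also have "\<dots> = 2 * (log_dist r (\<alpha> - \<beta>) + log_dist r (\<alpha> + \<beta>))"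
    using pos by (simp add: ln_mult log_dist_def)
  finally show ?thesis by (simp add: x_def y_def)
qed

text \<open>The projection, rescaled to [-1, 1], is written as a cosine, as for Chebyshev
  polynomials. The clamp is inactive on the closure of \<Omega>; elsewhere it keeps the argument in
  the domain of \<open>arccos\<close>, so the angle is continuous on the whole plane.\<close>

definition proj_angle :: "pt set \<Rightarrow> real \<Rightarrow> pt \<Rightarrow> real" where
  "proj_angle \<Omega> \<theta> x = arccos (max (-1) (min 1
     ((2 * (x \<bullet> rotv \<theta> 1 0) - proj_inf \<Omega> \<theta> - proj_sup \<Omega> \<theta>) / (proj_sup \<Omega> \<theta> - proj_inf \<Omega> \<theta>))))"

lemma proj_angle_measurable [measurable]: "proj_angle \<Omega> \<theta> \<in> borel_measurable borel"
  unfolding proj_angle_def[abs_def] divide_inverse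
  by (intro borel_measurable_continuous_onI continuous_intros) auto

lemma cos_proj_angle:
  assumes "bounded \<Omega>" "x \<in> closure \<Omega>" "proj_inf \<Omega> \<theta> < proj_sup \<Omega> \<theta>"
  shows "(proj_sup \<Omega> \<theta> - proj_inf \<Omega> \<theta>) * cos (proj_angle \<Omega> \<theta> x) = 2 * (x \<bullet> rotv \<theta> 1 0) - proj_inf \<Omega> \<theta> - proj_sup \<Omega> \<theta>"
proof -
  let ?y = "(2 * (x \<bullet> rotv \<theta> 1 0) - proj_inf \<Omega> \<theta> - proj_sup \<Omega> \<theta>) / (proj_sup \<Omega> \<theta> - proj_inf \<Omega> \<theta>)"
  note b = proj_bounds[OF assms(1,2), of \<theta>]
  have y: "-1 \<le> ?y" "?y \<le> 1" using b assms(3) by (auto simp: field_simps)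
  then have "cos (proj_angle \<Omega> \<theta> x) = ?y" by (simp add: proj_angle_def min_def max_def)
  then show ?thesis using assms(3) by (simp only: nonzero_mult_div_cancel_left times_divide_eq_right)
qed

text \<open>For r = 1 this is ln (2 |cos \<alpha> - cos \<beta>|), the logarithmic kernel of an
  interval in arccosine coordinates; r < 1 makes it bounded.\<close>

definition pair_kernel :: "real \<Rightarrow> (pt \<Rightarrow> real) \<Rightarrow> pt \<times> pt \<Rightarrow> real" where
  "pair_kernel r \<alpha> p = log_dist r (\<alpha> (fst p) - \<alpha> (snd p)) + log_dist r (\<alpha> (fst p) + \<alpha> (snd p))"

lemma pair_kernel_bounded:
  assumes "0 \<le> r" "r < 1"
  obtains B where "\<And>p. \<bar>pair_kernel r \<alpha> p\<bar> \<le> B"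
proof -
  obtain B where B: "\<And>\<phi>. \<bar>log_dist r \<phi>\<bar> \<le> B" using log_dist_bounded[OF assms] by blast
  have "\<bar>pair_kernel r \<alpha> p\<bar> \<le> B + B" for p
    unfolding pair_kernel_def by (rule order_trans[OF abs_triangle_ineq add_mono[OF B B]])
  then show ?thesis by (rule that)
qed

lemma pair_kernel_measurable [measurable]:
  assumes [measurable]: "\<alpha> \<in> borel_measurable borel"
  shows "pair_kernel r \<alpha> \<in> borel_measurable (borel \<Otimes>\<^sub>M borel)"
  unfolding pair_kernel_def[abs_def] by measurable

lemma cos_mult_cos:
  fixes a b c m :: real
  shows "2 * c / m * (cos a * cos b) = c * cos (a - b) / m + c * cos (a + b) / m"
  by (simp add: cos_diff cos_add distrib_left right_diff_distrib add_divide_distrib diff_divide_distrib)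

text \<open>\<open>- pair_kernel\<close> is positive definite: its expansion is \<open>\<Sum>n. 2 r\<^sup>n / n cos (n \<alpha>) cos (n \<beta>)\<close>.\<close>

lemma pair_kernel_integral:
  assumes r: "0 \<le> r" "r < 1" and \<mu>: "prob_space \<mu>" "sets \<mu> = sets borel"
    and [measurable]: "\<alpha> \<in> borel_measurable borel"
  shows "integrable (\<mu> \<Otimes>\<^sub>M \<mu>) (pair_kernel r \<alpha>)" "(\<integral>p. pair_kernel r \<alpha> p \<partial>(\<mu> \<Otimes>\<^sub>M \<mu>)) \<le> 0"
proof -
  interpret M: prob_space \<mu> by fact
  interpret PP: pair_prob_space \<mu> \<mu> ..
  have [measurable_cong]: "sets \<mu> = sets borel" by fact
  show i: "integrable (\<mu> \<Otimes>\<^sub>M \<mu>) (pair_kernel r \<alpha>)"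
  proof -
    obtain B where "\<And>p. \<bar>pair_kernel r \<alpha> p\<bar> \<le> B" using pair_kernel_bounded[OF r] by blast
    then show ?thesis by (intro PP.P.integrable_const_bound[where B=B]) auto
  qed
  have ic: "integrable \<mu> (\<lambda>x. cos (n * \<alpha> x))" for n :: nat
    by (rule M.integrable_const_bound[where B=1]) auto
  have i2: "integrable (\<mu> \<Otimes>\<^sub>M \<mu>) (\<lambda>p. cos (n * \<alpha> (fst p)) * cos (n * \<alpha> (snd p)))" for n :: nat
    by (rule PP.P.integrable_const_bound[where B=1]) (auto simp: abs_mult intro!: mult_le_one)
  have e2: "(\<integral>p. cos (n * \<alpha> (fst p)) * cos (n * \<alpha> (snd p)) \<partial>(\<mu> \<Otimes>\<^sub>M \<mu>)) = (\<integral>x. cos (n * \<alpha> x) \<partial>\<mu>)\<^sup>2" for n :: nat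
    using PP.integral_fst'[OF i2[of n]] by (simp add: power2_eq_square)
  \<comment> \<open>In the truncated expansion every term is a product of the same cosine in the two
    variables, so its integral against the product measure is a square; the truncation error
    vanishes as N grows.\<close>
  have le: "(\<integral>p. pair_kernel r \<alpha> p \<partial>(\<mu> \<Otimes>\<^sub>M \<mu>)) \<le> 2 * (r ^ N / (1 - r))" for N
  proof -
    let ?T = "\<lambda>n p. 2 * r ^ n / n * (cos (n * \<alpha> (fst p)) * cos (n * \<alpha> (snd p)))"
    have pw: "pair_kernel r \<alpha> p \<le> 2 * (r ^ N / (1 - r)) - (\<Sum>n<N. ?T n p)" for p
    proof -
      have "(\<Sum>n<N. ?T n p) = (\<Sum>n<N. r ^ n * cos (n * (\<alpha> (fst p) - \<alpha> (snd p))) / n) + (\<Sum>n<N. r ^ n * cos (n * (\<alpha> (fst p) + \<alpha> (snd p))) / n)"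
        unfolding sum.distrib[symmetric]
      proof (intro sum.cong refl)
        fix n :: nat
        show "?T n p = r ^ n * cos (n * (\<alpha> (fst p) - \<alpha> (snd p))) / n + r ^ n * cos (n * (\<alpha> (fst p) + \<alpha> (snd p))) / n"
          unfolding right_diff_distrib[of "real n"] distrib_left[of "real n"] by (rule cos_mult_cos)
      qed
      then show ?thesis
        using log_dist_approx[OF r, of "\<alpha> (fst p) - \<alpha> (snd p)" N] log_dist_approx[OF r, of "\<alpha> (fst p) + \<alpha> (snd p)" N]
        unfolding pair_kernel_def by linarith
    qed
    have it: "integrable (\<mu> \<Otimes>\<^sub>M \<mu>) (\<lambda>p. \<Sum>n<N. ?T n p)" by (intro Bochner_Integration.integrable_sum integrable_mult_right i2)
    have "(\<integral>p. pair_kernel r \<alpha> p \<partial>(\<mu> \<Otimes>\<^sub>M \<mu>)) \<le> (\<integral>p. 2 * (r ^ N / (1 - r)) - (\<Sum>n<N. ?T n p) \<partial>(\<mu> \<Otimes>\<^sub>M \<mu>))"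
      by (intro integral_mono i Bochner_Integration.integrable_diff it PP.P.integrable_const pw)
    also have "\<dots> = 2 * (r ^ N / (1 - r)) - (\<Sum>n<N. 2 * r ^ n / n * (\<integral>x. cos (n * \<alpha> x) \<partial>\<mu>)\<^sup>2)"
    proof -
      have "(\<integral>p. (\<Sum>n<N. ?T n p) \<partial>(\<mu> \<Otimes>\<^sub>M \<mu>)) = (\<Sum>n<N. 2 * r ^ n / n * (\<integral>x. cos (n * \<alpha> x) \<partial>\<mu>)\<^sup>2)"
        by (subst Bochner_Integration.integral_sum) (auto intro!: integrable_mult_right i2 sum.cong simp only: integral_mult_right_zero e2)
      then show ?thesis
        by (subst Bochner_Integration.integral_diff[OF PP.P.integrable_const it]) (simp add: PP.P.prob_space)
    qed
    also have "\<dots> \<le> 2 * (r ^ N / (1 - r))" using r by (simp add: sum_nonneg)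
    finally show ?thesis .
  qed
  have "(\<lambda>N. 2 * (r ^ N / (1 - r))) \<longlonglongrightarrow> 2 * (0 / (1 - r))"
    using r by (intro tendsto_intros LIMSEQ_power_zero) auto
  from LIMSEQ_le_const[OF this] le show "(\<integral>p. pair_kernel r \<alpha> p \<partial>(\<mu> \<Otimes>\<^sub>M \<mu>)) \<le> 0" by auto
qed

text \<open>The majorant H may be large at single points; only its mean matters. If the positive
  part of the energy is infinite there is nothing to prove, because boundedness of K makes the
  negative part finite. Otherwise the diagonal is a null set and the hypothesis off the diagonal
  suffices.\<close>

lemma log_energy_ge:
  assumes \<mu>: "prob_on K \<mu>" and K: "closed K" "bounded K"
    and H: "integrable (\<mu> \<Otimes>\<^sub>M \<mu>) H" "(\<integral>p. H p \<partial>(\<mu> \<Otimes>\<^sub>M \<mu>)) \<le> 0"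
    and bound: "\<And>x y. x \<in> K \<Longrightarrow> y \<in> K \<Longrightarrow> x \<noteq> y \<Longrightarrow> ln (dist x y) \<le> c + H (x, y)"
  shows "ereal (- c) \<le> log_energy \<mu>"
proof -
  have \<mu>': "prob_space \<mu>" "sets \<mu> = sets borel" "emeasure \<mu> (UNIV - K) = 0"
    using \<mu> by (auto simp: prob_on_def)
  interpret M: prob_space \<mu> by fact
  interpret PP: pair_prob_space \<mu> \<mu> ..
  note [measurable_cong] = \<mu>'(2)
  have [measurable]: "K \<in> sets borel" using K by simp
  let ?M = "\<mu> \<Otimes>\<^sub>M \<mu>"
  define pos :: "pt \<times> pt \<Rightarrow> ennreal" where "pos p = (if fst p = snd p then \<infinity> else ennreal (max 0 (- ln (dist (fst p) (snd p)))))" for p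
  define neg :: "pt \<times> pt \<Rightarrow> ennreal" where "neg p = (if fst p = snd p then 0 else ennreal (max 0 (ln (dist (fst p) (snd p)))))" for p
  have [measurable]: "pos \<in> borel_measurable ?M" "neg \<in> borel_measurable ?M"
    unfolding pos_def[abs_def] neg_def[abs_def] by measurable
  have E: "log_energy \<mu> = enn2ereal (\<integral>\<^sup>+p. pos p \<partial>?M) - enn2ereal (\<integral>\<^sup>+p. neg p \<partial>?M)"
    unfolding log_energy_def pos_def neg_def ..
  have AEK: "AE x in \<mu>. x \<in> K"
  proof (rule AE_I[of _ _ "UNIV - K"])
    show "{x \<in> space \<mu>. x \<notin> K} \<subseteq> UNIV - K" by auto
  qed (use \<mu>' in auto)
  have AE: "AE p in ?M. fst p \<in> K \<and> snd p \<in> K"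
  proof (rule PP.AE_pair_measure)
    show "AE x in \<mu>. AE y in \<mu>. fst (x, y) \<in> K \<and> snd (x, y) \<in> K"
      using AEK by eventually_elim (use AEK in auto)
    show "{p \<in> space ?M. fst p \<in> K \<and> snd p \<in> K} \<in> sets ?M" by measurable
  qed
  obtain D where D: "\<And>x. x \<in> K \<Longrightarrow> norm x \<le> D" using K(2) by (auto simp: bounded_iff)
  define B where "B = \<bar>ln (2 * D)\<bar>"
  have lnB: "ln (dist x y) \<le> B" if "x \<in> K" "y \<in> K" "x \<noteq> y" for x y
  proof -
    have "dist x y \<le> 2 * D" using D[OF that(1)] D[OF that(2)] norm_triangle_ineq4[of x y] by (simp add: dist_norm)
    then have "ln (dist x y) \<le> ln (2 * D)" using that by (intro ln_mono) auto
    then show ?thesis by (simp add: B_def)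
  qed
  have "(\<integral>\<^sup>+p. neg p \<partial>?M) \<le> (\<integral>\<^sup>+p. ennreal B \<partial>?M)"
    using AE by (intro nn_integral_mono_AE, eventually_elim) (auto simp: neg_def B_def intro!: ennreal_leI lnB[unfolded B_def])
  also have "\<dots> = ennreal B" by (simp add: PP.P.emeasure_space_1)
  finally have neg_fin: "(\<integral>\<^sup>+p. neg p \<partial>?M) < \<infinity>" using ennreal_less_top le_less_trans by (metis infinity_ennreal_def)
  show ?thesis
  proof (cases "(\<integral>\<^sup>+p. pos p \<partial>?M) = \<infinity>")
    case True
    then show ?thesis using neg_fin unfolding E by (cases "\<integral>\<^sup>+p. neg p \<partial>?M") auto
  next
    case False
    \<comment> \<open>The value \<infinity> of \<open>pos\<close> on the diagonal forces the
      diagonal to be null, which excludes atoms.\<close>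
    have "AE p in ?M. pos p \<noteq> \<infinity>" using False by (intro nn_integral_PInf_AE) auto
    then have ne: "AE p in ?M. fst p \<noteq> snd p" by eventually_elim (auto simp: pos_def split: if_splits)
    define k where "k p = - ln (dist (fst p) (snd p))" for p :: "pt \<times> pt"
    have [measurable]: "k \<in> borel_measurable ?M" unfolding k_def[abs_def] by measurable
    have p1: "(\<integral>\<^sup>+p. pos p \<partial>?M) = (\<integral>\<^sup>+p. ennreal (max 0 (k p)) \<partial>?M)"
      using ne by (intro nn_integral_cong_AE, eventually_elim) (simp add: pos_def k_def)
    have n1: "(\<integral>\<^sup>+p. neg p \<partial>?M) = (\<integral>\<^sup>+p. ennreal (max 0 (- k p)) \<partial>?M)"
      using ne by (intro nn_integral_cong_AE, eventually_elim) (simp add: neg_def k_def)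
    have ip: "integrable ?M (\<lambda>p. max 0 (k p))"
      using False p1 by (intro integrableI_nonneg) (auto simp: less_top)
    have ineg: "integrable ?M (\<lambda>p. max 0 (- k p))"
      using neg_fin n1 by (intro integrableI_nonneg) auto
    have kk: "k = (\<lambda>p. max 0 (k p) - max 0 (- k p))" by (auto simp: fun_eq_iff)
    have ik: "integrable ?M k" by (subst kk) (intro Bochner_Integration.integrable_diff ip ineg)
    have "- c \<le> (\<integral>p. - c - H p \<partial>?M)"
      using H by (subst Bochner_Integration.integral_diff) (auto simp: PP.P.prob_space)
    also have "\<dots> \<le> (\<integral>p. k p \<partial>?M)"
    proof (rule integral_mono_AE[OF _ ik])
      show "integrable ?M (\<lambda>p. - c - H p)" using H by auto
      show "AE p in ?M. - c - H p \<le> k p"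
        using AE ne
      proof eventually_elim
        case (elim p)
        then show ?case using bound[of "fst p" "snd p"] by (simp add: k_def)
      qed
    qed
    also have "\<dots> = (\<integral>p. max 0 (k p) \<partial>?M) - (\<integral>p. max 0 (- k p) \<partial>?M)"
      by (subst kk) (rule Bochner_Integration.integral_diff[OF ip ineg])
    finally have le: "- c \<le> (\<integral>p. max 0 (k p) \<partial>?M) - (\<integral>p. max 0 (- k p) \<partial>?M)" .
    have "log_energy \<mu> = ereal (\<integral>p. max 0 (k p) \<partial>?M) - ereal (\<integral>p. max 0 (- k p) \<partial>?M)"
      unfolding E p1 n1 using ip ineg
      by (subst (1 2) nn_integral_eq_integral) (auto simp: enn2ereal_ennreal)
    then show ?thesis using le by simp
  qed
qed

section \<open>Lower bound for the energy of all measures on the closure of \<Omega>\<close>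

lemma sin_scaled_tendsto: "(\<lambda>N. real (Suc N) * sin (pi / (2 * real (Suc N)))) \<longlonglongrightarrow> pi / 2"
proof -
  let ?h = "\<lambda>N. pi / 2 * inverse (real (Suc N))"
  have "((\<lambda>x::real. sin x / x) \<longlongrightarrow> 1) (at 0)"
    using DERIV_sin[of "0::real"] by (simp add: has_field_derivative_iff)
  moreover have "filterlim ?h (at 0) sequentially"
  proof (rule filterlim_atI)
    show "?h \<longlonglongrightarrow> 0" using tendsto_mult[OF tendsto_const LIMSEQ_inverse_real_of_nat, of "pi / 2"] by simp
  qed auto
  ultimately have "(\<lambda>N. sin (?h N) / ?h N) \<longlonglongrightarrow> 1" by (rule filterlim_compose)
  then have "(\<lambda>N. pi / 2 * (sin (?h N) / ?h N)) \<longlonglongrightarrow> pi / 2 * 1" by (intro tendsto_intros)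
  moreover have "pi / 2 * (sin (?h N) / ?h N) = real (Suc N) * sin (pi / (2 * real (Suc N)))" for N
  proof -
    define h where "h = pi / (2 * real (Suc N))"
    have h: "h \<noteq> 0" "pi / 2 = real (Suc N) * h" by (simp_all add: h_def del: of_nat_Suc)
    have hN: "?h N = h" by (simp only: h_def divide_inverse inverse_mult_distrib mult.assoc)
    have "pi / 2 * (sin h / h) = real (Suc N) * sin h" unfolding h(2) using h(1) by simp
    then show ?thesis unfolding hN h_def[symmetric] .
  qed
  ultimately show ?thesis by (simp only: mult_1_right)
qed

lemma ln_square_mult:
  fixes a b :: real
  shows "0 < a \<Longrightarrow> 0 < b \<Longrightarrow> ln (a\<^sup>2 * b) = 2 * ln a + ln b"
  by (simp add: ln_mult_pos ln_realpow)

text \<open>Jensen's inequality from the tangent of ln at the mean A.\<close>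

lemma ln_mean_le:
  fixes w :: "nat \<Rightarrow> real"
  assumes N: "N > 0" and w: "\<And>k. w k > 0"
  shows "(\<Sum>k<N. ln (w k)) / N \<le> ln ((\<Sum>k<N. w k) / N)"
proof -
  define A where "A = (\<Sum>k<N. w k) / N"
  have A: "A > 0" unfolding A_def using N w by (intro divide_pos_pos sum_pos) auto
  have "ln (w k) \<le> ln A + (w k / A - 1)" for k
    using ln_le_minus_one[of "w k / A"] w[of k] A by (simp add: ln_div)
  then have "(\<Sum>k<N. ln (w k)) \<le> (\<Sum>k<N. ln A + (w k / A - 1))" by (intro sum_mono)
  also have "\<dots> = N * ln A + ((\<Sum>k<N. w k) / A - N)"
    by (simp add: sum.distrib sum_subtractf sum_divide_distrib)
  also have "(\<Sum>k<N. w k) / A = N" using N A unfolding A_def by (simp add: field_simps)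
  finally have "(\<Sum>k<N. ln (w k)) \<le> N * ln A" by simp
  then show ?thesis using N by (simp add: A_def divide_le_eq mult.commute)
qed

context
  fixes \<Omega> :: "pt set" and P :: real
  assumes \<Omega>: "open \<Omega>" "bounded \<Omega>" "connected \<Omega>" "\<Omega> \<noteq> {}" and P: "perimeter \<Omega> = ereal P"
begin

text \<open>For finite N and r < 1, \<open>ln_norm_le_average\<close> passes from the distance to N
  projections, \<open>log_dist_product_ge\<close> from each projection to a kernel with nonpositive
  integral, and \<open>crofton_bound\<close> with \<open>ln_mean_le\<close> bounds the widths that
  remain. \<rho> is allowed to depend on r but not on N, so that N can tend to infinity
  afterwards.\<close>

lemma log_energy_lower_bound_finite:
  assumes \<mu>: "prob_on (closure \<Omega>) \<mu>" and r: "0 < r" "r < 1"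
  obtains \<rho> where "0 \<le> \<rho>" "\<rho> < 1" "0 < P"
    "\<And>N. N > 0 \<Longrightarrow> ereal (- (\<rho> ^ N / (1 - \<rho>) + ln (P / (4 * (real N * sin (pi / (2 * real N))))) - ln r)) \<le> log_energy \<mu>"
proof -
  define w where "w \<theta> = proj_sup \<Omega> \<theta> - proj_inf \<Omega> \<theta>" for \<theta>
  obtain x0 where x0: "x0 \<in> \<Omega>" using \<Omega>(4) by auto
  obtain e where e: "e > 0" "cball x0 e \<subseteq> \<Omega>"
  proof -
    obtain d where "d > 0" "ball x0 d \<subseteq> \<Omega>" by (rule openE[OF \<Omega>(1) x0])
    moreover have "cball x0 (d / 2) \<subseteq> ball x0 d" using \<open>d > 0\<close> by (auto simp: mem_cball)
    ultimately show ?thesis by (intro that[of "d / 2"]) auto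
  qed
  have we: "2 * e \<le> w \<theta>" for \<theta>
  proof -
    have nr: "rotv \<theta> 1 0 \<bullet> rotv \<theta> 1 0 = 1" by (rule inner_rotv)
    then have n1: "norm (rotv \<theta> 1 0) = 1" by (simp add: norm_eq_1)
    have "x0 + e *\<^sub>R rotv \<theta> 1 0 \<in> cball x0 e" "x0 - e *\<^sub>R rotv \<theta> 1 0 \<in> cball x0 e"
      using e n1 by (auto simp: dist_norm)
    then have "x0 + e *\<^sub>R rotv \<theta> 1 0 \<in> closure \<Omega>" "x0 - e *\<^sub>R rotv \<theta> 1 0 \<in> closure \<Omega>"
      using e closure_subset by blast+
    from proj_bounds(2)[OF \<Omega>(2) this(1), of \<theta>] proj_bounds(1)[OF \<Omega>(2) this(2), of \<theta>]
    show ?thesis using nr by (simp add: w_def inner_diff_left inner_add_left)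
  qed
  have wpos: "w \<theta> > 0" for \<theta> using we[of \<theta>] e by linarith
  obtain D0 where D0: "\<And>x. x \<in> closure \<Omega> \<Longrightarrow> norm x \<le> D0"
    using bounded_closure[OF \<Omega>(2)] by (auto simp: bounded_iff)
  \<comment> \<open>The summand 2 e makes D at least 2 E, so that \<rho> below is
    nonnegative.\<close>
  define D where "D = 2 * \<bar>D0\<bar> + 2 * e"
  have D: "dist x y \<le> D" if "x \<in> closure \<Omega>" "y \<in> closure \<Omega>" for x y
    using D0[OF that(1)] D0[OF that(2)] norm_triangle_ineq4[of x y] e by (simp add: D_def dist_norm)
  have De: "2 * e \<le> D" "D > 0" using e by (auto simp: D_def)
  \<comment> \<open>Both regularisations leave an additive term: ((1 - \<rho>) D)^2 in the average
    and (1 - r)^4 in the kernel, the latter scaled by the squared width. Every width is at least 2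
    e, so this E, which equals (1 - \<rho>) D, puts the first below the second.\<close>
  define E where "E = e * (1 - r)\<^sup>2"
  define \<rho> where "\<rho> = 1 - E / D"
  have E: "E > 0" "E \<le> e" using e r by (auto simp: E_def power_le_one mult_left_le)
  have \<rho>: "0 \<le> \<rho>" "\<rho> < 1" "(1 - \<rho>) * D = E" using E De by (auto simp: \<rho>_def field_simps)
  have lt: "0 < P \<and> ereal (- (\<rho> ^ N / (1 - \<rho>) + ln (P / (4 * (real N * sin (pi / (2 * real N))))) - ln r)) \<le> log_energy \<mu>"
    if N: "N > 0" for N
  proof -
    define \<theta> where "\<theta> k = pi * real k / real N" for k
    define s where "s = sin (pi / (2 * real N))"
    have s: "s > 0" unfolding s_def
      using N by (intro sin_gt_zero) (auto simp: field_simps intro: less_le_trans[of pi "2 * pi"])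
    have cr: "2 * (\<Sum>k<N. w (\<theta> k)) \<le> P / s"
      using crofton_bound[OF \<Omega> P N] by (simp only: w_def \<theta>_def s_def sum_distrib_left)
    have sp: "(\<Sum>k<N. w (\<theta> k)) > 0" using N wpos by (intro sum_pos) auto
    then have "0 < P / s" using cr by linarith
    then have Pp: "P > 0" using s by (simp add: zero_less_divide_iff)
    define G where "G k = pair_kernel r (proj_angle \<Omega> (\<theta> k))" for k
    \<comment> \<open>The term - ln (2 r) stems from the factor 2 r between cosine differences and
      the kernel. Together with the Crofton bound for the mean width it produces P / (4 N s), which
      tends to P / (2 pi) because N s tends to pi / 2.\<close>
    define c where "c = \<rho> ^ N / (1 - \<rho>) + ln ((\<Sum>k<N. w (\<theta> k)) / N) - ln (2 * r)"
    define H where "H p = (\<Sum>k<N. G k p) / N" for p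
    have sets\<mu>: "prob_space \<mu>" "sets \<mu> = sets borel" using \<mu> by (auto simp: prob_on_def)
    note Gi = pair_kernel_integral[OF less_imp_le[OF r(1)] r(2) sets\<mu> proj_angle_measurable, of \<Omega>]
    have Hi: "integrable (\<mu> \<Otimes>\<^sub>M \<mu>) H" unfolding H_def[abs_def] G_def
      by (intro integrable_divide Bochner_Integration.integrable_sum Gi)
    have "(\<integral>p. H p \<partial>(\<mu> \<Otimes>\<^sub>M \<mu>)) = (\<Sum>k<N. \<integral>p. G k p \<partial>(\<mu> \<Otimes>\<^sub>M \<mu>)) / N"
      unfolding H_def G_def using Gi(1) by simp
    also have "\<dots> \<le> 0" using Gi(2) by (intro divide_nonpos_nonneg sum_nonpos) (auto simp: G_def)
    finally have HI: "(\<integral>p. H p \<partial>(\<mu> \<Otimes>\<^sub>M \<mu>)) \<le> 0" .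
    have bound: "ln (dist x y) \<le> c + H (x, y)" if xy: "x \<in> closure \<Omega>" "y \<in> closure \<Omega>" "x \<noteq> y" for x y
    proof -
      let ?z = "x - y"
      have z: "?z \<noteq> 0" "norm ?z \<le> D" using xy D[of x y] by (auto simp: dist_norm)
      have tm: "ln (4 * (?z \<bullet> rotv (\<theta> k) 1 0)\<^sup>2 + ((1 - \<rho>) * D)\<^sup>2) \<le> 2 * ln (w (\<theta> k)) - 2 * ln (2 * r) + 2 * G k (x, y)" for k
      proof -
        let ?\<alpha> = "proj_angle \<Omega> (\<theta> k) x" and ?\<beta> = "proj_angle \<Omega> (\<theta> k) y" and ?w = "w (\<theta> k)"
        have lt: "proj_inf \<Omega> (\<theta> k) < proj_sup \<Omega> (\<theta> k)" using wpos[of "\<theta> k"] by (simp add: w_def)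
        have "2 * (?z \<bullet> rotv (\<theta> k) 1 0) = ?w * (cos ?\<alpha> - cos ?\<beta>)"
          using cos_proj_angle[OF \<Omega>(2) xy(1) lt] cos_proj_angle[OF \<Omega>(2) xy(2) lt]
          by (simp add: w_def right_diff_distrib[of _ "cos ?\<alpha>"] inner_diff_left)
        then have sq: "4 * (?z \<bullet> rotv (\<theta> k) 1 0)\<^sup>2 = ?w\<^sup>2 * (cos ?\<alpha> - cos ?\<beta>)\<^sup>2"
        proof -
          have "4 * (?z \<bullet> rotv (\<theta> k) 1 0)\<^sup>2 = (2 * (?z \<bullet> rotv (\<theta> k) 1 0))\<^sup>2" by algebra
          then show ?thesis by (simp only: \<open>2 * (?z \<bullet> rotv (\<theta> k) 1 0) = ?w * (cos ?\<alpha> - cos ?\<beta>)\<close> power_mult_distrib)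
        qed
        have "2 * r * E \<le> ?w * (1 - r)\<^sup>2"
        proof -
          have "2 * r * E \<le> 2 * 1 * E" using r E by (intro mult_right_mono mult_left_mono) auto
          also have "\<dots> = (2 * e) * (1 - r)\<^sup>2" by (simp add: E_def)
          also have "\<dots> \<le> ?w * (1 - r)\<^sup>2" using we by (intro mult_right_mono) auto
          finally show ?thesis .
        qed
        then have "(2 * r * E)\<^sup>2 \<le> (?w * (1 - r)\<^sup>2)\<^sup>2" using r E by (intro power_mono) auto
        then have E2: "(2 * r)\<^sup>2 * E\<^sup>2 \<le> ?w\<^sup>2 * (1 - r) ^ 4" by (simp add: power_mult_distrib flip: power_mult)
        have "(2 * r)\<^sup>2 * (4 * (?z \<bullet> rotv (\<theta> k) 1 0)\<^sup>2 + E\<^sup>2) \<le> ?w\<^sup>2 * (4 * r\<^sup>2 * (cos ?\<alpha> - cos ?\<beta>)\<^sup>2 + (1 - r) ^ 4)"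
        proof -
          have "(2 * r)\<^sup>2 * (?w\<^sup>2 * (cos ?\<alpha> - cos ?\<beta>)\<^sup>2) = ?w\<^sup>2 * (4 * r\<^sup>2 * (cos ?\<alpha> - cos ?\<beta>)\<^sup>2)" by algebra
          then show ?thesis unfolding sq distrib_left using E2 by linarith
        qed
        moreover have pp: "0 < 4 * (?z \<bullet> rotv (\<theta> k) 1 0)\<^sup>2 + E\<^sup>2" using E by (intro add_nonneg_pos) auto
        moreover have qq: "0 < 4 * r\<^sup>2 * (cos ?\<alpha> - cos ?\<beta>)\<^sup>2 + (1 - r) ^ 4" using r by (intro add_nonneg_pos) auto
        ultimately have "ln ((2 * r)\<^sup>2 * (4 * (?z \<bullet> rotv (\<theta> k) 1 0)\<^sup>2 + E\<^sup>2)) \<le>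
            ln (?w\<^sup>2 * (4 * r\<^sup>2 * (cos ?\<alpha> - cos ?\<beta>)\<^sup>2 + (1 - r) ^ 4))"
          using r by (intro ln_mono) (auto intro!: mult_pos_pos)
        then have "2 * ln (2 * r) + ln (4 * (?z \<bullet> rotv (\<theta> k) 1 0)\<^sup>2 + E\<^sup>2) \<le>
            2 * ln ?w + ln (4 * r\<^sup>2 * (cos ?\<alpha> - cos ?\<beta>)\<^sup>2 + (1 - r) ^ 4)"
          using r by (subst (asm) (1 2) ln_square_mult) (use pp qq wpos in auto)
        also have "ln (4 * r\<^sup>2 * (cos ?\<alpha> - cos ?\<beta>)\<^sup>2 + (1 - r) ^ 4) \<le> 2 * G k (x, y)"
          using log_dist_product_ge[OF r] by (simp add: G_def pair_kernel_def)
        finally show ?thesis using \<rho>(3) by simp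
      qed
      have "2 * ln (norm ?z) \<le> 2 * (\<rho> ^ N / (1 - \<rho>)) +
        (\<Sum>k<N. ln (4 * (?z \<bullet> rotv (\<theta> k) 1 0)\<^sup>2 + ((1 - \<rho>) * D)\<^sup>2)) / N"
        unfolding \<theta>_def by (rule ln_norm_le_average[OF \<rho>(1,2) N z])
      also have "\<dots> \<le> 2 * (\<rho> ^ N / (1 - \<rho>)) + (\<Sum>k<N. 2 * ln (w (\<theta> k)) - 2 * ln (2 * r) + 2 * G k (x, y)) / N"
        by (intro add_left_mono divide_right_mono sum_mono tm) auto
      also have "(\<Sum>k<N. 2 * ln (w (\<theta> k)) - 2 * ln (2 * r) + 2 * G k (x, y)) / N =
          2 * ((\<Sum>k<N. ln (w (\<theta> k))) / N) - 2 * ln (2 * r) + 2 * H (x, y)"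
      proof -
        have "(\<Sum>k<N. 2 * ln (w (\<theta> k)) - 2 * ln (2 * r) + 2 * G k (x, y)) =
          2 * (\<Sum>k<N. ln (w (\<theta> k))) - N * (2 * ln (2 * r)) + 2 * (\<Sum>k<N. G k (x, y))"
          by (simp only: sum.distrib sum_subtractf sum_distrib_left sum_constant card_lessThan)
        then show ?thesis using N by (simp add: H_def add_divide_distrib diff_divide_distrib)
      qed
      finally have "ln (norm ?z) \<le> \<rho> ^ N / (1 - \<rho>) + (\<Sum>k<N. ln (w (\<theta> k))) / N - ln (2 * r) + H (x, y)" by linarith
      then show ?thesis using ln_mean_le[OF N, of "\<lambda>k. w (\<theta> k)"] wpos by (simp add: c_def dist_norm)
    qed
    have "ereal (- c) \<le> log_energy \<mu>"
      using bounded_closure[OF \<Omega>(2)] bound by (intro log_energy_ge[OF \<mu> _ _ Hi HI]) auto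
    moreover have "c \<le> \<rho> ^ N / (1 - \<rho>) + ln (P / (4 * (real N * s))) - ln r"
    proof -
      have "(\<Sum>k<N. w (\<theta> k)) / N \<le> P / (2 * (real N * s))" using cr N s by (simp add: field_simps)
      then have "ln ((\<Sum>k<N. w (\<theta> k)) / N) \<le> ln (P / (2 * (real N * s)))" using sp N by (intro ln_mono) auto
      also have "P / (2 * (real N * s)) = 2 * (P / (4 * (real N * s)))" by simp
      also have "ln (2 * (P / (4 * (real N * s)))) = ln 2 + ln (P / (4 * (real N * s)))"
        using Pp N s by (intro ln_mult_pos) auto
      finally have "ln ((\<Sum>k<N. w (\<theta> k)) / N) \<le> ln 2 + ln (P / (4 * (real N * s)))" .
      moreover have "ln (2 * r) = ln 2 + ln r" using r by (intro ln_mult_pos) auto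
      ultimately show ?thesis unfolding c_def by linarith
    qed
    then have "ereal (- (\<rho> ^ N / (1 - \<rho>) + ln (P / (4 * (real N * s))) - ln r)) \<le> ereal (- c)" by simp
    ultimately show ?thesis using Pp unfolding s_def by (blast intro: order_trans)
  qed
  show ?thesis using that[OF \<rho>(1,2)] lt[of 1] lt by blast
qed

lemma perimeter_pos: "0 < P"
proof -
  obtain x where x: "x \<in> \<Omega>" using \<Omega>(4) by auto
  have "measure lborel \<Omega> > 0"
  proof -
    obtain e where e: "e > 0" "ball x e \<subseteq> \<Omega>" by (rule openE[OF \<Omega>(1) x])
    have "0 < measure lborel (ball x e)" using content_ball_pos[OF e(1)] by simp
    also have "\<dots> \<le> measure lborel \<Omega>"
      using e \<Omega> emeasure_bounded_finite[OF \<Omega>(2)] by (intro measure_mono_fmeasurable) (auto simp: fmeasurable_def)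
    finally show ?thesis .
  qed
  then have "0 < 4 * pi * measure lborel \<Omega>" by simp
  then have "0 < P\<^sup>2" using isoperimetric[OF \<Omega>(1,2) P] by linarith
  then show ?thesis using perimeter_nonneg[of \<Omega>] P by (auto simp: less_le)
qed

text \<open>The limits are taken in this order because \<rho> depends on r: for fixed r the error
  \<rho>^N / (1 - \<rho>) vanishes as N grows, and then ln r tends to 0.\<close>

lemma log_energy_lower_bound:
  assumes \<mu>: "prob_on (closure \<Omega>) \<mu>"
  shows "ereal (- ln (P / (2 * pi))) \<le> log_energy \<mu>"
proof -
  have r: "ereal (- (ln (P / (2 * pi)) - ln r)) \<le> log_energy \<mu>" if r: "0 < r" "r < 1" for r
  proof -
    obtain \<rho> where \<rho>: "0 \<le> \<rho>" "\<rho> < 1" and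
      le: "\<And>N. N > 0 \<Longrightarrow> ereal (- (\<rho> ^ N / (1 - \<rho>) + ln (P / (4 * (real N * sin (pi / (2 * real N))))) - ln r)) \<le> log_energy \<mu>"
      using log_energy_lower_bound_finite[OF \<mu> r] by metis
    have "(\<lambda>N. - (\<rho> ^ Suc N / (1 - \<rho>) + ln (P / (4 * (real (Suc N) * sin (pi / (2 * real (Suc N)))))) - ln r))
      \<longlonglongrightarrow> - (0 / (1 - \<rho>) + ln (P / (4 * (pi / 2))) - ln r)"
      using \<rho> perimeter_pos
      by (intro tendsto_intros sin_scaled_tendsto LIMSEQ_Suc[OF LIMSEQ_power_zero]) auto
    then have "(\<lambda>N. ereal (- (\<rho> ^ Suc N / (1 - \<rho>) + ln (P / (4 * (real (Suc N) * sin (pi / (2 * real (Suc N)))))) - ln r)))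
      \<longlonglongrightarrow> ereal (- (ln (P / (2 * pi)) - ln r))" by simp
    then show ?thesis by (rule LIMSEQ_le_const2) (intro exI[of _ 0] allI impI le, simp)
  qed
  \<comment> \<open>The double successor makes the sequence start at 1/2, inside the open
    interval.\<close>
  define u where "u n = 1 - inverse (real (Suc (Suc n)))" for n
  have "u \<longlonglongrightarrow> 1 - 0" unfolding u_def[abs_def]
    by (intro tendsto_diff tendsto_const LIMSEQ_Suc[OF LIMSEQ_inverse_real_of_nat])
  then have "(\<lambda>n. - (ln (P / (2 * pi)) - ln (u n))) \<longlonglongrightarrow> - (ln (P / (2 * pi)) - ln (1 - 0))"
    by (intro tendsto_intros) auto
  then have "(\<lambda>n. ereal (- (ln (P / (2 * pi)) - ln (u n)))) \<longlonglongrightarrow> ereal (- ln (P / (2 * pi)))"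
    by simp
  moreover have "0 < u n" "u n < 1" for n
    by (simp_all add: u_def inverse_less_1_iff del: of_nat_Suc)
  then have "\<forall>n\<ge>0. ereal (- (ln (P / (2 * pi)) - ln (u n))) \<le> log_energy \<mu>" using r by blast
  ultimately show ?thesis by (intro LIMSEQ_le_const2[of _ _ "log_energy \<mu>"] exI[of _ 0])
qed

theorem log_cap_le: "log_cap (closure \<Omega>) \<le> P / (2 * pi)"
proof -
  define V where "V = (INF \<mu>\<in>{\<mu>. prob_on (closure \<Omega>) \<mu>}. log_energy \<mu>)"
  have V: "ereal (- ln (P / (2 * pi))) \<le> V" unfolding V_def
    by (intro INF_greatest) (use log_energy_lower_bound in auto)
  show ?thesis
  proof (cases V)
    case (real v)
    then have "- v \<le> ln (P / (2 * pi))" using V by simp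
    then have "exp (- v) \<le> exp (ln (P / (2 * pi)))" by simp
    then show ?thesis using perimeter_pos real by (simp add: log_cap_def V_def[symmetric])
  qed (use V perimeter_pos in \<open>auto simp: log_cap_def V_def[symmetric]\<close>)
qed

end

subsection \<open>Saint-Venant inequality for test functions\<close>

text \<open>A nonnegative quadratic has nonpositive discriminant. It serves the Cauchy-Schwarz
  inequality and, later, the estimate of the first variation along a minimising sequence.\<close>

lemma discriminant_le:
  fixes a b c :: real
  assumes b: "0 \<le> b" and pos: "\<And>s. 0 \<le> a - 2 * s * c + s\<^sup>2 * b"
  shows "c\<^sup>2 \<le> a * b"
proof (cases "b = 0")
  case True
  show ?thesis
  proof (cases "c = 0")
    case False
    \<comment> \<open>For b = 0 the expression is affine in s; this s brings it to the value
      -1.\<close>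
    then have "2 * ((a + 1) / (2 * c)) * c = a + 1" by simp
    then have "0 \<le> a - (a + 1)" using pos[of "(a + 1) / (2 * c)"] True by (simp del: times_divide_eq_right)
    then show ?thesis by simp
  qed (use pos[of 0] True in auto)
next
  case False
  then have "b > 0" using b by simp
  have "0 \<le> a - 2 * (c / b) * c + (c / b)\<^sup>2 * b" by (rule pos)
  also have "\<dots> = a - c\<^sup>2 / b" using \<open>b > 0\<close> by (simp add: power2_eq_square)
  finally show ?thesis using \<open>b > 0\<close> by (simp add: divide_le_eq)
qed

lemma
  fixes u v :: "'a \<Rightarrow> 'b::euclidean_space"
  assumes [measurable]: "u \<in> borel_measurable M" "v \<in> borel_measurable M"
    and u: "integrable M (\<lambda>x. (norm (u x))\<^sup>2)" and v: "integrable M (\<lambda>x. (norm (v x))\<^sup>2)"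
  shows integrable_inner_L2: "integrable M (\<lambda>x. u x \<bullet> v x)"
    and integrable_norm_L2: "integrable M (\<lambda>x. (norm (u x - s *\<^sub>R v x))\<^sup>2)"
    and integral_norm_L2: "(\<integral>x. (norm (u x - s *\<^sub>R v x))\<^sup>2 \<partial>M) =
      (\<integral>x. (norm (u x))\<^sup>2 \<partial>M) - 2 * s * (\<integral>x. u x \<bullet> v x \<partial>M) + s\<^sup>2 * (\<integral>x. (norm (v x))\<^sup>2 \<partial>M)"
    and cauchy_schwarz_L2: "(\<integral>x. u x \<bullet> v x \<partial>M)\<^sup>2 \<le> (\<integral>x. (norm (u x))\<^sup>2 \<partial>M) * (\<integral>x. (norm (v x))\<^sup>2 \<partial>M)"
proof -
  show i: "integrable M (\<lambda>x. u x \<bullet> v x)"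
  proof (rule Bochner_Integration.integrable_bound)
    show "integrable M (\<lambda>x. (norm (u x))\<^sup>2 + (norm (v x))\<^sup>2)" using u v by simp
    show "AE x in M. norm (u x \<bullet> v x) \<le> norm ((norm (u x))\<^sup>2 + (norm (v x))\<^sup>2)"
    proof (rule AE_I2)
      fix x
      have "\<bar>u x \<bullet> v x\<bar> \<le> norm (u x) * norm (v x)" by (rule Cauchy_Schwarz_ineq2)
      also have "\<dots> \<le> (norm (u x))\<^sup>2 + (norm (v x))\<^sup>2"
        using sum_squares_bound[of "norm (u x)" "norm (v x)"] mult_nonneg_nonneg[OF norm_ge_zero[of "u x"] norm_ge_zero[of "v x"]]
        by linarith
      finally show "norm (u x \<bullet> v x) \<le> norm ((norm (u x))\<^sup>2 + (norm (v x))\<^sup>2)" by simp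
    qed
  qed simp
  have eq: "(norm (u x - s *\<^sub>R v x))\<^sup>2 = (norm (u x))\<^sup>2 - 2 * s * (u x \<bullet> v x) + s\<^sup>2 * (norm (v x))\<^sup>2" for x s
    unfolding power2_norm_eq_inner
    by (simp add: inner_diff_left inner_diff_right inner_commute power2_eq_square algebra_simps)
  show i2: "integrable M (\<lambda>x. (norm (u x - s *\<^sub>R v x))\<^sup>2)" for s
    unfolding eq using u v i by simp
  show int: "(\<integral>x. (norm (u x - s *\<^sub>R v x))\<^sup>2 \<partial>M) =
      (\<integral>x. (norm (u x))\<^sup>2 \<partial>M) - 2 * s * (\<integral>x. u x \<bullet> v x \<partial>M) + s\<^sup>2 * (\<integral>x. (norm (v x))\<^sup>2 \<partial>M)" for s
    unfolding eq using u v i by simp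
  show "(\<integral>x. u x \<bullet> v x \<partial>M)\<^sup>2 \<le> (\<integral>x. (norm (u x))\<^sup>2 \<partial>M) * (\<integral>x. (norm (v x))\<^sup>2 \<partial>M)"
  proof (rule discriminant_le)
    fix s show "0 \<le> (\<integral>x. (norm (u x))\<^sup>2 \<partial>M) - 2 * s * (\<integral>x. u x \<bullet> v x \<partial>M) + s\<^sup>2 * (\<integral>x. (norm (v x))\<^sup>2 \<partial>M)"
      unfolding int[symmetric] by simp
  qed simp
qed

section \<open>Smoothed truncations, level strips and the Poincare inequality\<close>

lemma max0_square_DERIV: "((\<lambda>t. (max 0 t)\<^sup>2) has_real_derivative 2 * max 0 t) (at (t::real))"
proof -
  consider "t > 0" | "t < 0" | "t = 0" by linarith
  then show ?thesis
  proof cases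
    case 1
    have "((\<lambda>t. t\<^sup>2) has_real_derivative 2 * max 0 t) (at t)" using 1 by (auto intro!: derivative_eq_intros)
    then show ?thesis
      by (rule has_field_derivative_transform_within_open[of _ _ _ "{0<..}"]) (use 1 in auto)
  next
    case 2
    have "((\<lambda>t. 0) has_real_derivative 2 * max 0 t) (at t)" using 2 by simp
    then show ?thesis
      by (rule has_field_derivative_transform_within_open[of _ _ _ "{..<0}"]) (use 2 in auto)
  next
    case 3
    have "((\<lambda>h::real. max 0 h) \<longlongrightarrow> max 0 0) (at 0)" by (intro tendsto_intros)
    then have "((\<lambda>h::real. max 0 h) \<longlongrightarrow> 0) (at 0)" by simp
    then have "((\<lambda>h::real. (max 0 h)\<^sup>2 / h) \<longlongrightarrow> 0) (at 0)"
      by (rule Lim_transform_eventually) (auto simp: eventually_at_filter power2_eq_square max_def)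
    then show ?thesis using 3 by (simp add: has_field_derivative_iff)
  qed
qed

text \<open>A C1 substitute for clamping s to [0, 1]: for 0 < d \<le> 1/2 the derivative
  \<open>ramp'\<close> is a trapezoid of height 1 on [0, 1] with flanks of width d. Keeping the
  slope at most 1 costs height, the final value being 1 - d instead of 1.\<close>

definition ramp :: "real \<Rightarrow> real \<Rightarrow> real" where
  "ramp d s = ((max 0 s)\<^sup>2 - (max 0 (s - d))\<^sup>2 - (max 0 (s - (1 - d)))\<^sup>2 + (max 0 (s - 1))\<^sup>2) / (2 * d)"

definition ramp' :: "real \<Rightarrow> real \<Rightarrow> real" where
  "ramp' d s = (max 0 s - max 0 (s - d) - max 0 (s - (1 - d)) + max 0 (s - 1)) / d"

lemma ramp_DERIV: "d > 0 \<Longrightarrow> (ramp d has_real_derivative ramp' d s) (at s)"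
proof -
  assume d: "d > 0"
  have c: "((\<lambda>t. (max 0 (t - c))\<^sup>2) has_real_derivative 2 * max 0 (s - c)) (at s)" for c :: real
  proof -
    have "((\<lambda>t. t - c) has_real_derivative 1) (at s)" by (auto intro!: derivative_eq_intros)
    from DERIV_chain2[where f="\<lambda>t. (max 0 t)\<^sup>2" and g="\<lambda>t. t - c", OF max0_square_DERIV this]
    show ?thesis by simp
  qed
  have "(ramp d has_real_derivative
    (2 * max 0 s - 2 * max 0 (s - d) - 2 * max 0 (s - (1 - d)) + 2 * max 0 (s - 1)) / (2 * d)) (at s)"
    unfolding ramp_def[abs_def]
    by (intro DERIV_cdivide DERIV_add DERIV_diff c max0_square_DERIV)
  also have "(2 * max 0 s - 2 * max 0 (s - d) - 2 * max 0 (s - (1 - d)) + 2 * max 0 (s - 1)) / (2 * d) = ramp' d s"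
    using d unfolding ramp'_def by (simp add: field_simps)
  finally show ?thesis .
qed

lemma ramp'_continuous: "d > 0 \<Longrightarrow> continuous_on S (ramp' d)"
  unfolding ramp'_def[abs_def] by (intro continuous_intros) auto

lemma ramp'_bounds:
  assumes "0 < d" "d \<le> 1/2"
  shows "0 \<le> ramp' d s" "ramp' d s \<le> 1" "s \<le> 0 \<Longrightarrow> ramp' d s = 0" "1 \<le> s \<Longrightarrow> ramp' d s = 0"
  using assms unfolding ramp'_def by (auto simp: divide_le_eq le_divide_eq max_def)

lemma ramp_values:
  assumes "0 < d" "d \<le> 1/2"
  shows "s \<le> 0 \<Longrightarrow> ramp d s = 0" "1 \<le> s \<Longrightarrow> ramp d s = 1 - d" "0 \<le> ramp d s" "ramp d s \<le> 1 - d"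
proof -
  show z: "ramp d s = 0" if "s \<le> 0" for s using that assms by (simp add: ramp_def max_def)
  show o: "ramp d s = 1 - d" if "1 \<le> s" for s
  proof -
    have "ramp d s = (s\<^sup>2 - (s - d)\<^sup>2 - (s - (1 - d))\<^sup>2 + (s - 1)\<^sup>2) / (2 * d)"
      using that assms by (simp add: ramp_def max_def)
    also have "s\<^sup>2 - (s - d)\<^sup>2 - (s - (1 - d))\<^sup>2 + (s - 1)\<^sup>2 = (1 - d) * (2 * d)" by algebra
    finally show ?thesis using assms by simp
  qed
  have mono: "ramp d x \<le> ramp d y" if "x \<le> y" for x y
    using that ramp_DERIV[OF assms(1)] ramp'_bounds(1)[OF assms]
    by (intro DERIV_nonneg_imp_nondecreasing[where f="ramp d"]) auto
  show "0 \<le> ramp d s" using mono[of "min 0 s" s] z[of "min 0 s"] by simp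
  show "ramp d s \<le> 1 - d" using mono[of s "max 1 s"] o[of "max 1 s"] by simp
qed

lemma C1c_compose:
  assumes f: "C1c f" and F: "\<And>s. (F has_real_derivative F' s) (at s)" "continuous_on UNIV F'" "F 0 = 0"
  shows "C1c (\<lambda>x. F (f x))" "grad (\<lambda>x. F (f x)) x = F' (f x) *\<^sub>R grad f x"
proof -
  obtain R where R: "\<And>x. R < norm x \<Longrightarrow> f x = 0" using C1c_support[OF f] by metis
  have d: "((\<lambda>x. F (f x)) has_derivative (\<lambda>w. (F' (f x) *\<^sub>R grad f x) \<bullet> w)) (at x)" for x
    using has_derivative_compose[OF C1c_has_derivative[OF f] F(1)[unfolded has_field_derivative_def]]
    by (simp add: mult.commute)
  have c: "continuous_on UNIV (\<lambda>x. F' (f x) *\<^sub>R grad f x)"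
    by (intro continuous_intros C1c_continuous_grad[OF f] continuous_on_compose2[OF F(2) C1c_continuous[OF f]]) auto
  show "C1c (\<lambda>x. F (f x))" "grad (\<lambda>x. F (f x)) x = F' (f x) *\<^sub>R grad f x"
    using C1cI[OF d c, of R] R F(3) by auto
qed

lemma level_indicator_sum:
  fixes h y :: real
  assumes "h > 0"
  shows "(\<Sum>k<K. indicator {real k * h<..real (Suc k) * h} y) = (indicator {0<..real K * h} y :: real)"
proof (induction K)
  case (Suc K)
  have "0 \<le> real K * h" "real K * h \<le> real (Suc K) * h" using assms by auto
  then show ?case using Suc by (auto simp: indicator_def simp del: of_nat_Suc)
qed simp

text \<open>A staircase above y, hence an upper Riemann sum for the layer cake formula when y is the
  value of a function.\<close>

lemma layer_sum_ge:
  fixes h y :: real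
  assumes "h > 0"
  shows "min y (real K * h) \<le> (\<Sum>k<K. h * indicator {real k * h<..} y)"
proof (induction K)
  case (Suc K)
  have "min y (real (Suc K) * h) \<le> min y (real K * h) + h * indicator {real K * h<..} y"
    using assms by (auto simp: indicator_def min_def algebra_simps)
  then show ?case using Suc by simp
qed simp

context
  fixes \<Omega> :: "pt set" and \<phi> :: "pt \<Rightarrow> real"
  assumes \<Omega> [measurable]: "\<Omega> \<in> sets borel" and \<Omega>_fin: "emeasure lborel \<Omega> < \<infinity>"
    and \<phi>: "C1c \<phi>" and \<phi>_out: "\<And>x. x \<notin> \<Omega> \<Longrightarrow> \<phi> x = 0"
begin

private lemma meas: "\<phi> \<in> borel_measurable borel" "grad \<phi> \<in> borel_measurable borel"
  by (rule C1c_measurable[OF \<phi>])+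

private lemma grad2_integrable: "integrable lborel (\<lambda>x. (norm (grad \<phi> x))\<^sup>2)"
  by (intro C1c_integrable[OF \<phi>] continuous_intros C1c_continuous_grad[OF \<phi>]) simp

text \<open>The Sobolev inequality for a smoothed truncation of \<open>\<phi>\<close> to the strip, with Cauchy-Schwarz on the
  right-hand side.\<close>

lemma strip_inequality:
  assumes h: "h > 0"
  shows "4 * pi * h\<^sup>2 * measure lborel {x. real (Suc k) * h < \<phi> x} \<le>
    (\<integral>x. indicator {real k * h<..real (Suc k) * h} (\<phi> x) * (norm (grad \<phi> x))\<^sup>2 \<partial>lborel) *
    (measure lborel {x. real k * h < \<phi> x} - measure lborel {x. real (Suc k) * h < \<phi> x})"
proof -
  note [measurable] = meas
  define a where "a = real k * h"
  have a: "0 \<le> a" "real (Suc k) * h = a + h" using h by (auto simp: a_def algebra_simps)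
  define A where "A = {x. a < \<phi> x}"
  define A' where "A' = {x. a + h < \<phi> x}"
  define g where "g x = indicator {a<..a + h} (\<phi> x) * norm (grad \<phi> x)" for x
  define D where "D = (\<integral>x. indicator {a<..a + h} (\<phi> x) * (norm (grad \<phi> x))\<^sup>2 \<partial>lborel)"
  have [measurable]: "A \<in> sets borel" "A' \<in> sets borel" unfolding A_def A'_def by measurable
  have sub: "A \<subseteq> \<Omega>" "A' \<subseteq> A" using \<phi>_out a h by (force simp: A_def A'_def)+
  have fin: "A \<in> fmeasurable lborel" "A' \<in> fmeasurable lborel"
    using \<Omega>_fin emeasure_mono[OF sub(1), of lborel] emeasure_mono[OF order_trans[OF sub(2,1)], of lborel]
    by (auto intro!: fmeasurableI intro: le_less_trans)
  have "A - A' \<in> fmeasurable lborel" using fin by (intro fmeasurable_Diff) auto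
  then have iA: "integrable lborel (indicator A' :: pt \<Rightarrow> real)" "integrable lborel (indicator (A - A') :: pt \<Rightarrow> real)"
    using fin(2) by (auto intro!: integrable_real_indicator simp: fmeasurable_def simp del: Diff_iff)
  have diff: "measure lborel (A - A') = measure lborel A - measure lborel A'"
    using fin sub by (intro measure_Diff) (auto simp: fmeasurable_def less_top)
  have g2: "(g x)\<^sup>2 = indicator {a<..a + h} (\<phi> x) * (norm (grad \<phi> x))\<^sup>2" for x
    by (simp add: g_def indicator_def)
  have ig2: "integrable lborel (\<lambda>x. (g x)\<^sup>2)" unfolding g2
    by (rule Bochner_Integration.integrable_bound[OF grad2_integrable]) (auto simp: indicator_def)
  have gm [measurable]: "g \<in> borel_measurable lborel" unfolding g_def[abs_def] by measurable
  have gA: "g x = g x * indicator (A - A') x" for x by (auto simp: g_def A_def A'_def indicator_def)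
  have ig: "integrable lborel g" and CS: "(\<integral>x. g x \<partial>lborel)\<^sup>2 \<le> D * measure lborel (A - A')"
  proof -
    have i: "integrable lborel (\<lambda>x. (norm (g x))\<^sup>2)" "integrable lborel (\<lambda>x. (norm (indicator (A - A') x :: real))\<^sup>2)"
      using ig2 iA(2) by (simp_all add: power2_eq_square flip: indicator_inter_arith)
    have m: "(indicator (A - A') :: pt \<Rightarrow> real) \<in> borel_measurable lborel" by measurable
    show "integrable lborel g"
      using integrable_inner_L2[OF gm m i] by (simp add: gA[symmetric])
    show "(\<integral>x. g x \<partial>lborel)\<^sup>2 \<le> D * measure lborel (A - A')"
      using cauchy_schwarz_L2[OF gm m i]
      by (simp add: gA[symmetric] D_def g2 power2_eq_square[of "indicator _ _"] flip: indicator_inter_arith)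
  qed
  \<comment> \<open>The factor (1 - d)^2 is the height lost by \<open>ramp\<close>. The truncation
    is at its full height on A', and its gradient lives in the strip with size at most g /
    h.\<close>
  have key: "(1 - d)\<^sup>2 * (4 * pi * h\<^sup>2 * measure lborel A') \<le> D * measure lborel (A - A')" if d: "0 < d" "d \<le> 1/2" for d
  proof -
    define F where "F s = ramp d ((s - a) / h)" for s
    define F' where "F' s = ramp' d ((s - a) / h) / h" for s
    have "((\<lambda>s. (s - a) / h) has_real_derivative 1 / h) (at s)" for s
      using h by (auto intro!: derivative_eq_intros)
    from DERIV_chain2[OF ramp_DERIV[OF d(1)] this]
    have Fd: "(F has_real_derivative F' s) (at s)" for s by (simp add: F_def[abs_def] F'_def)
    have Fc: "continuous_on UNIV F'" unfolding F'_def[abs_def]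
      using h by (intro continuous_intros continuous_on_compose2[OF ramp'_continuous[OF d(1), of UNIV]]) auto
    have F0: "F 0 = 0" unfolding F_def using a h d by (intro ramp_values) (auto simp: divide_le_0_iff)
    note C = C1c_compose[OF \<phi> Fd Fc F0]
    have gr: "norm (grad (\<lambda>x. F (\<phi> x)) x) \<le> g x / h" for x
    proof -
      have "norm (grad (\<lambda>x. F (\<phi> x)) x) = F' (\<phi> x) * norm (grad \<phi> x)"
        unfolding C(2) using h ramp'_bounds(1)[OF d] by (simp add: F'_def)
      also have "F' (\<phi> x) \<le> indicator {a<..a + h} (\<phi> x) / h"
      proof (cases "\<phi> x \<in> {a<..a + h}")
        case True then show ?thesis using h ramp'_bounds(2)[OF d] by (simp add: F'_def divide_right_mono)
      next
        case False
        then have "(\<phi> x - a) / h \<le> 0 \<or> 1 \<le> (\<phi> x - a) / h" using h by (auto simp: field_simps)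
        then have "ramp' d ((\<phi> x - a) / h) = 0" using ramp'_bounds(3,4)[OF d] by blast
        then show ?thesis using h by (simp add: F'_def indicator_def)
      qed
      finally show ?thesis by (simp add: g_def mult_right_mono)
    qed
    have ic: "integrable lborel (\<lambda>x. norm (grad (\<lambda>x. F (\<phi> x)) x))"
      by (intro C1c_integrable[OF C(1)] continuous_intros C1c_continuous_grad[OF C(1)]) simp
    have if2: "integrable lborel (\<lambda>x. (F (\<phi> x))\<^sup>2)"
      by (intro C1c_integrable[OF C(1)] continuous_intros C1c_continuous[OF C(1)]) simp
    have "(1 - d)\<^sup>2 * measure lborel A' = (\<integral>x. (1 - d)\<^sup>2 * indicator A' x \<partial>lborel)" by simp
    also have "\<dots> \<le> (\<integral>x. (F (\<phi> x))\<^sup>2 \<partial>lborel)"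
    proof (rule integral_mono[OF _ if2])
      show "integrable lborel (\<lambda>x. (1 - d)\<^sup>2 * indicator A' x)" using iA by simp
      fix x show "(1 - d)\<^sup>2 * indicator A' x \<le> (F (\<phi> x))\<^sup>2"
      proof (cases "x \<in> A'")
        case True
        then have "1 \<le> (\<phi> x - a) / h" using h by (auto simp: A'_def field_simps)
        then show ?thesis using True ramp_values(2)[OF d] by (simp add: F_def)
      qed simp
    qed
    finally have 1: "(1 - d)\<^sup>2 * measure lborel A' \<le> (\<integral>x. (F (\<phi> x))\<^sup>2 \<partial>lborel)" .
    have "4 * pi * (\<integral>x. (F (\<phi> x))\<^sup>2 \<partial>lborel) \<le> (\<integral>x. norm (grad (\<lambda>x. F (\<phi> x)) x) \<partial>lborel)\<^sup>2"
      by (rule sobolev_L1[OF C(1)]) (use ramp_values(3)[OF d] in \<open>simp add: F_def\<close>)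
    also have "\<dots> \<le> (\<integral>x. g x / h \<partial>lborel)\<^sup>2"
      using gr ig ic by (intro power_mono integral_mono) auto
    also have "\<dots> = (\<integral>x. g x \<partial>lborel)\<^sup>2 / h\<^sup>2" by (simp add: power_divide)
    also have "\<dots> \<le> D * measure lborel (A - A') / h\<^sup>2" using CS by (intro divide_right_mono) auto
    finally have "4 * pi * (\<integral>x. (F (\<phi> x))\<^sup>2 \<partial>lborel) * h\<^sup>2 \<le> D * measure lborel (A - A')"
      using h by (simp add: pos_le_divide_eq)
    moreover have "4 * pi * ((1 - d)\<^sup>2 * measure lborel A') * h\<^sup>2 \<le> 4 * pi * (\<integral>x. (F (\<phi> x))\<^sup>2 \<partial>lborel) * h\<^sup>2"
      by (intro mult_right_mono mult_left_mono 1) auto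
    moreover have "(1 - d)\<^sup>2 * (4 * pi * h\<^sup>2 * measure lborel A') = 4 * pi * ((1 - d)\<^sup>2 * measure lborel A') * h\<^sup>2"
      by algebra
    ultimately show ?thesis by linarith
  qed
  have "(\<lambda>n. (1 - inverse (real (Suc n)))\<^sup>2 * (4 * pi * h\<^sup>2 * measure lborel A')) \<longlonglongrightarrow> (1 - 0)\<^sup>2 * (4 * pi * h\<^sup>2 * measure lborel A')"
    by (intro tendsto_intros LIMSEQ_inverse_real_of_nat)
  \<comment> \<open>The value d = 1 / (n + 1) is admissible in \<open>key\<close> only from n = 1
    on.\<close>
  moreover have "\<forall>n\<ge>1. (1 - inverse (real (Suc n)))\<^sup>2 * (4 * pi * h\<^sup>2 * measure lborel A') \<le> D * measure lborel (A - A')"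
  proof (intro allI impI key)
    fix n :: nat assume "1 \<le> n"
    then have "2 \<le> real (Suc n)" by simp
    then show "inverse (real (Suc n)) \<le> 1 / 2" using le_imp_inverse_le[of 2 "real (Suc n)"] by simp
  qed simp
  ultimately have "(1 - 0)\<^sup>2 * (4 * pi * h\<^sup>2 * measure lborel A') \<le> D * measure lborel (A - A')"
    by (intro LIMSEQ_le_const2[of _ _ "D * measure lborel (A - A')"] exI[of _ 1])
  then have "4 * pi * h\<^sup>2 * measure lborel A' \<le> D * (measure lborel A - measure lborel A')"
    by (simp add: diff)
  then show ?thesis unfolding a_def[symmetric] a(2) A_def A'_def D_def .
qed

text \<open>The layer cake sum of the level measures is estimated strip by strip and then by
  Cauchy-Schwarz over the strips: the Dirichlet energies add up to at most D, and the other factor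
  telescopes to half the square of the measure of \<Omega>. For the disc this is sharp on the
  torsion function.\<close>

lemma integral_le_torsion_bound:
  "(\<integral>x. \<phi> x \<partial>lborel) \<le> measure lborel \<Omega> * sqrt ((\<integral>x. (norm (grad \<phi> x))\<^sup>2 \<partial>lborel) / (8 * pi))"
proof -
  note [measurable] = meas
  define V where "V = measure lborel \<Omega>"
  define D where "D = (\<integral>x. (norm (grad \<phi> x))\<^sup>2 \<partial>lborel)"
  have D0: "D \<ge> 0" by (simp add: D_def)
  obtain B where B: "\<And>x. norm (\<phi> x) \<le> B"
  proof -
    obtain R where R: "\<And>x. R < norm x \<Longrightarrow> \<phi> x = 0" using C1c_support[OF \<phi>] by metis
    show ?thesis using bounded_support_bound[OF C1c_continuous[OF \<phi>] R] that by blast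
  qed
  have main: "(\<integral>x. \<phi> x \<partial>lborel) \<le> h * V + V * sqrt (D / (8 * pi))" if h: "h > 0" for h
  proof -
    define m where "m k = measure lborel {x. real k * h < \<phi> x}" for k
    define Dk where "Dk k = (\<integral>x. indicator {real k * h<..real (Suc k) * h} (\<phi> x) * (norm (grad \<phi> x))\<^sup>2 \<partial>lborel)" for k
    have sub: "{x. real k * h < \<phi> x} \<subseteq> \<Omega>" for k
    proof
      fix x assume "x \<in> {x. real k * h < \<phi> x}"
      moreover have "0 \<le> real k * h" using h by simp
      ultimately have "\<phi> x \<noteq> 0" by auto
      then show "x \<in> \<Omega>" using \<phi>_out by blast
    qed
    have Lfin: "{x. real k * h < \<phi> x} \<in> fmeasurable lborel" for k
      using emeasure_mono[OF sub[of k], of lborel] \<Omega>_fin by (intro fmeasurableI) (auto intro: le_less_trans)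
    have iL: "integrable lborel (\<lambda>x. indicator {real k * h<..} (\<phi> x) :: real)" for k
    proof -
      have "integrable lborel (indicator {x. real k * h < \<phi> x} :: pt \<Rightarrow> real)"
        using Lfin[of k] by (intro integrable_real_indicator) (auto simp: fmeasurable_def)
      moreover have "(indicator {x. real k * h < \<phi> x} :: pt \<Rightarrow> real) = (\<lambda>x. indicator {real k * h<..} (\<phi> x))"
        by (auto simp: indicator_def fun_eq_iff)
      ultimately show ?thesis by simp
    qed
    have mL: "(\<integral>x. indicator {real k * h<..} (\<phi> x) \<partial>lborel) = m k" for k
    proof -
      have "(\<lambda>x. indicator {real k * h<..} (\<phi> x)) = (indicator {x. real k * h < \<phi> x} :: pt \<Rightarrow> real)"
        by (auto simp: indicator_def fun_eq_iff)
      then show ?thesis by (simp add: m_def)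
    qed
    have m0: "0 \<le> m k" for k by (simp add: m_def)
    have mV: "m 0 \<le> V" unfolding m_def V_def
      using sub[of 0] \<Omega>_fin by (intro measure_mono_fmeasurable) (auto intro: fmeasurableI)
    have mdec: "m (Suc k) \<le> m k" for k unfolding m_def
    proof (rule measure_mono_fmeasurable[OF _ _ Lfin])
      have "real k * h \<le> real (Suc k) * h" using h by (intro mult_right_mono) auto
      then show "{x. real (Suc k) * h < \<phi> x} \<subseteq> {x. real k * h < \<phi> x}" by auto
    qed (use Lfin[of "Suc k"] in auto)
    have Dk0: "0 \<le> Dk k" for k by (simp add: Dk_def)
    have iDk: "integrable lborel (\<lambda>x. indicator {real k * h<..real (Suc k) * h} (\<phi> x) * (norm (grad \<phi> x))\<^sup>2)" for k
      by (rule Bochner_Integration.integrable_bound[OF grad2_integrable]) (auto simp: indicator_def)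
    \<comment> \<open>Multiplying the strip inequality by m (Suc k) makes its left side a square.
      The root then splits into an energy factor and a level factor, ready for Cauchy-Schwarz over
      k.\<close>
    have strip: "h * m (Suc k) \<le> sqrt (Dk k / (4 * pi)) * sqrt (m (Suc k) * (m k - m (Suc k)))" for k
    proof -
      have "4 * pi * h\<^sup>2 * m (Suc k) \<le> Dk k * (m k - m (Suc k))"
        unfolding m_def Dk_def by (rule strip_inequality[OF h])
      then have "m (Suc k) * (4 * pi * h\<^sup>2 * m (Suc k)) \<le> m (Suc k) * (Dk k * (m k - m (Suc k)))"
        by (intro mult_left_mono m0)
      then have "(h * m (Suc k))\<^sup>2 \<le> Dk k / (4 * pi) * (m (Suc k) * (m k - m (Suc k)))"
        by (simp add: power2_eq_square field_simps)
      then show ?thesis unfolding real_sqrt_mult[symmetric] by (rule real_le_rsqrt)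
    qed
    \<comment> \<open>K strips reach the maximum of the function. The staircase uses one level more:
      level 0 is controlled by no strip and contributes the error h V, which vanishes with
      h.\<close>
    define K where "K = nat \<lceil>B / h\<rceil>"
    have K: "\<phi> x \<le> real (Suc K) * h" for x
    proof -
      have "B / h \<le> real K" unfolding K_def by (rule real_nat_ceiling_ge)
      then have "B \<le> real K * h" using h by (simp add: divide_le_eq)
      also have "\<dots> \<le> real (Suc K) * h" using h by (intro mult_right_mono) auto
      finally show ?thesis using B[of x] by simp
    qed
    have "(\<Sum>k<K. h * m (Suc k)) \<le> (\<Sum>k<K. sqrt (Dk k / (4 * pi)) * sqrt (m (Suc k) * (m k - m (Suc k))))"
      by (intro sum_mono strip)
    also have "\<dots> \<le> sqrt ((\<Sum>k<K. (sqrt (Dk k / (4 * pi)))\<^sup>2) * (\<Sum>k<K. (sqrt (m (Suc k) * (m k - m (Suc k))))\<^sup>2))"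
      by (intro real_le_rsqrt Cauchy_Schwarz_ineq_sum)
    also have "(\<Sum>k<K. (sqrt (Dk k / (4 * pi)))\<^sup>2) = (\<Sum>k<K. Dk k) / (4 * pi)"
      using Dk0 by (simp add: sum_divide_distrib)
    also have "(\<Sum>k<K. (sqrt (m (Suc k) * (m k - m (Suc k))))\<^sup>2) = (\<Sum>k<K. m (Suc k) * (m k - m (Suc k)))"
      using m0 mdec by (intro sum.cong refl real_sqrt_pow2) auto
    also have "sqrt ((\<Sum>k<K. Dk k) / (4 * pi) * (\<Sum>k<K. m (Suc k) * (m k - m (Suc k)))) \<le> sqrt (D / (4 * pi) * (V\<^sup>2 / 2))"
    proof (intro real_sqrt_le_mono mult_mono divide_right_mono)
      have "(\<Sum>k<K. Dk k) = (\<integral>x. (\<Sum>k<K. indicator {real k * h<..real (Suc k) * h} (\<phi> x) * (norm (grad \<phi> x))\<^sup>2) \<partial>lborel)"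
        unfolding Dk_def by (rule Bochner_Integration.integral_sum[symmetric]) (rule iDk)
      also have "\<dots> \<le> D" unfolding D_def
      proof (rule integral_mono[OF _ grad2_integrable])
        show "integrable lborel (\<lambda>x. \<Sum>k<K. indicator {real k * h<..real (Suc k) * h} (\<phi> x) * (norm (grad \<phi> x))\<^sup>2)"
          by (intro Bochner_Integration.integrable_sum iDk)
        fix x show "(\<Sum>k<K. indicator {real k * h<..real (Suc k) * h} (\<phi> x) * (norm (grad \<phi> x))\<^sup>2) \<le> (norm (grad \<phi> x))\<^sup>2"
          unfolding sum_distrib_right[symmetric] level_indicator_sum[OF h] by (simp add: indicator_def)
      qed
      finally show "(\<Sum>k<K. Dk k) \<le> D" .
      \<comment> \<open>Lower Riemann sum for the integral of m dm. This is the factor 2 that turns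
        4 pi into 8 pi.\<close>
      have "m (Suc k) * (m k - m (Suc k)) \<le> ((m k)\<^sup>2 - (m (Suc k))\<^sup>2) / 2" for k
        using zero_le_power2[of "m k - m (Suc k)"] by (simp add: power2_eq_square algebra_simps)
      then have "(\<Sum>k<K. m (Suc k) * (m k - m (Suc k))) \<le> (\<Sum>k<K. ((m k)\<^sup>2 - (m (Suc k))\<^sup>2) / 2)"
        by (rule sum_mono)
      also have "\<dots> = ((m 0)\<^sup>2 - (m K)\<^sup>2) / 2"
        by (simp only: sum_divide_distrib[symmetric] sum_lessThan_telescope'[of "\<lambda>k. (m k)\<^sup>2"])
      also have "\<dots> \<le> V\<^sup>2 / 2" 
        using power_mono[OF mV m0, of 2] by (intro divide_right_mono) (auto simp: diff_le_eq intro: add_increasing2)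
      finally show "(\<Sum>k<K. m (Suc k) * (m k - m (Suc k))) \<le> V\<^sup>2 / 2" .
      show "0 \<le> (\<Sum>k<K. m (Suc k) * (m k - m (Suc k)))"
        using m0 mdec by (intro sum_nonneg mult_nonneg_nonneg) auto
    qed (use D0 in auto)
    also have "\<dots> = V * sqrt (D / (8 * pi))"
    proof -
      have "D / (4 * pi) * (V\<^sup>2 / 2) = V\<^sup>2 * (D / (8 * pi))" by simp
      then show ?thesis by (simp add: real_sqrt_mult V_def del: times_divide_eq_right)
    qed
    finally have S: "(\<Sum>k<K. h * m (Suc k)) \<le> V * sqrt (D / (8 * pi))" .
    have "(\<integral>x. \<phi> x \<partial>lborel) \<le> (\<integral>x. (\<Sum>k<Suc K. h * indicator {real k * h<..} (\<phi> x)) \<partial>lborel)"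
    proof (rule integral_mono)
      show "integrable lborel \<phi>" by (rule C1c_integrable[OF \<phi> C1c_continuous[OF \<phi>]])
      show "integrable lborel (\<lambda>x. \<Sum>k<Suc K. h * indicator {real k * h<..} (\<phi> x))"
        by (intro Bochner_Integration.integrable_sum integrable_mult_right iL)
      fix x show "\<phi> x \<le> (\<Sum>k<Suc K. h * indicator {real k * h<..} (\<phi> x))"
        using layer_sum_ge[OF h, of "\<phi> x" "Suc K"] K[of x] by (simp only: min_absorb1)
    qed
    also have "\<dots> = (\<Sum>k<Suc K. h * m k)"
      by (subst Bochner_Integration.integral_sum) (use iL in \<open>simp_all add: mL del: sum.lessThan_Suc\<close>)
    also have "\<dots> = h * m 0 + (\<Sum>k<K. h * m (Suc k))" by (rule sum.lessThan_Suc_shift)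
    also have "\<dots> \<le> h * V + V * sqrt (D / (8 * pi))"
      using S mV h by (intro add_mono mult_left_mono) auto
    finally show ?thesis .
  qed
  have "(\<lambda>n. inverse (real (Suc n)) * V + V * sqrt (D / (8 * pi))) \<longlonglongrightarrow> 0 * V + V * sqrt (D / (8 * pi))"
    by (intro tendsto_intros LIMSEQ_inverse_real_of_nat)
  moreover have "\<forall>n\<ge>0. (\<integral>x. \<phi> x \<partial>lborel) \<le> inverse (real (Suc n)) * V + V * sqrt (D / (8 * pi))"
    by (intro allI impI main) simp
  ultimately have "(\<integral>x. \<phi> x \<partial>lborel) \<le> 0 * V + V * sqrt (D / (8 * pi))"
    by (intro LIMSEQ_le_const[of _ _ "\<integral>x. \<phi> x \<partial>lborel"] exI[of _ 0])
  then show ?thesis by (simp add: V_def D_def)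
qed

text \<open>The Sobolev inequality for \<phi>^2 bounds the fourth power by S D, and Cauchy-Schwarz
  on \<Omega> bounds S^2 by the measure times the fourth power; one factor S cancels. The constant
  is not sharp: the lemma serves only to make minimising sequences converge in L2.\<close>

lemma poincare:
  "(\<integral>x. (\<phi> x)\<^sup>2 \<partial>lborel) \<le> measure lborel \<Omega> / pi * (\<integral>x. (norm (grad \<phi> x))\<^sup>2 \<partial>lborel)"
proof -
  note [measurable] = meas
  define V where "V = measure lborel \<Omega>"
  define D where "D = (\<integral>x. (norm (grad \<phi> x))\<^sup>2 \<partial>lborel)"
  define S where "S = (\<integral>x. (\<phi> x)\<^sup>2 \<partial>lborel)"
  have D0: "D \<ge> 0" "V \<ge> 0" "S \<ge> 0" by (simp_all add: D_def V_def S_def)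
  have d2: "((\<lambda>s. s\<^sup>2) has_real_derivative 2 * s) (at s)" for s :: real
    by (auto intro!: derivative_eq_intros)
  note C = C1c_compose[OF \<phi> d2]
  have C1: "C1c (\<lambda>x. (\<phi> x)\<^sup>2)" and C2: "grad (\<lambda>x. (\<phi> x)\<^sup>2) x = (2 * \<phi> x) *\<^sub>R grad \<phi> x" for x
    by (auto intro!: C continuous_intros)
  have i2: "integrable lborel (\<lambda>x. (norm (\<phi> x))\<^sup>2)"
    by (intro C1c_integrable[OF \<phi>] continuous_intros C1c_continuous[OF \<phi>]) simp
  have i4: "integrable lborel (\<lambda>x. (norm ((\<phi> x)\<^sup>2))\<^sup>2)"
    by (intro C1c_integrable[OF \<phi>] continuous_intros C1c_continuous[OF \<phi>]) simp
  have ig: "integrable lborel (\<lambda>x. (norm (norm (grad \<phi> x)))\<^sup>2)" using grad2_integrable by simp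
  have iabs: "integrable lborel (\<lambda>x. (norm \<bar>\<phi> x\<bar>)\<^sup>2)" using i2 by simp
  have sob: "4 * pi * (\<integral>x. ((\<phi> x)\<^sup>2)\<^sup>2 \<partial>lborel) \<le> (\<integral>x. norm (grad (\<lambda>x. (\<phi> x)\<^sup>2) x) \<partial>lborel)\<^sup>2"
    by (rule sobolev_L1[OF C1]) simp
  also have "(\<integral>x. norm (grad (\<lambda>x. (\<phi> x)\<^sup>2) x) \<partial>lborel) = 2 * (\<integral>x. \<bar>\<phi> x\<bar> \<bullet> norm (grad \<phi> x) \<partial>lborel)"
    unfolding C2 by (simp add: abs_mult mult.assoc)
  also have "(2 * (\<integral>x. \<bar>\<phi> x\<bar> \<bullet> norm (grad \<phi> x) \<partial>lborel))\<^sup>2 \<le> 4 * (S * D)"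
    using cauchy_schwarz_L2[OF _ _ iabs ig] by (simp add: power_mult_distrib S_def D_def)
  finally have 1: "pi * (\<integral>x. ((\<phi> x)\<^sup>2)\<^sup>2 \<partial>lborel) \<le> S * D" by simp
  have i\<Omega>: "integrable lborel (\<lambda>x. (norm (indicator \<Omega> x :: real))\<^sup>2)"
  proof -
    have "integrable lborel (indicator \<Omega> :: pt \<Rightarrow> real)" using \<Omega>_fin by (intro integrable_real_indicator) auto
    moreover have "(\<lambda>x. (norm (indicator \<Omega> x :: real))\<^sup>2) = indicator \<Omega>" by (auto simp: indicator_def)
    ultimately show ?thesis by simp
  qed
  have ind: "(\<lambda>x. (norm (indicator \<Omega> x :: real))\<^sup>2) = indicator \<Omega>" by (auto simp: indicator_def)
  have e: "(\<lambda>x. (\<phi> x)\<^sup>2 \<bullet> (indicator \<Omega> x :: real)) = (\<lambda>x. (\<phi> x)\<^sup>2)"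
    using \<phi>_out by (force simp: indicator_def)
  have n: "(norm ((\<phi> x)\<^sup>2))\<^sup>2 = ((\<phi> x)\<^sup>2)\<^sup>2" for x by simp
  have V: "(\<integral>x. indicator \<Omega> x \<partial>lborel) = V" by (simp add: V_def)
  have "(\<integral>x. (\<phi> x)\<^sup>2 \<bullet> (indicator \<Omega> x :: real) \<partial>lborel)\<^sup>2 \<le>
     (\<integral>x. (norm ((\<phi> x)\<^sup>2))\<^sup>2 \<partial>lborel) * (\<integral>x. (norm (indicator \<Omega> x :: real))\<^sup>2 \<partial>lborel)"
    by (rule cauchy_schwarz_L2[OF _ _ i4 i\<Omega>]) measurable
  then have 2: "S\<^sup>2 \<le> (\<integral>x. ((\<phi> x)\<^sup>2)\<^sup>2 \<partial>lborel) * V" unfolding e ind n V S_def .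
  have "S * (pi * S) = pi * S\<^sup>2" by (simp add: power2_eq_square)
  also have "\<dots> \<le> pi * ((\<integral>x. ((\<phi> x)\<^sup>2)\<^sup>2 \<partial>lborel) * V)" using 2 by (intro mult_left_mono) auto
  also have "\<dots> = (pi * (\<integral>x. ((\<phi> x)\<^sup>2)\<^sup>2 \<partial>lborel)) * V" by simp
  also have "\<dots> \<le> S * D * V" using 1 D0 by (intro mult_right_mono) auto
  finally have "S * (pi * S) \<le> S * (D * V)" by (simp add: mult.assoc)
  then have "pi * S \<le> D * V" using D0 by (cases "S = 0") auto
  then show ?thesis unfolding S_def[symmetric] D_def[symmetric] V_def[symmetric] by (simp add: field_simps)
qed

end

subsection \<open>Torsional rigidity\<close>

lemma smooth_fun_lincomb:
  assumes "smooth_fun f" "smooth_fun g"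
  shows "smooth_fun (\<lambda>x. a * f x + b * g x)"
proof -
  have d: "iter_pd is f differentiable (at x)" "iter_pd is g differentiable (at x)" for "is" x
    using assms by (auto simp: smooth_fun_def)
  have eq: "iter_pd is (\<lambda>x. a * f x + b * g x) = (\<lambda>x. a * iter_pd is f x + b * iter_pd is g x)" for "is"
  proof (induction "is")
    case (Cons i js)
    have "pd i (\<lambda>x. a * iter_pd js f x + b * iter_pd js g x) x = a * pd i (iter_pd js f) x + b * pd i (iter_pd js g) x" for x
    proof -
      have "((\<lambda>x. a * iter_pd js f x + b * iter_pd js g x) has_derivative
        (\<lambda>w. a * frechet_derivative (iter_pd js f) (at x) w + b * frechet_derivative (iter_pd js g) (at x) w)) (at x)"
        using d[of js x] unfolding frechet_derivative_works by (auto intro!: derivative_eq_intros)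
      from frechet_derivative_at[OF this, symmetric] show ?thesis by (simp add: pd_def)
    qed
    then show ?case by (simp add: Cons)
  qed simp
  show ?thesis unfolding smooth_fun_def eq
    using d by (intro allI differentiable_add differentiable_mult differentiable_const)
qed

lemma test_fun_lincomb:
  assumes "test_fun \<Omega> f" "test_fun \<Omega> g"
  shows "test_fun \<Omega> (\<lambda>x. a * f x + b * g x)"
proof (rule test_funI[where K="tsupport f \<union> tsupport g"])
  have "closed (tsupport h)" for h :: "pt \<Rightarrow> real" by (simp add: tsupport_def)
  then show "closed (tsupport f \<union> tsupport g)" by blast
  fix x assume "x \<notin> tsupport f \<union> tsupport g"
  then have "f x = 0" "g x = 0"
    using subsetD[OF closure_subset[of "{x. f x \<noteq> 0}"], of x] subsetD[OF closure_subset[of "{x. g x \<noteq> 0}"], of x]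
    by (auto simp: tsupport_def)
  then show "a * f x + b * g x = 0" by simp
qed (use assms in \<open>auto simp: test_fun_def smooth_fun_lincomb compact_imp_bounded\<close>)

lemma grad_lincomb:
  assumes "C1c f" "C1c g"
  shows "grad (\<lambda>x. a * f x + b * g x) x = a *\<^sub>R grad f x + b *\<^sub>R grad g x"
  by (rule grad_unique)
    (auto intro!: derivative_eq_intros C1c_has_derivative assms simp: inner_add_left)

lemma test_fun_zero: "test_fun \<Omega> (\<lambda>_. 0)"
proof (rule test_funI[where K="{}"])
  show "smooth_fun (\<lambda>_. 0)" by (rule bump_algebra_smooth[OF bump_algebra.const])
qed auto

section \<open>Completeness of L2 and passage to limits of test functions\<close>

lemma summable_norm_diff_convergent:
  fixes X :: "nat \<Rightarrow> 'a::banach"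
  assumes "summable (\<lambda>k. norm (X (Suc k) - X k))" shows "convergent X"
proof -
  have "summable (\<lambda>k. X (Suc k) - X k)" using assms by (rule summable_norm_cancel)
  then have "convergent (\<lambda>n. \<Sum>k<n. X (Suc k) - X k)" by (simp add: summable_iff_convergent)
  then have "convergent (\<lambda>n. X 0 + (X n - X 0))"
    unfolding sum_lessThan_telescope by (rule convergent_add[OF convergent_const])
  then show ?thesis by simp
qed

text \<open>Riesz-Fischer for distances stated as nonnegative integrals, the form in which
  \<open>torsion_fun\<close> asks for convergence. A fast subsequence converges almost everywhere,
  and Fatou shows that its limit is the L2 limit of the whole sequence.\<close>

lemma L2_complete:
  fixes f :: "nat \<Rightarrow> 'a \<Rightarrow> 'b::euclidean_space"
  assumes [measurable]: "\<And>n. f n \<in> borel_measurable M"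
    and Cauchy: "\<And>e::real. 0 < e \<Longrightarrow> \<exists>N. \<forall>m\<ge>N. \<forall>n\<ge>N. (\<integral>\<^sup>+x. ennreal ((norm (f m x - f n x))\<^sup>2) \<partial>M) \<le> ennreal e"
  obtains v where "v \<in> borel_measurable M" "(\<lambda>n. \<integral>\<^sup>+x. ennreal ((norm (f n x - v x))\<^sup>2) \<partial>M) \<longlonglongrightarrow> 0"
proof -
  define Q where "Q k N \<longleftrightarrow> (\<forall>m\<ge>N. \<forall>n\<ge>N. (\<integral>\<^sup>+x. ennreal ((norm (f m x - f n x))\<^sup>2) \<partial>M) \<le> ennreal ((1/4) ^ k))"
    for k N :: nat
  have "\<exists>N. Q k N" for k unfolding Q_def by (rule Cauchy) simp
  then obtain N where "\<And>k. Q k (N k)" by metis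
  then have N: "\<And>k m n. N k \<le> m \<Longrightarrow> N k \<le> n \<Longrightarrow> (\<integral>\<^sup>+x. ennreal ((norm (f m x - f n x))\<^sup>2) \<partial>M) \<le> ennreal ((1/4) ^ k)"
    unfolding Q_def by blast
  \<comment> \<open>The cumulative sum puts r k above N j for all j \<le> k although N need not be
    monotone; the summand k makes r tend to infinity.\<close>
  define r where "r k = k + (\<Sum>j\<le>k. N j)" for k
  have "N k \<le> (\<Sum>j\<le>k. N j)" for k by (intro member_le_sum) simp_all
  then have rN: "N k \<le> r k" "N k \<le> r (Suc k)" "k \<le> r k" for k by (simp_all add: r_def le_SucI trans_le_add1 trans_le_add2)
  define \<Delta> where "\<Delta> k x = (norm (f (r (Suc k)) x - f (r k) x))\<^sup>2" for k x
  have [measurable]: "\<Delta> k \<in> borel_measurable M" for k unfolding \<Delta>_def[abs_def] by measurable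
  \<comment> \<open>The weight 2^k still leaves a convergent series against 4^(-k). Its finiteness
    almost everywhere gives increments of order 2^(-k/2), which are summable.\<close>
  have "(\<integral>\<^sup>+x. (\<Sum>k. ennreal (2 ^ k * \<Delta> k x)) \<partial>M) = (\<Sum>k. \<integral>\<^sup>+x. ennreal (2 ^ k * \<Delta> k x) \<partial>M)"
    by (rule nn_integral_suminf) measurable
  also have "\<dots> \<le> (\<Sum>k. ennreal ((1/2) ^ k))"
  proof (rule suminf_le)
    fix k
    have "(\<integral>\<^sup>+x. ennreal (2 ^ k * \<Delta> k x) \<partial>M) = ennreal (2 ^ k) * (\<integral>\<^sup>+x. ennreal (\<Delta> k x) \<partial>M)"
      by (subst nn_integral_cmult[symmetric]) (auto simp: ennreal_mult \<Delta>_def)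
    also have "\<dots> \<le> ennreal (2 ^ k) * ennreal ((1/4) ^ k)"
      unfolding \<Delta>_def by (intro mult_left_mono N rN) simp
    also have "\<dots> = ennreal ((1/2) ^ k)" by (simp flip: ennreal_mult power_mult_distrib)
    finally show "(\<integral>\<^sup>+x. ennreal (2 ^ k * \<Delta> k x) \<partial>M) \<le> ennreal ((1/2) ^ k)" .
  qed auto
  also have "\<dots> = ennreal (\<Sum>k. (1/2) ^ k)" by (intro suminf_ennreal2 summable_geometric) auto
  also have "\<dots> < \<infinity>" by simp
  finally have "(\<integral>\<^sup>+x. (\<Sum>k. ennreal (2 ^ k * \<Delta> k x)) \<partial>M) \<noteq> \<infinity>" by simp
  then have fin: "AE x in M. (\<Sum>k. ennreal (2 ^ k * \<Delta> k x)) \<noteq> \<infinity>"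
    by (intro nn_integral_PInf_AE) measurable
  have conv: "AE x in M. convergent (\<lambda>k. f (r k) x)"
    using fin
  proof eventually_elim
    case (elim x)
    then have "summable (\<lambda>k. 2 ^ k * \<Delta> k x)"
      by (intro summable_suminf_not_top) (auto simp: \<Delta>_def)
    then have "(\<lambda>k. 2 ^ k * \<Delta> k x) \<longlonglongrightarrow> 0" by (rule summable_LIMSEQ_zero)
    then have "Bseq (\<lambda>k. 2 ^ k * \<Delta> k x)" by (rule convergent_imp_Bseq[OF convergentI])
    then obtain B where B: "B > 0" "\<And>k. norm (2 ^ k * \<Delta> k x) \<le> B" by (auto simp: Bseq_def)
    have le: "norm (f (r (Suc k)) x - f (r k) x) \<le> sqrt B * (sqrt (1/2)) ^ k" for k
    proof -
      have "2 ^ k * \<Delta> k x \<le> B" using B(2)[of k] by (simp add: \<Delta>_def)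
      then have "(norm (f (r (Suc k)) x - f (r k) x))\<^sup>2 \<le> B * (1/2) ^ k"
        by (simp add: \<Delta>_def power_one_over field_simps)
      then have "norm (f (r (Suc k)) x - f (r k) x) \<le> sqrt (B * (1/2) ^ k)" by (rule real_le_rsqrt)
      then show ?thesis by (simp only: real_sqrt_mult real_sqrt_power)
    qed
    have sm: "summable (\<lambda>k. sqrt B * (sqrt (1/2)) ^ k)"
      by (intro summable_mult summable_geometric) simp
    have "summable (\<lambda>k. norm (f (r (Suc k)) x - f (r k) x))"
    proof (rule summable_comparison_test'[OF sm])
      fix k show "norm (norm (f (r (Suc k)) x - f (r k) x)) \<le> sqrt B * (sqrt (1/2)) ^ k" using le[of k] by simp
    qed
    then show ?case by (rule summable_norm_diff_convergent)
  qed
  define v where "v x = lim (\<lambda>k. f (r k) x)" for x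
  have vm [measurable]: "v \<in> borel_measurable M" unfolding v_def[abs_def] by measurable
  \<comment> \<open>Fatou along the subsequence in the second index turns the Cauchy estimate into
    an estimate of the distance to v.\<close>
  have bound: "(\<integral>\<^sup>+x. ennreal ((norm (f m x - v x))\<^sup>2) \<partial>M) \<le> ennreal e"
    if e: "\<forall>m\<ge>N. \<forall>n\<ge>N. (\<integral>\<^sup>+x. ennreal ((norm (f m x - f n x))\<^sup>2) \<partial>M) \<le> ennreal e" and m: "m \<ge> N" for m N e
  proof -
    have "(\<integral>\<^sup>+x. ennreal ((norm (f m x - v x))\<^sup>2) \<partial>M) \<le> (\<integral>\<^sup>+x. liminf (\<lambda>k. ennreal ((norm (f m x - f (r k) x))\<^sup>2)) \<partial>M)"
    proof (rule nn_integral_mono_AE)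
      show "AE x in M. ennreal ((norm (f m x - v x))\<^sup>2) \<le> liminf (\<lambda>k. ennreal ((norm (f m x - f (r k) x))\<^sup>2))"
        using conv
      proof eventually_elim
        case (elim x)
        then have "(\<lambda>k. f (r k) x) \<longlonglongrightarrow> v x" unfolding v_def by (simp add: convergent_LIMSEQ_iff)
        then have "(\<lambda>k. ennreal ((norm (f m x - f (r k) x))\<^sup>2)) \<longlonglongrightarrow> ennreal ((norm (f m x - v x))\<^sup>2)"
          by (intro tendsto_intros)
        then have "liminf (\<lambda>k. ennreal ((norm (f m x - f (r k) x))\<^sup>2)) = ennreal ((norm (f m x - v x))\<^sup>2)"
          by (rule lim_imp_Liminf[OF sequentially_bot])
        then show ?case by (simp only: order_refl)
      qed
    qed
    also have "\<dots> \<le> liminf (\<lambda>k. \<integral>\<^sup>+x. ennreal ((norm (f m x - f (r k) x))\<^sup>2) \<partial>M)"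
    proof (rule nn_integral_liminf)
      show "(\<lambda>x. ennreal ((norm (f m x - f (r k) x))\<^sup>2)) \<in> borel_measurable M" for k by measurable
    qed
    also have "\<dots> \<le> limsup (\<lambda>k. \<integral>\<^sup>+x. ennreal ((norm (f m x - f (r k) x))\<^sup>2) \<partial>M)"
      by (rule Liminf_le_Limsup) simp
    also have "\<dots> \<le> ennreal e"
    proof (rule Limsup_bounded)
      show "\<forall>\<^sub>F k in sequentially. (\<integral>\<^sup>+x. ennreal ((norm (f m x - f (r k) x))\<^sup>2) \<partial>M) \<le> ennreal e"
        using eventually_ge_at_top[of N]
      proof eventually_elim
        case (elim k)
        then have "N \<le> r k" using rN(3)[of k] by linarith
        then show ?case using e m by blast
      qed
    qed
    finally show ?thesis .
  qed
  have "(\<lambda>n. \<integral>\<^sup>+x. ennreal ((norm (f n x - v x))\<^sup>2) \<partial>M) \<longlonglongrightarrow> 0"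
  proof (rule order_tendstoI)
    fix a :: ennreal assume "0 < a"
    then obtain e where e: "0 < e" "ennreal e < a"
    proof (cases a)
      case (real t)
      then show ?thesis using that[of "t / 2"] \<open>0 < a\<close> by (auto simp: ennreal_less_iff)
    next
      case top then show ?thesis using that[of 1] by simp
    qed
    obtain N where "\<forall>m\<ge>N. \<forall>n\<ge>N. (\<integral>\<^sup>+x. ennreal ((norm (f m x - f n x))\<^sup>2) \<partial>M) \<le> ennreal e" using Cauchy[OF e(1)] by blast
    from bound[OF this] show "\<forall>\<^sub>F n in sequentially. (\<integral>\<^sup>+x. ennreal ((norm (f n x - v x))\<^sup>2) \<partial>M) < a"
      using e(2) by (intro eventually_sequentiallyI[of N]) (blast intro: le_less_trans)
  qed simp
  then show ?thesis using vm that by blast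
qed

lemma
  fixes u :: "nat \<Rightarrow> 'a \<Rightarrow> 'b::euclidean_space"
  assumes um [measurable]: "\<And>n. u n \<in> borel_measurable M" "v \<in> borel_measurable M"
    and u2: "\<And>n. integrable M (\<lambda>x. (norm (u n x))\<^sup>2)"
    and lim: "(\<lambda>n. \<integral>\<^sup>+x. ennreal ((norm (u n x - v x))\<^sup>2) \<partial>M) \<longlonglongrightarrow> 0"
  shows L2_limit_integrable: "integrable M (\<lambda>x. (norm (v x))\<^sup>2)"
    and L2_limit_inner: "\<And>w. w \<in> borel_measurable M \<Longrightarrow> integrable M (\<lambda>x. (norm (w x))\<^sup>2) \<Longrightarrow>
      (\<lambda>n. \<integral>x. u n x \<bullet> w x \<partial>M) \<longlonglongrightarrow> (\<integral>x. v x \<bullet> w x \<partial>M)"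
    and L2_limit_norm: "(\<lambda>n. \<integral>x. (norm (u n x))\<^sup>2 \<partial>M) \<longlonglongrightarrow> (\<integral>x. (norm (v x))\<^sup>2 \<partial>M)"
proof -
  obtain n0 where "(\<integral>\<^sup>+x. ennreal ((norm (u n0 x - v x))\<^sup>2) \<partial>M) < 1"
    using order_tendstoD(2)[OF lim, of 1] by (auto simp: eventually_sequentially)
  from less_trans[OF this ennreal_one_less_top]
  have "(\<integral>\<^sup>+x. ennreal ((norm (u n0 x - v x))\<^sup>2) \<partial>M) < \<infinity>" by simp
  then have i0: "integrable M (\<lambda>x. (norm (u n0 x - v x))\<^sup>2)" by (intro integrableI_nonneg) auto
  have "integrable M (\<lambda>x. (norm (u n0 x - 1 *\<^sub>R (u n0 x - v x)))\<^sup>2)"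
    by (rule integrable_norm_L2[OF _ _ u2 i0]) measurable
  then show v2: "integrable M (\<lambda>x. (norm (v x))\<^sup>2)" by simp
  have d2: "integrable M (\<lambda>x. (norm (u n x - v x))\<^sup>2)" for n
    using integrable_norm_L2[OF um u2[of n] v2, of 1] by simp
  define d where "d n = (\<integral>x. (norm (u n x - v x))\<^sup>2 \<partial>M)" for n
  have "(\<lambda>n. ennreal (d n)) \<longlonglongrightarrow> ennreal 0"
    using lim d2 by (simp add: nn_integral_eq_integral d_def)
  then have d: "d \<longlonglongrightarrow> 0" by (subst (asm) tendsto_ennreal_iff) (auto simp: d_def)
  show inner: "(\<lambda>n. \<integral>x. u n x \<bullet> w x \<partial>M) \<longlonglongrightarrow> (\<integral>x. v x \<bullet> w x \<partial>M)"
    if wm [measurable]: "w \<in> borel_measurable M" and w2: "integrable M (\<lambda>x. (norm (w x))\<^sup>2)" for w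
  proof -
    define W where "W = (\<integral>x. (norm (w x))\<^sup>2 \<partial>M)"
    have "(\<lambda>n. (\<integral>x. u n x \<bullet> w x \<partial>M) - (\<integral>x. v x \<bullet> w x \<partial>M)) \<longlonglongrightarrow> 0"
    proof (rule Lim_null_comparison)
      have "(\<lambda>n. sqrt (d n * W)) \<longlonglongrightarrow> sqrt (0 * W)" by (intro tendsto_intros d)
      then show "(\<lambda>n. sqrt (d n * W)) \<longlonglongrightarrow> 0" by simp
      show "\<forall>\<^sub>F n in sequentially. norm ((\<integral>x. u n x \<bullet> w x \<partial>M) - (\<integral>x. v x \<bullet> w x \<partial>M)) \<le> sqrt (d n * W)"
      proof (rule always_eventually, rule allI)
        fix n
        have dm: "(\<lambda>x. u n x - v x) \<in> borel_measurable M" by measurable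
        have "(\<integral>x. u n x \<bullet> w x \<partial>M) - (\<integral>x. v x \<bullet> w x \<partial>M) = (\<integral>x. (u n x - v x) \<bullet> w x \<partial>M)"
          unfolding inner_diff_left
          by (rule Bochner_Integration.integral_diff[symmetric]) (intro integrable_inner_L2 um wm u2 v2 w2)+
        moreover have "(\<integral>x. (u n x - v x) \<bullet> w x \<partial>M)\<^sup>2 \<le> d n * W"
          unfolding d_def W_def by (rule cauchy_schwarz_L2[OF dm wm d2 w2])
        ultimately show "norm ((\<integral>x. u n x \<bullet> w x \<partial>M) - (\<integral>x. v x \<bullet> w x \<partial>M)) \<le> sqrt (d n * W)"
          by (simp add: real_le_rsqrt)
      qed
    qed
    then show ?thesis by (rule LIM_zero_cancel)
  qed
  have "(\<lambda>n. d n + 2 * (\<integral>x. u n x \<bullet> v x \<partial>M) - (\<integral>x. (norm (v x))\<^sup>2 \<partial>M)) \<longlonglongrightarrow>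
    0 + 2 * (\<integral>x. v x \<bullet> v x \<partial>M) - (\<integral>x. (norm (v x))\<^sup>2 \<partial>M)"
    by (intro tendsto_intros d inner um v2)
  moreover have "d n + 2 * (\<integral>x. u n x \<bullet> v x \<partial>M) - (\<integral>x. (norm (v x))\<^sup>2 \<partial>M) = (\<integral>x. (norm (u n x))\<^sup>2 \<partial>M)" for n
    using integral_norm_L2[OF um u2[of n] v2, of 1] by (simp add: d_def)
  ultimately show "(\<lambda>n. \<integral>x. (norm (u n x))\<^sup>2 \<partial>M) \<longlonglongrightarrow> (\<integral>x. (norm (v x))\<^sup>2 \<partial>M)"
    by (simp add: dot_square_norm)
qed

text \<open>The body of \<open>torsion_fun\<close> with the weak gradient and the approximating
  sequence as parameters, so that two solutions and their approximations can be played against each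
  other.\<close>

definition torsion_witness :: "pt set \<Rightarrow> (pt \<Rightarrow> real) \<Rightarrow> (pt \<Rightarrow> pt) \<Rightarrow> (nat \<Rightarrow> pt \<Rightarrow> real) \<Rightarrow> bool" where
  "torsion_witness \<Omega> v g \<phi> \<longleftrightarrow> v \<in> borel_measurable lborel \<and> g \<in> borel_measurable lborel \<and>
    (\<forall>n. test_fun \<Omega> (\<phi> n)) \<and>
    (\<lambda>n. \<integral>\<^sup>+ x. ennreal ((\<phi> n x - v x)\<^sup>2) \<partial>lborel) \<longlonglongrightarrow> 0 \<and>
    (\<lambda>n. \<integral>\<^sup>+ x. ennreal ((norm (grad (\<phi> n) x - g x))\<^sup>2) \<partial>lborel) \<longlonglongrightarrow> 0 \<and>
    (\<forall>\<psi>. test_fun \<Omega> \<psi> \<longrightarrow> (\<integral>x. g x \<bullet> grad \<psi> x \<partial>lborel) = (\<integral>x. \<psi> x \<partial>lborel))"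

lemma torsion_fun_iff_witness: "torsion_fun \<Omega> v \<longleftrightarrow> (\<exists>g \<phi>. torsion_witness \<Omega> v g \<phi>)"
  unfolding torsion_fun_def torsion_witness_def by blast

context
  fixes \<Omega> :: "pt set"
  assumes \<Omega>: "open \<Omega>" "bounded \<Omega>"
begin

private lemma \<Omega>m: "\<Omega> \<in> sets borel" using \<Omega>(1) by simp

private lemma \<Omega>fin: "emeasure lborel \<Omega> < \<infinity>" by (rule emeasure_bounded_finite[OF \<Omega>(2)])

private lemma tC: "test_fun \<Omega> \<phi> \<Longrightarrow> C1c \<phi>" by (rule test_fun_C1c)

private lemma tm:
  "test_fun \<Omega> \<phi> \<Longrightarrow> \<phi> \<in> borel_measurable borel" "test_fun \<Omega> \<phi> \<Longrightarrow> grad \<phi> \<in> borel_measurable borel"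
  using C1c_measurable[OF tC] by blast+

private lemma t2: "test_fun \<Omega> \<phi> \<Longrightarrow> integrable lborel (\<lambda>x. (norm (\<phi> x))\<^sup>2)"
  "test_fun \<Omega> \<phi> \<Longrightarrow> integrable lborel (\<lambda>x. (norm (grad \<phi> x))\<^sup>2)"
  "test_fun \<Omega> \<phi> \<Longrightarrow> integrable lborel \<phi>"
proof -
  assume t: "test_fun \<Omega> \<phi>"
  note C = C1c_integrable[OF tC[OF t]] and c = C1c_continuous[OF tC[OF t]] C1c_continuous_grad[OF tC[OF t]]
  show "integrable lborel (\<lambda>x. (norm (\<phi> x))\<^sup>2)" by (intro C continuous_intros c) simp
  show "integrable lborel (\<lambda>x. (norm (grad \<phi> x))\<^sup>2)" by (intro C continuous_intros c) simp
  show "integrable lborel \<phi>" by (rule C[OF c(1)])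
qed

lemma test_fun_torsion_bound:
  assumes "test_fun \<Omega> \<phi>"
  shows "(\<integral>x. \<phi> x \<partial>lborel) \<le> sqrt ((measure lborel \<Omega>)\<^sup>2 / (8 * pi) * (\<integral>x. (norm (grad \<phi> x))\<^sup>2 \<partial>lborel))"
proof -
  have "(\<integral>x. \<phi> x \<partial>lborel) \<le> measure lborel \<Omega> * sqrt ((\<integral>x. (norm (grad \<phi> x))\<^sup>2 \<partial>lborel) / (8 * pi))"
    using test_fun_zero_outside(1)[OF assms] by (intro integral_le_torsion_bound \<Omega>m \<Omega>fin tC assms)
  also have "\<dots> = sqrt ((measure lborel \<Omega>)\<^sup>2) * sqrt ((\<integral>x. (norm (grad \<phi> x))\<^sup>2 \<partial>lborel) / (8 * pi))" by simp
  finally show ?thesis unfolding real_sqrt_mult[symmetric] by simp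
qed

text \<open>The energy identity comes from testing the weak equation with the approximations
  themselves and letting n tend to infinity. Integrals of v are limits because \<Omega> has finite
  measure and v vanishes almost everywhere outside.\<close>

lemma
  assumes w: "torsion_witness \<Omega> v g \<phi>"
  shows torsion_witness_integrable: "integrable lborel (\<lambda>x. (norm (g x))\<^sup>2)"
    and torsion_witness_limit: "(\<lambda>n. \<integral>x. \<phi> n x \<partial>lborel) \<longlonglongrightarrow> (\<integral>x. v x \<partial>lborel)"
    and torsion_witness_inner: "\<And>w. w \<in> borel_measurable lborel \<Longrightarrow> integrable lborel (\<lambda>x. (norm (w x))\<^sup>2) \<Longrightarrow>
      (\<lambda>n. \<integral>x. grad (\<phi> n) x \<bullet> w x \<partial>lborel) \<longlonglongrightarrow> (\<integral>x. g x \<bullet> w x \<partial>lborel)"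
    and torsion_witness_norm: "(\<lambda>n. \<integral>x. (norm (grad (\<phi> n) x))\<^sup>2 \<partial>lborel) \<longlonglongrightarrow> (\<integral>x. (norm (g x))\<^sup>2 \<partial>lborel)"
    and torsion_witness_energy: "(\<integral>x. v x \<partial>lborel) = (\<integral>x. (norm (g x))\<^sup>2 \<partial>lborel)"
proof -
  from w have vm: "v \<in> borel_measurable lborel" and gm: "g \<in> borel_measurable lborel"
    and \<phi>: "\<And>n. test_fun \<Omega> (\<phi> n)"
    and lv: "(\<lambda>n. \<integral>\<^sup>+ x. ennreal ((\<phi> n x - v x)\<^sup>2) \<partial>lborel) \<longlonglongrightarrow> 0"
    and lg: "(\<lambda>n. \<integral>\<^sup>+ x. ennreal ((norm (grad (\<phi> n) x - g x))\<^sup>2) \<partial>lborel) \<longlonglongrightarrow> 0"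
    and weak: "\<And>\<psi>. test_fun \<Omega> \<psi> \<Longrightarrow> (\<integral>x. g x \<bullet> grad \<psi> x \<partial>lborel) = (\<integral>x. \<psi> x \<partial>lborel)"
    by (simp_all add: torsion_witness_def)
  note [measurable] = vm gm
  have lv': "(\<lambda>n. \<integral>\<^sup>+ x. ennreal ((norm (\<phi> n x - v x))\<^sup>2) \<partial>lborel) \<longlonglongrightarrow> 0" using lv by simp
  have m1: "\<phi> n \<in> borel_measurable lborel" "grad (\<phi> n) \<in> borel_measurable lborel" for n
    unfolding measurable_lborel2 by (rule tm[OF \<phi>])+
  have t2n: "integrable lborel (\<lambda>x. (norm (\<phi> n x))\<^sup>2)" "integrable lborel (\<lambda>x. (norm (grad (\<phi> n) x))\<^sup>2)" for n
    by (rule t2[OF \<phi>])+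
  show gi: "integrable lborel (\<lambda>x. (norm (g x))\<^sup>2)"
    using m1(2) gm t2n(2) lg by (rule L2_limit_integrable)
  show gl: "(\<lambda>n. \<integral>x. grad (\<phi> n) x \<bullet> w x \<partial>lborel) \<longlonglongrightarrow> (\<integral>x. g x \<bullet> w x \<partial>lborel)"
    if "w \<in> borel_measurable lborel" "integrable lborel (\<lambda>x. (norm (w x))\<^sup>2)" for w
    using m1(2) gm t2n(2) lg that by (rule L2_limit_inner)
  show gn: "(\<lambda>n. \<integral>x. (norm (grad (\<phi> n) x))\<^sup>2 \<partial>lborel) \<longlonglongrightarrow> (\<integral>x. (norm (g x))\<^sup>2 \<partial>lborel)"
    using m1(2) gm t2n(2) lg by (rule L2_limit_norm)
  have ind: "integrable lborel (\<lambda>x. (norm (indicator \<Omega> x :: real))\<^sup>2)"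
  proof -
    have "integrable lborel (indicator \<Omega> :: pt \<Rightarrow> real)" using \<Omega>fin \<Omega>m by (intro integrable_real_indicator) auto
    moreover have "(\<lambda>x. (norm (indicator \<Omega> x :: real))\<^sup>2) = indicator \<Omega>" by (auto simp: indicator_def)
    ultimately show ?thesis by simp
  qed
  have v0: "AE x in lborel. v x * indicator \<Omega> x = v x"
  proof -
    \<comment> \<open>Outside \<Omega> the difference of the n-th test function and v is just - v,
      so its L2 norm there is at most a null sequence.\<close>
    have "(\<integral>\<^sup>+x. indicator (- \<Omega>) x * ennreal ((v x)\<^sup>2) \<partial>lborel) \<le> (\<integral>\<^sup>+ x. ennreal ((\<phi> n x - v x)\<^sup>2) \<partial>lborel)" for n
      using test_fun_zero_outside(1)[OF \<phi>[of n]] by (intro nn_integral_mono) (auto simp: indicator_def)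
    then have "(\<integral>\<^sup>+x. indicator (- \<Omega>) x * ennreal ((v x)\<^sup>2) \<partial>lborel) \<le> 0"
      by (intro LIMSEQ_le_const[OF lv] exI[of _ 0] allI impI)
    then have "(\<integral>\<^sup>+x. indicator (- \<Omega>) x * ennreal ((v x)\<^sup>2) \<partial>lborel) = 0" by simp
    moreover have "(\<lambda>x. indicator (- \<Omega>) x * ennreal ((v x)\<^sup>2)) \<in> borel_measurable lborel"
    proof -
      have "(indicator (- \<Omega>) :: pt \<Rightarrow> ennreal) \<in> borel_measurable lborel"
        using \<Omega>m by (intro borel_measurable_indicator) simp
      moreover have "(\<lambda>x. ennreal ((v x)\<^sup>2)) \<in> borel_measurable lborel"
        using vm by (intro measurable_compose[OF _ measurable_ennreal] borel_measurable_power)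
      ultimately show ?thesis by (rule borel_measurable_times_ennreal)
    qed
    ultimately have "AE x in lborel. indicator (- \<Omega>) x * ennreal ((v x)\<^sup>2) = 0"
      by (simp only: nn_integral_0_iff_AE)
    then show ?thesis
    proof eventually_elim
      case (elim x) then show ?case by (cases "x \<in> \<Omega>") auto
    qed
  qed
  have "(\<lambda>n. \<integral>x. \<phi> n x \<bullet> indicator \<Omega> x \<partial>lborel) \<longlonglongrightarrow> (\<integral>x. v x \<bullet> indicator \<Omega> x \<partial>lborel)"
  proof (rule L2_limit_inner[OF m1(1) vm t2n(1) lv' _ ind])
    show "indicator \<Omega> \<in> borel_measurable lborel" using \<Omega>m by (intro borel_measurable_indicator) simp
  qed
  moreover have "(\<integral>x. \<phi> n x \<bullet> indicator \<Omega> x \<partial>lborel) = (\<integral>x. \<phi> n x \<partial>lborel)" for n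
    using test_fun_zero_outside(1)[OF \<phi>[of n]]
    by (intro Bochner_Integration.integral_cong) (auto simp: indicator_def)
  moreover have "(\<integral>x. v x \<bullet> indicator \<Omega> x \<partial>lborel) = (\<integral>x. v x \<partial>lborel)"
  proof (rule integral_cong_AE)
    show "AE x in lborel. v x \<bullet> indicator \<Omega> x = v x" using v0 by simp
    have "(indicator \<Omega> :: pt \<Rightarrow> real) \<in> borel_measurable lborel"
      using \<Omega>m by (intro borel_measurable_indicator) simp
    then show "(\<lambda>x. v x \<bullet> indicator \<Omega> x) \<in> borel_measurable lborel"
      using vm by (intro borel_measurable_inner)
  qed (rule vm)
  ultimately show lim: "(\<lambda>n. \<integral>x. \<phi> n x \<partial>lborel) \<longlonglongrightarrow> (\<integral>x. v x \<partial>lborel)" by simp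
  have "(\<lambda>n. \<integral>x. \<phi> n x \<partial>lborel) \<longlonglongrightarrow> (\<integral>x. g x \<bullet> g x \<partial>lborel)"
    using gl[OF gm gi] weak[OF \<phi>] by (simp add: inner_commute)
  then show "(\<integral>x. v x \<partial>lborel) = (\<integral>x. (norm (g x))\<^sup>2 \<partial>lborel)"
    using LIMSEQ_unique[OF lim] by (simp add: dot_square_norm)
qed

text \<open>The approximations of each solution are tested in the equation of the other, so both
  integrals equal the integral of g \<bullet> g'. Equality of the integrals is all that the definite
  description in \<open>torsion\<close> asks for.\<close>

lemma torsion_fun_unique:
  assumes "torsion_fun \<Omega> v" "torsion_fun \<Omega> v'"
  shows "(\<integral>x. v x \<partial>lborel) = (\<integral>x. v' x \<partial>lborel)"
proof -
  obtain g \<phi> where 1: "torsion_witness \<Omega> v g \<phi>" using assms(1) by (auto simp: torsion_fun_iff_witness)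
  obtain g' \<phi>' where 2: "torsion_witness \<Omega> v' g' \<phi>'" using assms(2) by (auto simp: torsion_fun_iff_witness)
  have lim: "(\<lambda>n. \<integral>x. \<phi> n x \<partial>lborel) \<longlonglongrightarrow> (\<integral>x. g x \<bullet> g' x \<partial>lborel)"
    if 1: "torsion_witness \<Omega> v g \<phi>" and 2: "torsion_witness \<Omega> v' g' \<phi>'" for v g \<phi> v' g' \<phi>'
  proof -
    have "g' \<in> borel_measurable lborel" using 2 by (simp add: torsion_witness_def)
    moreover have "(\<integral>x. grad (\<phi> n) x \<bullet> g' x \<partial>lborel) = (\<integral>x. \<phi> n x \<partial>lborel)" for n
      using 1 2 by (simp add: torsion_witness_def inner_commute)
    ultimately show ?thesis
      using torsion_witness_inner[OF 1 _ torsion_witness_integrable[OF 2]] by simp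
  qed
  show ?thesis
    using LIMSEQ_unique[OF torsion_witness_limit[OF 1] lim[OF 1 2]] LIMSEQ_unique[OF torsion_witness_limit[OF 2] lim[OF 2 1]]
    by (simp add: inner_commute)
qed

lemma torsion_eq: "torsion_fun \<Omega> v \<Longrightarrow> torsion \<Omega> = (\<integral>x. v x \<partial>lborel)"
proof -
  assume v: "torsion_fun \<Omega> v"
  show ?thesis unfolding torsion_def
  proof (rule the_equality)
    show "\<exists>w. torsion_fun \<Omega> w \<and> (\<integral>x. v x \<partial>lborel) = (\<integral>x. w x \<partial>lborel)" using v by blast
    fix t assume "\<exists>w. torsion_fun \<Omega> w \<and> t = (\<integral>x. w x \<partial>lborel)"
    then obtain w where w: "torsion_fun \<Omega> w" "t = (\<integral>x. w x \<partial>lborel)" by blast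
    show "t = (\<integral>x. v x \<partial>lborel)" unfolding w(2) by (rule torsion_fun_unique[OF w(1) v])
  qed
qed

text \<open>In the limit the integral t equals the Dirichlet energy, so the bound for test functions
  becomes t \<le> sqrt (C t), that is t \<le> C.\<close>

lemma torsion_fun_integral_le:
  assumes "torsion_fun \<Omega> v"
  shows "(\<integral>x. v x \<partial>lborel) \<le> (measure lborel \<Omega>)\<^sup>2 / (8 * pi)"
proof -
  define C where "C = (measure lborel \<Omega>)\<^sup>2 / (8 * pi)"
  have C: "C \<ge> 0" by (simp add: C_def)
  obtain g \<phi> where w: "torsion_witness \<Omega> v g \<phi>" using assms by (auto simp: torsion_fun_iff_witness)
  then have \<phi>: "test_fun \<Omega> (\<phi> n)" for n by (simp add: torsion_witness_def)
  define t where "t = (\<integral>x. v x \<partial>lborel)"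
  have t: "t = (\<integral>x. (norm (g x))\<^sup>2 \<partial>lborel)" using torsion_witness_energy[OF w] by (simp add: t_def)
  have "(\<lambda>n. sqrt (C * (\<integral>x. (norm (grad (\<phi> n) x))\<^sup>2 \<partial>lborel))) \<longlonglongrightarrow> sqrt (C * t)"
    unfolding t by (intro tendsto_intros torsion_witness_norm[OF w])
  moreover have "(\<integral>x. \<phi> n x \<partial>lborel) \<le> sqrt (C * (\<integral>x. (norm (grad (\<phi> n) x))\<^sup>2 \<partial>lborel))" for n
    unfolding C_def by (rule test_fun_torsion_bound[OF \<phi>])
  ultimately have "t \<le> sqrt (C * t)"
    unfolding t_def by (intro LIMSEQ_le[OF torsion_witness_limit[OF w]]) auto
  have t0: "0 \<le> t" by (simp add: t)
  have "t\<^sup>2 \<le> (sqrt (C * t))\<^sup>2" using \<open>t \<le> sqrt (C * t)\<close> t0 by (rule power_mono)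
  then have "t * t \<le> C * t" using C t0 by (simp add: power2_eq_square)
  then have "t \<le> C" using t0 C by (cases "t = 0") auto
  then show ?thesis by (simp add: t_def C_def)
qed

text \<open>Direct method for J f = a f f / 2 - l f on test functions.
  \<open>test_fun_torsion_bound\<close> and the arithmetic-geometric mean give J \<ge> - C / 2. A
  minimising sequence is Cauchy in energy, hence in L2 by \<open>poincare\<close>, and its limit
  solves the weak equation.\<close>

lemma torsion_fun_exists: "\<exists>v. torsion_fun \<Omega> v"
proof -
  define a where "a f g = (\<integral>x. grad f x \<bullet> grad g x \<partial>lborel)" for f g :: "pt \<Rightarrow> real"
  define l where "l f = (\<integral>x. f x \<partial>lborel)" for f :: "pt \<Rightarrow> real"
  define C where "C = (measure lborel \<Omega>)\<^sup>2 / (8 * pi)"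
  define J where "J f = a f f / 2 - l f" for f
  define T where "T = {f. test_fun \<Omega> f}"
  have aa: "a f f = (\<integral>x. (norm (grad f x))\<^sup>2 \<partial>lborel)" for f by (simp add: a_def dot_square_norm)
  have a0: "0 \<le> a f f" for f by (simp add: aa)
  have gm: "f \<in> T \<Longrightarrow> grad f \<in> borel_measurable lborel" for f using tm(2)[of f] by (simp add: T_def)
  have g2: "f \<in> T \<Longrightarrow> integrable lborel (\<lambda>x. (norm (grad f x))\<^sup>2)" for f using t2(2)[of f] by (simp add: T_def)
  have comb: "(\<lambda>x. \<alpha> * f x + \<beta> * g x) \<in> T" if "f \<in> T" "g \<in> T" for f g \<alpha> \<beta>
    using that test_fun_lincomb by (simp add: T_def)
  have lcomb: "l (\<lambda>x. \<alpha> * f x + \<beta> * g x) = \<alpha> * l f + \<beta> * l g" if "f \<in> T" "g \<in> T" for f g \<alpha> \<beta>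
    using that t2(3)[of f] t2(3)[of g] by (simp add: l_def T_def)
  have acomb: "a (\<lambda>x. \<alpha> * f x + \<beta> * g x) (\<lambda>x. \<alpha> * f x + \<beta> * g x) = \<alpha>\<^sup>2 * a f f + 2 * \<alpha> * \<beta> * a f g + \<beta>\<^sup>2 * a g g"
    if "f \<in> T" "g \<in> T" for f g \<alpha> \<beta>
  proof -
    have i: "integrable lborel (\<lambda>x. grad f x \<bullet> grad g x)"
      using that by (intro integrable_inner_L2 gm g2)
    have i': "integrable lborel (\<lambda>x. grad f x \<bullet> grad f x)" "integrable lborel (\<lambda>x. grad g x \<bullet> grad g x)"
      using that by (auto intro!: integrable_inner_L2 gm g2)
    have gr: "grad (\<lambda>x. \<alpha> * f x + \<beta> * g x) x = \<alpha> *\<^sub>R grad f x + \<beta> *\<^sub>R grad g x" for x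
      using that by (intro grad_lincomb tC) (simp_all add: T_def)
    have "grad (\<lambda>x. \<alpha> * f x + \<beta> * g x) x \<bullet> grad (\<lambda>x. \<alpha> * f x + \<beta> * g x) x =
      \<alpha>\<^sup>2 * (grad f x \<bullet> grad f x) + 2 * \<alpha> * \<beta> * (grad f x \<bullet> grad g x) + \<beta>\<^sup>2 * (grad g x \<bullet> grad g x)" for x
      unfolding gr by (simp add: inner_add_left inner_add_right inner_commute power2_eq_square algebra_simps)
    then show ?thesis using i i' by (simp add: a_def)
  qed
  have J_low: "- C / 2 \<le> J f" if "f \<in> T" for f
  proof -
    have "l f \<le> sqrt (C * a f f)"
      unfolding l_def C_def aa using that by (intro test_fun_torsion_bound) (simp add: T_def)
    also have "\<dots> \<le> (C + a f f) / 2"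
      using arith_geo_mean_sqrt[of C "a f f"] a0[of f] by (simp add: C_def)
    finally show ?thesis by (simp add: J_def)
  qed
  have T0: "(\<lambda>_. 0) \<in> T" by (simp add: T_def test_fun_zero)
  have bdd: "bdd_below (J ` T)" using J_low by (intro bdd_belowI2[of _ "- C / 2"])
  define I where "I = Inf (J ` T)"
  have I: "I \<le> J f" if "f \<in> T" for f unfolding I_def using that bdd by (intro cInf_lower) auto
  have "\<exists>f. f \<in> T \<and> J f < I + 1 / real (Suc n)" for n
    using cInf_lessD[of "J ` T" "I + 1 / real (Suc n)"] T0 by (auto simp: I_def)
  then obtain \<phi> where \<phi>: "\<And>n. \<phi> n \<in> T" "\<And>n. J (\<phi> n) < I + 1 / real (Suc n)" by metis
  have \<phi>t: "test_fun \<Omega> (\<phi> n)" for n using \<phi>(1) by (simp add: T_def)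
  \<comment> \<open>Parallelogram law: the midpoint of f and g is again a competitor, so its J is at
    least I, and the difference pays for what J f and J g exceed I by.\<close>
  have par: "a (\<lambda>x. f x - g x) (\<lambda>x. f x - g x) \<le> 4 * (J f + J g - 2 * I)" if "f \<in> T" "g \<in> T" for f g
  proof -
    have "I \<le> J (\<lambda>x. 1/2 * f x + 1/2 * g x)" by (intro I comb that)
    also have "\<dots> = (a f f + 2 * a f g + a g g) / 8 - (l f + l g) / 2"
      unfolding J_def acomb[OF that] lcomb[OF that] by (simp add: power2_eq_square field_simps)
    finally have le: "I \<le> (a f f + 2 * a f g + a g g) / 8 - (l f + l g) / 2" .
    have eq: "a (\<lambda>x. f x - g x) (\<lambda>x. f x - g x) = a f f - 2 * a f g + a g g"
      using acomb[OF that, of 1 "-1"] by simp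
    have lin: "p - 2 * q + r \<le> 4 * (p / 2 - s + (r / 2 - t) - 2 * i)"
      if "i \<le> (p + 2 * q + r) / 8 - (s + t) / 2" for p q r s t i :: real
      using that by (simp add: field_simps)
    show ?thesis unfolding eq J_def by (rule lin[OF le])
  qed
  have small: "a (\<lambda>x. \<phi> m x - \<phi> n x) (\<lambda>x. \<phi> m x - \<phi> n x) \<le> 8 / real (Suc N)" if "N \<le> m" "N \<le> n" for m n N
  proof -
    have "1 / real (Suc m) \<le> 1 / real (Suc N)" "1 / real (Suc n) \<le> 1 / real (Suc N)"
      using that by (auto intro!: divide_left_mono)
    then have le: "J (\<phi> m) - I \<le> 1 / real (Suc N)" "J (\<phi> n) - I \<le> 1 / real (Suc N)"
      using \<phi>(2)[of m] \<phi>(2)[of n] by linarith+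
    have "a (\<lambda>x. \<phi> m x - \<phi> n x) (\<lambda>x. \<phi> m x - \<phi> n x) \<le> 4 * ((J (\<phi> m) - I) + (J (\<phi> n) - I))"
      using par[OF \<phi>(1) \<phi>(1), of m n] by (simp add: algebra_simps)
    also have "\<dots> \<le> 4 * (1 / real (Suc N) + 1 / real (Suc N))"
      by (intro mult_left_mono add_mono le) simp
    finally show ?thesis by simp
  qed
  have dT: "(\<lambda>x. \<phi> m x - \<phi> n x) \<in> T" for m n using comb[OF \<phi>(1) \<phi>(1), of 1 m "-1" n] by simp
  have gd: "grad (\<lambda>x. \<phi> m x - \<phi> n x) x = grad (\<phi> m) x - grad (\<phi> n) x" for m n x
    using grad_lincomb[OF tC[OF \<phi>t] tC[OF \<phi>t], of 1 m "-1" n x] by simp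
  have nn1: "(\<integral>\<^sup>+x. ennreal ((norm (grad (\<phi> m) x - grad (\<phi> n) x))\<^sup>2) \<partial>lborel) = ennreal (a (\<lambda>x. \<phi> m x - \<phi> n x) (\<lambda>x. \<phi> m x - \<phi> n x))" for m n
    unfolding aa gd[symmetric] by (rule nn_integral_eq_integral[OF g2[OF dT]]) simp
  define V where "V = measure lborel \<Omega> / pi"
  have V0: "V \<ge> 0" by (simp add: V_def)
  have nn2: "(\<integral>\<^sup>+x. ennreal ((norm (\<phi> m x - \<phi> n x))\<^sup>2) \<partial>lborel) \<le> ennreal (V * a (\<lambda>x. \<phi> m x - \<phi> n x) (\<lambda>x. \<phi> m x - \<phi> n x))" for m n
  proof -
    have t: "test_fun \<Omega> (\<lambda>x. \<phi> m x - \<phi> n x)" using dT by (simp add: T_def)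
    have "(\<integral>x. (\<phi> m x - \<phi> n x)\<^sup>2 \<partial>lborel) \<le> V * a (\<lambda>x. \<phi> m x - \<phi> n x) (\<lambda>x. \<phi> m x - \<phi> n x)"
      unfolding V_def aa by (rule poincare[OF \<Omega>m \<Omega>fin tC[OF t] test_fun_zero_outside(1)[OF t]])
    moreover have "(\<integral>\<^sup>+x. ennreal ((norm (\<phi> m x - \<phi> n x))\<^sup>2) \<partial>lborel) = ennreal (\<integral>x. (norm (\<phi> m x - \<phi> n x))\<^sup>2 \<partial>lborel)"
      by (rule nn_integral_eq_integral[OF t2(1)[OF t]]) simp
    ultimately show ?thesis by (simp add: ennreal_leI)
  qed
  have ev: "\<exists>N. c * (8 / real (Suc N)) \<le> e" if "e > 0" "c \<ge> 0" for c e :: real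
  proof -
    have "(\<lambda>N. c * (8 * inverse (real (Suc N)))) \<longlonglongrightarrow> c * (8 * 0)"
      by (intro tendsto_intros LIMSEQ_inverse_real_of_nat)
    then have "\<forall>\<^sub>F N in sequentially. c * (8 * inverse (real (Suc N))) < e"
      using that by (intro order_tendstoD(2)) auto
    then obtain N where "c * (8 * inverse (real (Suc N))) < e" by (auto simp: eventually_sequentially)
    then show ?thesis by (intro exI[of _ N]) (simp add: divide_inverse)
  qed
  obtain g where gmv: "g \<in> borel_measurable lborel"
    and lg: "(\<lambda>n. \<integral>\<^sup>+x. ennreal ((norm (grad (\<phi> n) x - g x))\<^sup>2) \<partial>lborel) \<longlonglongrightarrow> 0"
  proof (rule L2_complete[of "\<lambda>n. grad (\<phi> n)" lborel])
    fix e :: real assume "e > 0"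
    then obtain N where N: "1 * (8 / real (Suc N)) \<le> e" using ev[of e 1] by auto
    have "(\<integral>\<^sup>+x. ennreal ((norm (grad (\<phi> m) x - grad (\<phi> n) x))\<^sup>2) \<partial>lborel) \<le> ennreal e" if "N \<le> m" "N \<le> n" for m n
      unfolding nn1 using small[OF that] N by (intro ennreal_leI) simp
    then show "\<exists>N. \<forall>m\<ge>N. \<forall>n\<ge>N. (\<integral>\<^sup>+x. ennreal ((norm (grad (\<phi> m) x - grad (\<phi> n) x))\<^sup>2) \<partial>lborel) \<le> ennreal e" by blast
  qed (use gm[OF \<phi>(1)] in auto)
  obtain v where vm: "v \<in> borel_measurable lborel"
    and lv: "(\<lambda>n. \<integral>\<^sup>+x. ennreal ((norm (\<phi> n x - v x))\<^sup>2) \<partial>lborel) \<longlonglongrightarrow> 0"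
  proof (rule L2_complete[of "\<lambda>n. \<phi> n" lborel])
    fix e :: real assume "e > 0"
    then obtain N where N: "V * (8 / real (Suc N)) \<le> e" using ev[of e V] V0 by auto
    have "(\<integral>\<^sup>+x. ennreal ((norm (\<phi> m x - \<phi> n x))\<^sup>2) \<partial>lborel) \<le> ennreal e" if "N \<le> m" "N \<le> n" for m n
    proof -
      have "V * a (\<lambda>x. \<phi> m x - \<phi> n x) (\<lambda>x. \<phi> m x - \<phi> n x) \<le> V * (8 / real (Suc N))"
        by (intro mult_left_mono small that V0)
      then show ?thesis using N by (intro order_trans[OF nn2] ennreal_leI) linarith
    qed
    then show "\<exists>N. \<forall>m\<ge>N. \<forall>n\<ge>N. (\<integral>\<^sup>+x. ennreal ((norm (\<phi> m x - \<phi> n x))\<^sup>2) \<partial>lborel) \<le> ennreal e" by blast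
  qed (use tm(1)[OF \<phi>t] in auto)
  have weak: "(\<integral>x. g x \<bullet> grad \<psi> x \<partial>lborel) = (\<integral>x. \<psi> x \<partial>lborel)" if \<psi>: "test_fun \<Omega> \<psi>" for \<psi>
  proof -
    have \<psi>T: "\<psi> \<in> T" using \<psi> by (simp add: T_def)
    have "(\<lambda>n. a (\<phi> n) \<psi>) \<longlonglongrightarrow> (\<integral>x. g x \<bullet> grad \<psi> x \<partial>lborel)"
      unfolding a_def by (rule L2_limit_inner[where u="\<lambda>n. grad (\<phi> n)", OF gm[OF \<phi>(1)] gmv g2[OF \<phi>(1)] lg gm[OF \<psi>T] g2[OF \<psi>T]])
    moreover have "(\<lambda>n. a (\<phi> n) \<psi> - l \<psi>) \<longlonglongrightarrow> 0"
    proof (rule Lim_null_comparison)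
      have "(\<lambda>n. sqrt (2 * a \<psi> \<psi> * inverse (real (Suc n)))) \<longlonglongrightarrow> sqrt (2 * a \<psi> \<psi> * 0)"
        by (intro tendsto_intros LIMSEQ_inverse_real_of_nat)
      then show "(\<lambda>n. sqrt (2 * a \<psi> \<psi> * inverse (real (Suc n)))) \<longlonglongrightarrow> 0" by simp
      show "\<forall>\<^sub>F n in sequentially. norm (a (\<phi> n) \<psi> - l \<psi>) \<le> sqrt (2 * a \<psi> \<psi> * inverse (real (Suc n)))"
      proof (rule always_eventually, rule allI)
        fix n
        \<comment> \<open>The quadratic J (\<phi> n + s \<psi>) - I is nonnegative for all s, so its
          discriminant bounds the first variation by the gap J (\<phi> n) - I, which tends to
          0.\<close>
        have "((l \<psi> - a (\<phi> n) \<psi>) / 2)\<^sup>2 \<le> (J (\<phi> n) - I) * (a \<psi> \<psi> / 2)"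
        proof (rule discriminant_le)
          fix s
          have "I \<le> J (\<lambda>x. 1 * \<phi> n x + s * \<psi> x)" by (intro I comb \<phi>(1) \<psi>T)
          also have "\<dots> = J (\<phi> n) - 2 * s * ((l \<psi> - a (\<phi> n) \<psi>) / 2) + s\<^sup>2 * (a \<psi> \<psi> / 2)"
            unfolding J_def acomb[OF \<phi>(1) \<psi>T] lcomb[OF \<phi>(1) \<psi>T] by (simp add: field_simps)
          finally show "0 \<le> J (\<phi> n) - I - 2 * s * ((l \<psi> - a (\<phi> n) \<psi>) / 2) + s\<^sup>2 * (a \<psi> \<psi> / 2)" by simp
        qed (use a0 in simp)
        also have "\<dots> \<le> inverse (real (Suc n)) * (a \<psi> \<psi> / 2)"
          using \<phi>(2)[of n] a0[of \<psi>] by (intro mult_right_mono) (auto simp: inverse_eq_divide)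
        finally have "(a (\<phi> n) \<psi> - l \<psi>)\<^sup>2 \<le> 2 * a \<psi> \<psi> * inverse (real (Suc n))"
          by (simp add: power2_commute[of "l \<psi>"] power_divide mult_ac del: of_nat_Suc)
        then show "norm (a (\<phi> n) \<psi> - l \<psi>) \<le> sqrt (2 * a \<psi> \<psi> * inverse (real (Suc n)))"
          by (simp only: real_norm_def real_sqrt_le_iff real_sqrt_abs[symmetric])
      qed
    qed
    then have "(\<lambda>n. a (\<phi> n) \<psi>) \<longlonglongrightarrow> l \<psi>" by (rule LIM_zero_cancel)
    ultimately show ?thesis using LIMSEQ_unique unfolding l_def by blast
  qed
  have "torsion_fun \<Omega> v" unfolding torsion_fun_def
    using vm gmv \<phi>t lg lv weak by auto
  then show ?thesis by blast
qed

theorem torsion_le: "torsion \<Omega> \<le> (measure lborel \<Omega>)\<^sup>2 / (8 * pi)"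
proof -
  obtain v where v: "torsion_fun \<Omega> v" using torsion_fun_exists by blast
  show ?thesis using torsion_fun_integral_le[OF v] by (simp add: torsion_eq[OF v])
qed

end

subsection \<open>The unit disc\<close>

lemma measure_ball_pt: "0 \<le> r \<Longrightarrow> measure lborel (ball (a::pt) r) = pi * r\<^sup>2"
  by (simp add: content_ball unit_ball_vol_2)

section \<open>Perimeter of the disc\<close>

lemma C1c_mult:
  assumes f: "C1c f" and g: "C1c g"
  shows "C1c (\<lambda>x. f x * g x)" "grad (\<lambda>x. f x * g x) x = f x *\<^sub>R grad g x + g x *\<^sub>R grad f x"
proof -
  have d: "((\<lambda>x. f x * g x) has_derivative (\<lambda>w. (f x *\<^sub>R grad g x + g x *\<^sub>R grad f x) \<bullet> w)) (at x)" for x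
    by (auto intro!: derivative_eq_intros C1c_has_derivative f g simp: inner_add_left algebra_simps)
  have c: "continuous_on UNIV (\<lambda>x. f x *\<^sub>R grad g x + g x *\<^sub>R grad f x)"
    by (intro continuous_intros C1c_continuous C1c_continuous_grad f g)
  obtain R where "\<And>x. R < norm x \<Longrightarrow> f x = 0" using C1c_support[OF f] by metis
  then show "C1c (\<lambda>x. f x * g x)" "grad (\<lambda>x. f x * g x) x = f x *\<^sub>R grad g x + g x *\<^sub>R grad f x"
    using C1cI[OF d c, of R] by auto
qed

context
  fixes X :: "pt \<Rightarrow> pt"
  assumes X: "C1c_field X"
begin

lemma C1c_field_component: "C1c (\<lambda>x. X x $ i)"
  and C1c_field_grad: "grad (\<lambda>x. X x $ i) x $ j = frechet_derivative X (at x) (axis j 1) $ i"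
proof -
  have d: "(X has_derivative frechet_derivative X (at x)) (at x)" for x
    using X frechet_derivative_works by (auto simp: C1c_field_def)
  have lin: "linear (frechet_derivative X (at x))" for x
    using d by (rule has_derivative_linear)
  define G :: "pt \<Rightarrow> pt" where "G x = (\<chi> j. frechet_derivative X (at x) (axis j 1) $ i)" for x
  have G: "frechet_derivative X (at x) w $ i = G x \<bullet> w" for x w
  proof -
    have "w = w $ 1 *\<^sub>R axis 1 1 + w $ 2 *\<^sub>R axis 2 1" by (simp add: pt_eq_iff axis_def)
    then have "frechet_derivative X (at x) w =
        w $ 1 *\<^sub>R frechet_derivative X (at x) (axis 1 1) + w $ 2 *\<^sub>R frechet_derivative X (at x) (axis 2 1)"
      using linear_add[OF lin] linear_cmul[OF lin] by metis
    then show ?thesis by (simp add: G_def inner_pt)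
  qed
  have di: "((\<lambda>x. X x $ i) has_derivative (\<lambda>w. G x \<bullet> w)) (at x)" for x
    using has_derivative_compose[OF d[of x] bounded_linear_imp_has_derivative[OF bounded_linear_vec_nth[of i]]]
    by (simp add: G)
  have cG: "continuous_on UNIV G" unfolding G_def[abs_def]
    using X by (intro continuous_on_vec_lambda continuous_on_component) (auto simp: C1c_field_def)
  have "bounded (tsupport X)" using X by (auto simp: C1c_field_def compact_imp_bounded)
  then obtain R where R: "\<And>x. x \<in> tsupport X \<Longrightarrow> norm x \<le> R" by (auto simp: bounded_iff)
  have z: "X x $ i = 0" if "R < norm x" for x
  proof -
    have "x \<notin> tsupport X" using R[of x] that by auto
    then have "X x = 0" using subsetD[OF closure_subset[of "{x. X x \<noteq> 0}"], of x] by (auto simp: tsupport_def)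
    then show ?thesis by simp
  qed
  show "C1c (\<lambda>x. X x $ i)" "grad (\<lambda>x. X x $ i) x $ j = frechet_derivative X (at x) (axis j 1) $ i"
    using C1cI[OF di cG z] by (auto simp: G_def)
qed

lemma divergence_eq_grad: "divergence X x = grad (\<lambda>x. X x $ 1) x $ 1 + grad (\<lambda>x. X x $ 2) x $ 2"
  by (simp add: divergence_def sum_2 C1c_field_grad)

lemma divergence_continuous: "continuous_on S (divergence X)"
  unfolding divergence_eq_grad[abs_def]
  by (intro continuous_intros C1c_continuous_grad C1c_field_component)

lemma integral_divergence_mult:
  assumes \<zeta>: "C1c \<zeta>"
  shows "(\<integral>x. \<zeta> x * divergence X x \<partial>lborel) = - (\<integral>x. grad \<zeta> x \<bullet> X x \<partial>lborel)"
proof -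
  have int: "integrable lborel (\<lambda>x. \<zeta> x * grad (\<lambda>x. X x $ i) x $ i)" "integrable lborel (\<lambda>x. X x $ i * grad \<zeta> x $ i)" for i
    by (intro C1c_integrable[OF \<zeta>] continuous_intros C1c_continuous C1c_continuous_grad \<zeta> C1c_field_component; simp)+
  have eq: "(\<integral>x. \<zeta> x * grad (\<lambda>x. X x $ i) x $ i \<partial>lborel) = - (\<integral>x. X x $ i * grad \<zeta> x $ i \<partial>lborel)" for i
  proof -
    have "(\<integral>x. grad (\<lambda>x. \<zeta> x * X x $ i) x $ i \<partial>lborel) = 0"
      by (rule C1c_integral_grad_nth[OF C1c_mult(1)[OF \<zeta> C1c_field_component]])
    also have "(\<integral>x. grad (\<lambda>x. \<zeta> x * X x $ i) x $ i \<partial>lborel) =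
       (\<integral>x. \<zeta> x * grad (\<lambda>x. X x $ i) x $ i + X x $ i * grad \<zeta> x $ i \<partial>lborel)"
      by (simp add: C1c_mult(2)[OF \<zeta> C1c_field_component])
    finally show ?thesis using int by simp
  qed
  have "(\<integral>x. \<zeta> x * divergence X x \<partial>lborel) =
     (\<integral>x. \<zeta> x * grad (\<lambda>x. X x $ 1) x $ 1 \<partial>lborel) + (\<integral>x. \<zeta> x * grad (\<lambda>x. X x $ 2) x $ 2 \<partial>lborel)"
    unfolding divergence_eq_grad distrib_left by (rule Bochner_Integration.integral_add[OF int(1) int(1)])
  also have "\<dots> = - ((\<integral>x. X x $ 1 * grad \<zeta> x $ 1 \<partial>lborel) + (\<integral>x. X x $ 2 * grad \<zeta> x $ 2 \<partial>lborel))"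
    by (simp add: eq)
  also have "(\<integral>x. X x $ 1 * grad \<zeta> x $ 1 \<partial>lborel) + (\<integral>x. X x $ 2 * grad \<zeta> x $ 2 \<partial>lborel) =
     (\<integral>x. X x $ 1 * grad \<zeta> x $ 1 + X x $ 2 * grad \<zeta> x $ 2 \<partial>lborel)"
    by (rule Bochner_Integration.integral_add[OF int(2) int(2), symmetric])
  finally show ?thesis by (simp add: inner_pt mult.commute)
qed

text \<open>The indicator of the disc is replaced by a radial C1 cutoff, so that the divergence
  theorem becomes integration by parts without a boundary term. The cutoff is a function of 1 -
  |x|^2, not of |x|, which avoids a singularity at the origin.\<close>

lemma divergence_ball_le:
  assumes X1: "\<And>x. norm (X x) \<le> 1"
  shows "(LINT x:ball 0 1|lborel. divergence X x) \<le> 2 * pi"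
proof -
  obtain M where M: "\<And>x. \<bar>divergence X x\<bar> \<le> M" "0 \<le> M"
  proof -
    obtain R1 where "\<And>x. R1 < norm x \<Longrightarrow> grad (\<lambda>x. X x $ 1) x = 0" using C1c_support[OF C1c_field_component[of 1]] by metis
    moreover obtain R2 where "\<And>x. R2 < norm x \<Longrightarrow> grad (\<lambda>x. X x $ 2) x = 0" using C1c_support[OF C1c_field_component[of 2]] by metis
    ultimately have "divergence X x = 0" if "max R1 R2 < norm x" for x using that by (simp add: divergence_eq_grad)
    from bounded_support_bound[OF divergence_continuous this] show ?thesis using that by (metis real_norm_def)
  qed
  have main: "(LINT x:ball 0 1|lborel. divergence X x) \<le> 2 * pi + M * pi * (2 * d)" if d: "0 < d" "d \<le> 1/2" for d
  proof -
    \<comment> \<open>The squared radius 1 - d gives the annulus the area pi d exactly; with the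
      gradient bound 2 / d this yields 2 pi already before the limit.\<close>
    define r where "r = sqrt (1 - d)"
    have r: "0 < r" "r < 1" "r\<^sup>2 = 1 - d" using d by (auto simp: r_def)
    define \<zeta> where "\<zeta> x = ramp d ((1 - x \<bullet> x) / d)" for x :: pt
    define G where "G x = (ramp' d ((1 - x \<bullet> x) / d) * (- 2 / d)) *\<^sub>R x" for x :: pt
    have "((\<lambda>x. (1 - x \<bullet> x) / d) has_derivative (\<lambda>w. (- 2 / d) * (x \<bullet> w))) (at x)" for x :: pt
      using d by (auto intro!: derivative_eq_intros simp: inner_commute field_simps)
    from has_derivative_compose[OF this ramp_DERIV[OF d(1), unfolded has_field_derivative_def]]
    have \<zeta>d: "(\<zeta> has_derivative (\<lambda>w. G x \<bullet> w)) (at x)" for x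
      by (simp add: \<zeta>_def[abs_def] G_def mult.assoc)
    have Gc: "continuous_on UNIV G" unfolding G_def[abs_def]
      using d by (intro continuous_intros continuous_on_compose2[OF ramp'_continuous[OF d(1), of UNIV]]) auto
    have nx: "x \<bullet> x = (norm x)\<^sup>2" for x :: pt by (simp add: dot_square_norm)
    have out: "\<zeta> x = 0" if "1 \<le> norm x" for x
      using that d power_mono[of 1 "norm x" 2] unfolding \<zeta>_def nx
      by (intro ramp_values(1)[OF d]) (simp add: divide_le_0_iff)
    have \<zeta>: "C1c \<zeta>" "grad \<zeta> x = G x" for x using C1cI[OF \<zeta>d Gc, of 1] out by auto
    have \<zeta>b: "0 \<le> \<zeta> x" "\<zeta> x \<le> 1 - d" for x using ramp_values(3,4)[OF d] by (auto simp: \<zeta>_def)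
    have inn: "\<zeta> x = 1 - d" if "norm x < r" for x
    proof -
      have "(norm x)\<^sup>2 \<le> r\<^sup>2" using that by (intro power_mono) auto
      then have "1 \<le> (1 - x \<bullet> x) / d" unfolding nx using r d by (simp add: pos_le_divide_eq)
      then show ?thesis unfolding \<zeta>_def by (rule ramp_values(2)[OF d])
    qed
    define A where "A = ball (0::pt) 1 - ball 0 r"
    have Am: "measure lborel A = pi * d"
    proof -
      have "measure lborel A = measure lborel (ball (0::pt) 1) - measure lborel (ball (0::pt) r)"
        unfolding A_def using r emeasure_bounded_finite[OF bounded_ball[of "0::pt" 1]]
        by (intro measure_Diff) (auto intro!: subset_ball)
      also have "\<dots> = pi * 1\<^sup>2 - pi * r\<^sup>2" using r by (simp only: measure_ball_pt zero_le_one less_imp_le)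
      finally show ?thesis by (simp add: r right_diff_distrib)
    qed
    have bi: "integrable lborel (indicator S :: pt \<Rightarrow> real)" if "bounded S" "S \<in> sets borel" for S :: "pt set"
      using that by (intro integrable_real_indicator emeasure_bounded_finite) auto
    have iA: "integrable lborel (indicator A :: pt \<Rightarrow> real)" and iB: "integrable lborel (indicator (ball 0 1) :: pt \<Rightarrow> real)"
      by (intro bi; auto simp: A_def intro: bounded_subset[OF bounded_ball])+
    have G_le: "norm (G x) \<le> 2 / d * indicator A x" for x
    proof (cases "x \<in> A")
      case True
      then have nx1: "norm x \<le> 1" by (auto simp: A_def)
      have "norm (G x) = \<bar>ramp' d ((1 - x \<bullet> x) / d)\<bar> * (2 / d) * norm x" using d by (simp add: G_def abs_mult)
      also have "\<dots> \<le> 1 * (2 / d) * 1" using ramp'_bounds(1,2)[OF d] nx1 d by (intro mult_mono) auto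
      finally show ?thesis using True by simp
    next
      case False
      then consider "1 \<le> norm x" | "norm x < r" by (auto simp: A_def not_less)
      then have "ramp' d ((1 - x \<bullet> x) / d) = 0"
      proof cases
        case 1
        then show ?thesis using power_mono[of 1 "norm x" 2] d unfolding nx
          by (intro ramp'_bounds(3)[OF d]) (simp add: divide_le_0_iff)
      next
        case 2
        have "(norm x)\<^sup>2 \<le> r\<^sup>2" using 2 by (intro power_mono) auto
        then show ?thesis unfolding nx using r d by (intro ramp'_bounds(4)[OF d]) (simp add: pos_le_divide_eq)
      qed
      then show ?thesis using False by (simp add: G_def)
    qed
    have "- (\<integral>x. grad \<zeta> x \<bullet> X x \<partial>lborel) \<le> \<bar>\<integral>x. grad \<zeta> x \<bullet> X x \<partial>lborel\<bar>" by simp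
    also have "\<dots> \<le> (\<integral>x. 2 / d * indicator A x \<partial>lborel)"
    proof -
      have "integrable lborel (\<lambda>x. grad \<zeta> x \<bullet> X x)"
        unfolding inner_pt
        by (intro C1c_integrable[OF \<zeta>(1)] continuous_intros C1c_continuous C1c_continuous_grad \<zeta>(1) C1c_field_component) simp
      moreover have "\<bar>grad \<zeta> x \<bullet> X x\<bar> \<le> 2 / d * indicator A x" for x
      proof -
        have "\<bar>grad \<zeta> x \<bullet> X x\<bar> \<le> norm (G x) * norm (X x)" unfolding \<zeta>(2) by (rule Cauchy_Schwarz_ineq2)
        also have "\<dots> \<le> (2 / d * indicator A x) * 1" by (intro mult_mono G_le X1) (use d in auto)
        finally show ?thesis by simp
      qed
      ultimately show ?thesis
        using integral_norm_le[of lborel "\<lambda>x. grad \<zeta> x \<bullet> X x" "\<lambda>x. 2 / d * indicator A x"] iA by simp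
    qed
    also have "\<dots> = 2 * pi" using d by (simp add: Am)
    finally have 1: "(\<integral>x. \<zeta> x * divergence X x \<partial>lborel) \<le> 2 * pi"
      by (simp add: integral_divergence_mult[OF \<zeta>(1)])
    have i\<zeta>: "integrable lborel (\<lambda>x. \<zeta> x * divergence X x)"
      by (intro C1c_integrable[OF \<zeta>(1)] continuous_intros C1c_continuous \<zeta>(1) divergence_continuous) simp
    have iM: "integrable lborel (\<lambda>x. M * (d * indicator (ball 0 1) x + indicator A x))"
      using iA iB by simp
    have "(LINT x:ball 0 1|lborel. divergence X x) \<le>
      (\<integral>x. \<zeta> x * divergence X x + M * (d * indicator (ball 0 1) x + indicator A x) \<partial>lborel)"
      unfolding set_lebesgue_integral_def real_scaleR_def
    proof (rule integral_mono)
      have "set_integrable lborel (cball 0 1) (divergence X)"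
        unfolding set_integrable_def by (intro borel_integrable_compact divergence_continuous) auto
      then have "set_integrable lborel (ball 0 1) (divergence X)"
        by (rule set_integrable_subset) auto
      then show "integrable lborel (\<lambda>x. indicator (ball 0 1) x * divergence X x)"
        by (simp add: set_integrable_def)
      show "integrable lborel (\<lambda>x. \<zeta> x * divergence X x + M * (d * indicator (ball 0 1) x + indicator A x))"
        by (intro Bochner_Integration.integrable_add i\<zeta> iM)
      fix x
      \<comment> \<open>The error of the cutoff is d on the inner disc, where \<open>ramp\<close>
        stops at 1 - d, and at most 1 on the annulus; both contributions are of order d.\<close>
      have "0 \<le> indicator (ball 0 1) x - \<zeta> x \<and> indicator (ball 0 1) x - \<zeta> x \<le> d * indicator (ball 0 1) x + indicator A x"
      proof (cases "norm x < r")
        case True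
        then have "x \<in> ball 0 1" "x \<notin> A" using r by (auto simp: A_def)
        then show ?thesis using inn[OF True] d by simp
      next
        case False
        show ?thesis
        proof (cases "norm x < 1")
          case True
          then have "x \<in> ball 0 1" "x \<in> A" using False by (auto simp: A_def)
          then show ?thesis using \<zeta>b[of x] d by simp
        next
          case False
          then have "x \<notin> ball 0 1" "x \<notin> A" by (auto simp: A_def)
          then show ?thesis using out[of x] False by simp
        qed
      qed
      then have "(indicator (ball 0 1) x - \<zeta> x) * divergence X x \<le> (d * indicator (ball 0 1) x + indicator A x) * M"
        using M(1)[of x] M(2) by (intro order_trans[OF mult_left_mono[of "divergence X x" M] mult_right_mono]) auto
      then show "indicator (ball 0 1) x * divergence X x \<le>
        \<zeta> x * divergence X x + M * (d * indicator (ball 0 1) x + indicator A x)"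
        unfolding left_diff_distrib[of "indicator (ball 0 1) x" "\<zeta> x" "divergence X x"]
          mult.commute[of "d * indicator (ball 0 1) x + indicator A x" M] by linarith
    qed
    also have "\<dots> = (\<integral>x. \<zeta> x * divergence X x \<partial>lborel) + M * (d * pi + pi * d)"
      using iA iB by (subst Bochner_Integration.integral_add[OF i\<zeta> iM]) (simp add: Am measure_ball_pt)
    also have "\<dots> \<le> 2 * pi + M * (d * pi + pi * d)" using 1 by simp
    finally show ?thesis by (simp add: algebra_simps)
  qed
  have "(\<lambda>n. 2 * pi + M * pi * (2 * inverse (real (Suc n)))) \<longlonglongrightarrow> 2 * pi + M * pi * (2 * 0)"
    by (intro tendsto_intros LIMSEQ_inverse_real_of_nat)
  then have "(\<lambda>n. 2 * pi + M * pi * (2 * inverse (real (Suc n)))) \<longlonglongrightarrow> 2 * pi" by simp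
  moreover have "\<forall>n\<ge>1. (LINT x:ball 0 1|lborel. divergence X x) \<le> 2 * pi + M * pi * (2 * inverse (real (Suc n)))"
  proof (intro allI impI main)
    fix n :: nat assume "1 \<le> n"
    then have "2 \<le> real (Suc n)" by simp
    then show "inverse (real (Suc n)) \<le> 1 / 2" using le_imp_inverse_le[of 2 "real (Suc n)"] by simp
  qed simp
  ultimately show ?thesis by (intro LIMSEQ_le_const[of _ "2 * pi"] exI[of _ 1])
qed

end

lemma perimeter_disc_le: "perimeter (ball 0 1) \<le> ereal (2 * pi)"
  unfolding perimeter_def by (intro SUP_least) (auto intro: divergence_ball_le)

subsubsection \<open>Torsion of the disc\<close>

lemma exp_neg_bounds:
  assumes "0 < (t::real)"
  shows "t * exp (- t) \<le> 1" "t\<^sup>2 * exp (- t) \<le> 2"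
proof -
  have e: "1 + t + t\<^sup>2 / 2 \<le> exp t" using assms by (intro exp_lower_Taylor_quadratic) auto
  have "t \<le> exp t" "t\<^sup>2 \<le> 2 * exp t" using e assms zero_le_power2[of t] by linarith+
  then show "t * exp (- t) \<le> 1" "t\<^sup>2 * exp (- t) \<le> 2" by (simp_all add: exp_minus field_simps)
qed

text \<open>The relative error of the gradient of \<open>disc_approx\<close>. With u = K s - 1 the
  product rule for s times \<open>bump 0 u\<close> gives \<open>bump 0 u\<close> + K s
  \<open>bump 2 u\<close>, since \<open>bump 2\<close> is the derivative of \<open>bump 0\<close>,
  and K s = u + 1.\<close>

definition cutoff_error :: "real \<Rightarrow> real" where
  "cutoff_error u = bump 0 u + (u + 1) * bump 2 u - 1"

lemma cutoff_error_pos: "u > 0 \<Longrightarrow> cutoff_error u = exp (- inverse u) + (inverse u + (inverse u)\<^sup>2) * exp (- inverse u) - 1"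
  by (simp add: cutoff_error_def bump_def field_simps power2_eq_square)

lemma cutoff_error_bound: "\<bar>cutoff_error u\<bar> \<le> 4"
proof (cases "u > 0")
  case True
  then have t: "0 < inverse u" by simp
  have "0 \<le> exp (- inverse u)" "exp (- inverse u) \<le> 1" using t by auto
  moreover have "0 \<le> inverse u * exp (- inverse u)" "0 \<le> (inverse u)\<^sup>2 * exp (- inverse u)" using t by auto
  ultimately show ?thesis
    using exp_neg_bounds[OF t] unfolding cutoff_error_pos[OF True] distrib_right by linarith
qed (simp add: cutoff_error_def bump_def)

lemma cutoff_error_tendsto: "(cutoff_error \<longlongrightarrow> 0) at_top" "(bump 0 \<longlongrightarrow> 1) at_top"
proof -
  have i: "((\<lambda>u::real. inverse u) \<longlongrightarrow> 0) at_top" by (rule tendsto_inverse_0_at_top[OF filterlim_ident])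
  have "((\<lambda>u::real. exp (- inverse u) + (inverse u + (inverse u)\<^sup>2) * exp (- inverse u) - 1) \<longlongrightarrow>
      exp (- 0) + (0 + 0\<^sup>2) * exp (- 0) - 1) at_top" by (intro tendsto_intros i)
  then have "((\<lambda>u::real. exp (- inverse u) + (inverse u + (inverse u)\<^sup>2) * exp (- inverse u) - 1) \<longlongrightarrow> 0) at_top" by simp
  then show "(cutoff_error \<longlongrightarrow> 0) at_top"
    by (rule Lim_transform_eventually) (use eventually_gt_at_top[of 0] in \<open>eventually_elim, simp add: cutoff_error_pos\<close>)
  have "((\<lambda>u::real. exp (- inverse u)) \<longlongrightarrow> exp (- 0)) at_top" by (intro tendsto_intros i)
  then have "((\<lambda>u::real. exp (- inverse u)) \<longlongrightarrow> 1) at_top" by simp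
  then show "(bump 0 \<longlongrightarrow> 1) at_top"
    by (rule Lim_transform_eventually)
      (use eventually_gt_at_top[of 0] in \<open>eventually_elim, simp add: bump_def inverse_eq_divide\<close>)
qed

definition disc_quad :: "pt \<Rightarrow> real" where "disc_quad x = (1 - x \<bullet> x) / 4"

text \<open>\<open>disc_quad\<close> is the explicit torsion function inside the disc. The cutoff
  removes the set where it is at most 1 / (k + 1), which leaves a compact support inside the open
  disc and stays within \<open>bump_algebra\<close>.\<close>

definition disc_approx :: "nat \<Rightarrow> pt \<Rightarrow> real" where
  "disc_approx k x = disc_quad x * bump 0 (real (Suc k) * disc_quad x - 1)"

lemma disc_quad_pos: "0 < disc_quad x \<longleftrightarrow> x \<in> ball 0 1"
  by (simp add: disc_quad_def dot_square_norm abs_square_less_1)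

lemma disc_quad_derivative: "(disc_quad has_derivative (\<lambda>w. (- (1/2) *\<^sub>R x) \<bullet> w)) (at x)"
  unfolding disc_quad_def[abs_def]
  by (auto intro!: derivative_eq_intros simp: inner_commute field_simps)

lemma disc_approx_test_fun: "test_fun (ball 0 1) (disc_approx k)"
proof (rule test_funI[where K="{x. 1 / real (Suc k) \<le> disc_quad x}"])
  have q: "(\<lambda>x. disc_quad x) \<in> bump_algebra a b" for a b
  proof -
    have "(\<lambda>x. 1/4 + (- (1/4)) * (x $ 1 * x $ 1 + x $ 2 * x $ 2)) \<in> bump_algebra a b"
      by (intro bump_algebra.intros)
    moreover have "(\<lambda>x. 1/4 + (- (1/4)) * (x $ 1 * x $ 1 + x $ 2 * x $ 2)) = (\<lambda>x. disc_quad x)"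
      by (simp add: fun_eq_iff disc_quad_def inner_pt field_simps)
    ultimately show ?thesis by (simp only:)
  qed
  define a where "a = real (Suc k) / 4 - 1"
  define b where "b = - (real (Suc k) / 4)"
  have ab: "a + b * (x \<bullet> x) = real (Suc k) * disc_quad x - 1" for x
    by (simp add: a_def b_def disc_quad_def field_simps)
  have "(\<lambda>x. disc_quad x * bump 0 (a + b * (x \<bullet> x))) \<in> bump_algebra a b"
    by (intro bump_algebra.mult q bump_algebra.bump)
  then have "disc_approx k \<in> bump_algebra a b"
    unfolding disc_approx_def[abs_def] ab .
  then show "smooth_fun (disc_approx k)" by (rule bump_algebra_smooth)
  show "closed {x. 1 / real (Suc k) \<le> disc_quad x}"
    unfolding disc_quad_def by (intro closed_Collect_le continuous_intros) auto
  show sub: "{x. 1 / real (Suc k) \<le> disc_quad x} \<subseteq> ball 0 1"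
  proof safe
    fix x assume "1 / real (Suc k) \<le> disc_quad x"
    moreover have "0 < 1 / real (Suc k)" by simp
    ultimately show "x \<in> ball 0 1" using disc_quad_pos[of x] by linarith
  qed
  then show "bounded {x. 1 / real (Suc k) \<le> disc_quad x}" by (rule bounded_subset[OF bounded_ball])
  fix x assume "x \<notin> {x. 1 / real (Suc k) \<le> disc_quad x}"
  then have "real (Suc k) * disc_quad x < 1" by (simp add: field_simps)
  then show "disc_approx k x = 0" by (simp add: disc_approx_def bump_def)
qed

lemma disc_approx_grad:
  "grad (disc_approx k) x = (1 + cutoff_error (real (Suc k) * disc_quad x - 1)) *\<^sub>R (- (1/2) *\<^sub>R x)"
proof (rule grad_unique)
  let ?K = "real (Suc k)" and ?u = "real (Suc k) * disc_quad x - 1"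
  have "((\<lambda>s. ?K * s - 1) has_real_derivative ?K) (at s)" for s by (auto intro!: derivative_eq_intros)
  moreover have "(bump 0 has_real_derivative bump 2 u) (at u)" for u
    using bump_DERIV[of 0 u] by (simp add: numeral_2_eq_2)
  ultimately have b: "((\<lambda>s. bump 0 (?K * s - 1)) has_real_derivative bump 2 (?K * s - 1) * ?K) (at s)" for s
    by (intro DERIV_chain2[where f="bump 0" and g="\<lambda>s. ?K * s - 1"])
  have "((\<lambda>s. s * bump 0 (?K * s - 1)) has_real_derivative
     1 * bump 0 (?K * s - 1) + (bump 2 (?K * s - 1) * ?K) * s) (at s)" for s
    by (rule DERIV_mult[OF DERIV_ident b])
  from has_derivative_compose[OF disc_quad_derivative this[unfolded has_field_derivative_def]]
  have "((\<lambda>x. disc_quad x * bump 0 (?K * disc_quad x - 1)) has_derivative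
    (\<lambda>w. (1 * bump 0 ?u + (bump 2 ?u * ?K) * disc_quad x) * ((- (1/2) *\<^sub>R x) \<bullet> w))) (at x)" .
  moreover have "1 * bump 0 ?u + (bump 2 ?u * ?K) * disc_quad x = 1 + cutoff_error ?u"
    by (simp add: cutoff_error_def)
  ultimately show "(disc_approx k has_derivative (\<lambda>w. ((1 + cutoff_error ?u) *\<^sub>R (- (1/2) *\<^sub>R x)) \<bullet> w)) (at x)"
    unfolding disc_approx_def[abs_def] by (simp add: mult.assoc)
qed

lemma nn_integral_ball_tendsto_0:
  fixes h :: "nat \<Rightarrow> pt \<Rightarrow> real"
  assumes [measurable]: "\<And>n. h n \<in> borel_measurable borel"
    and "\<And>x. x \<in> ball 0 1 \<Longrightarrow> (\<lambda>n. h n x) \<longlonglongrightarrow> 0" "\<And>n x. 0 \<le> h n x" "\<And>n x. h n x \<le> C * indicator (ball 0 1) x"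
  shows "(\<lambda>n. \<integral>\<^sup>+x. ennreal (h n x) \<partial>lborel) \<longlonglongrightarrow> 0"
proof -
  have [measurable]: "ball (0::pt) 1 \<in> sets borel" by simp
  have "(\<lambda>n. \<integral>\<^sup>+x. ennreal (h n x) \<partial>lborel) \<longlonglongrightarrow> (\<integral>\<^sup>+x. 0 \<partial>(lborel :: pt measure))"
  proof (rule nn_integral_dominated_convergence[where w="\<lambda>x. ennreal C * indicator (ball 0 1) x"])
    show "AE x in lborel. ennreal (h j x) \<le> ennreal C * indicator (ball 0 1) x" for j
    proof (rule AE_I2)
      fix x show "ennreal (h j x) \<le> ennreal C * indicator (ball 0 1) x"
        using assms(4)[of j x] assms(3)[of j x] by (cases "x \<in> ball 0 1") (auto intro: ennreal_leI)
    qed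
    have "(\<integral>\<^sup>+x. ennreal C * indicator (ball 0 1) x \<partial>(lborel :: pt measure)) = ennreal C * emeasure lborel (ball (0::pt) 1)"
      by (rule nn_integral_cmult_indicator) simp
    also have "\<dots> < \<infinity>" using emeasure_bounded_finite[OF bounded_ball[of "0::pt" 1]] by (auto simp: ennreal_mult_less_top)
    finally show "(\<integral>\<^sup>+x. ennreal C * indicator (ball 0 1) x \<partial>(lborel :: pt measure)) < \<infinity>" .
    show "AE x in lborel. (\<lambda>n. ennreal (h n x)) \<longlonglongrightarrow> 0"
    proof (rule AE_I2)
      fix x :: pt
      have "(\<lambda>n. h n x) \<longlonglongrightarrow> 0"
      proof (cases "x \<in> ball 0 1")
        case False
        then have "h n x = 0" for n using assms(3)[of n x] assms(4)[of n x] by simp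
        then show ?thesis by simp
      qed (rule assms(2))
      then have "(\<lambda>n. ennreal (h n x)) \<longlonglongrightarrow> ennreal 0" by (rule tendsto_ennrealI)
      then show "(\<lambda>n. ennreal (h n x)) \<longlonglongrightarrow> 0" by simp
    qed
  qed measurable
  then show ?thesis by simp
qed

text \<open>The divergence of x \<psi> integrates to 0, and the divergence of x is 2.\<close>

lemma integral_position_grad:
  assumes "C1c \<psi>"
  shows "(\<integral>x. x \<bullet> grad \<psi> x \<partial>lborel) = - 2 * (\<integral>x. \<psi> x \<partial>lborel)"
proof -
  obtain R where R: "\<And>x. R < norm x \<Longrightarrow> \<psi> x = 0" using C1c_support[OF assms] by metis
  have i: "integrable lborel (\<lambda>x. x $ j * grad \<psi> x $ j)" "integrable lborel \<psi>" for j
    by (intro C1c_integrable[OF assms] continuous_intros C1c_continuous C1c_continuous_grad assms; simp)+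
  have "(\<integral>x. x $ j * grad \<psi> x $ j \<partial>lborel) = - (\<integral>x. \<psi> x \<partial>lborel)" for j
  proof -
    have d: "((\<lambda>x. x $ j * \<psi> x) has_derivative (\<lambda>w. (x $ j *\<^sub>R grad \<psi> x + \<psi> x *\<^sub>R axis j 1) \<bullet> w)) (at x)" for x
      by (auto intro!: derivative_eq_intros C1c_has_derivative assms bounded_linear_imp_has_derivative[OF bounded_linear_vec_nth]
        simp: inner_add_left inner_commute[of "axis j 1"] algebra_simps)
    have c: "continuous_on UNIV (\<lambda>x. x $ j *\<^sub>R grad \<psi> x + \<psi> x *\<^sub>R axis j 1)"
      by (intro continuous_intros C1c_continuous C1c_continuous_grad assms)
    have C: "C1c (\<lambda>x. x $ j * \<psi> x)" "grad (\<lambda>x. x $ j * \<psi> x) x = x $ j *\<^sub>R grad \<psi> x + \<psi> x *\<^sub>R axis j 1" for x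
      using C1cI[OF d c, of R] R by auto
    have "0 = (\<integral>x. x $ j * grad \<psi> x $ j + \<psi> x \<partial>lborel)"
      using C1c_integral_grad_nth[OF C(1), of j] by (simp add: C(2))
    then show ?thesis using i by simp
  qed
  then have "(\<integral>x. x $ 1 * grad \<psi> x $ 1 \<partial>lborel) + (\<integral>x. x $ 2 * grad \<psi> x $ 2 \<partial>lborel) = - 2 * (\<integral>x. \<psi> x \<partial>lborel)" by simp
  then show ?thesis unfolding inner_pt by (simp only: Bochner_Integration.integral_add[OF i(1) i(1)])
qed

text \<open>The explicit function is shown to satisfy the definition, with
  \<open>disc_approx\<close> as approximating sequence. Its integral then needs no polar
  coordinates: the energy identity gives a second linear relation between the integrals of v and of
  |g|^2.\<close>

theorem torsion_disc: "torsion (ball 0 1) = pi / 8"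
proof -
  define v where "v x = indicator (ball 0 1) x * disc_quad x" for x
  define g where "g x = (indicator (ball 0 1) x * (- (1/2))) *\<^sub>R x" for x :: pt
  have qm [measurable]: "disc_quad \<in> borel_measurable borel" unfolding disc_quad_def[abs_def] by measurable
  have bm [measurable]: "bump j \<in> borel_measurable borel" for j
    unfolding bump_def[abs_def] by measurable
  have [measurable]: "cutoff_error \<in> borel_measurable borel" unfolding cutoff_error_def[abs_def] by measurable
  have [measurable]: "ball (0::pt) 1 \<in> sets borel" by simp
  have vm: "v \<in> borel_measurable lborel" and gm: "g \<in> borel_measurable lborel"
    unfolding v_def[abs_def] g_def[abs_def] by measurable
  have u_lim: "filterlim (\<lambda>k. real (Suc k) * disc_quad x - 1) at_top sequentially" if "x \<in> ball 0 1" for x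
  proof -
    have q: "0 < disc_quad x" using that disc_quad_pos by blast
    have "filterlim (\<lambda>k. disc_quad x * real (Suc k)) at_top sequentially"
      by (rule filterlim_tendsto_pos_mult_at_top[OF tendsto_const q])
        (rule filterlim_compose[OF filterlim_real_sequentially filterlim_Suc])
    then have "filterlim (\<lambda>k. - 1 + disc_quad x * real (Suc k)) at_top sequentially"
      by (rule filterlim_tendsto_add_at_top[OF tendsto_const])
    then show ?thesis by (simp add: algebra_simps)
  qed
  have out: "bump j (real (Suc k) * disc_quad x - 1) = 0" if "x \<notin> ball 0 1" for j k x
  proof -
    have "disc_quad x \<le> 0" using that disc_quad_pos[of x] by linarith
    then have "real (Suc k) * disc_quad x \<le> 0" by (intro mult_nonneg_nonpos) auto
    then show ?thesis by (simp add: bump_def)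
  qed
  have q1: "0 \<le> disc_quad x" "disc_quad x \<le> 1" if "x \<in> ball 0 1" for x
  proof -
    show "0 \<le> disc_quad x" using disc_quad_pos[of x] that by linarith
    have "1 - x \<bullet> x \<le> 4" using inner_ge_zero[of x] by linarith
    then have "(1 - x \<bullet> x) / 4 \<le> 4 / 4" by (rule divide_right_mono) simp
    then show "disc_quad x \<le> 1" by (simp add: disc_quad_def)
  qed
  have b01: "0 \<le> bump 0 u" "bump 0 u \<le> 1" for u by (auto simp: bump_def)
  have lv: "(\<lambda>n. \<integral>\<^sup>+ x. ennreal ((disc_approx n x - v x)\<^sup>2) \<partial>lborel) \<longlonglongrightarrow> 0"
  proof (rule nn_integral_ball_tendsto_0[where C=1])
    show "(\<lambda>x. (disc_approx n x - v x)\<^sup>2) \<in> borel_measurable borel" for n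
      unfolding disc_approx_def[abs_def] v_def by measurable
    show "(\<lambda>n. (disc_approx n x - v x)\<^sup>2) \<longlonglongrightarrow> 0" if x: "x \<in> ball 0 1" for x
    proof -
      have "(\<lambda>n. (disc_quad x * bump 0 (real (Suc n) * disc_quad x - 1) - disc_quad x)\<^sup>2) \<longlonglongrightarrow> (disc_quad x * 1 - disc_quad x)\<^sup>2"
        by (intro tendsto_intros filterlim_compose[OF cutoff_error_tendsto(2) u_lim[OF x]])
      then show ?thesis using x by (simp add: disc_approx_def v_def)
    qed
    show "(disc_approx n x - v x)\<^sup>2 \<le> 1 * indicator (ball 0 1) x" for n x
    proof (cases "x \<in> ball 0 1")
      case True
      let ?b = "bump 0 (real (Suc n) * disc_quad x - 1)"
      have "disc_approx n x - v x = disc_quad x * (?b - 1)" using True by (simp add: disc_approx_def v_def right_diff_distrib)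
      moreover have "\<bar>disc_quad x * (?b - 1)\<bar> \<le> 1 * 1"
        unfolding abs_mult using q1[OF True] b01[of "real (Suc n) * disc_quad x - 1"] by (intro mult_mono) auto
      ultimately have "\<bar>disc_approx n x - v x\<bar> \<le> 1" by simp
      then show ?thesis using True by (simp add: abs_square_le_1)
    next
      case False then show ?thesis by (simp add: disc_approx_def v_def out del: of_nat_Suc)
    qed
  qed simp
  have gd: "norm (grad (disc_approx n) x - g x) = indicator (ball 0 1) x * (\<bar>cutoff_error (real (Suc n) * disc_quad x - 1)\<bar> * (norm x / 2))" for n x
  proof (cases "x \<in> ball 0 1")
    case True
    have "grad (disc_approx n) x - g x = (cutoff_error (real (Suc n) * disc_quad x - 1) * (- (1/2))) *\<^sub>R x"
      using True by (simp add: disc_approx_grad g_def algebra_simps del: of_nat_Suc)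
    then show ?thesis using True by (simp add: abs_mult)
  next
    case False
    then have "cutoff_error (real (Suc n) * disc_quad x - 1) = - 1" by (simp add: cutoff_error_def out del: of_nat_Suc)
    then show ?thesis using False by (simp add: disc_approx_grad g_def del: of_nat_Suc)
  qed
  have lg: "(\<lambda>n. \<integral>\<^sup>+ x. ennreal ((norm (grad (disc_approx n) x - g x))\<^sup>2) \<partial>lborel) \<longlonglongrightarrow> 0"
    unfolding gd
  proof (rule nn_integral_ball_tendsto_0[where C=4])
    show "(\<lambda>x. (indicator (ball 0 1) x * (\<bar>cutoff_error (real (Suc n) * disc_quad x - 1)\<bar> * (norm x / 2)))\<^sup>2) \<in> borel_measurable borel" for n
      by measurable
    show "(\<lambda>n. (indicator (ball 0 1) x * (\<bar>cutoff_error (real (Suc n) * disc_quad x - 1)\<bar> * (norm x / 2)))\<^sup>2) \<longlonglongrightarrow> 0"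
      if x: "x \<in> ball 0 1" for x
    proof -
      have "(\<lambda>n. (1 * (\<bar>cutoff_error (real (Suc n) * disc_quad x - 1)\<bar> * (norm x / 2)))\<^sup>2) \<longlonglongrightarrow> (1 * (\<bar>0\<bar> * (norm x / 2)))\<^sup>2"
        by (intro tendsto_intros filterlim_compose[OF cutoff_error_tendsto(1) u_lim[OF x]])
      then show ?thesis using x by simp
    qed
    show "(indicator (ball 0 1) x * (\<bar>cutoff_error (real (Suc n) * disc_quad x - 1)\<bar> * (norm x / 2)))\<^sup>2 \<le> 4 * indicator (ball 0 1) x" for n x
    proof (cases "x \<in> ball 0 1")
      case True
      have "\<bar>cutoff_error (real (Suc n) * disc_quad x - 1)\<bar> * (norm x / 2) \<le> 4 * (1 / 2)"
        using True by (intro mult_mono cutoff_error_bound) auto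
      then have "(\<bar>cutoff_error (real (Suc n) * disc_quad x - 1)\<bar> * (norm x / 2))\<^sup>2 \<le> 2\<^sup>2" by (intro power_mono) auto
      then show ?thesis using True by simp
    qed simp
  qed simp
  have weak: "(\<integral>x. g x \<bullet> grad \<psi> x \<partial>lborel) = (\<integral>x. \<psi> x \<partial>lborel)" if \<psi>: "test_fun (ball 0 1) \<psi>" for \<psi>
  proof -
    have "g x \<bullet> grad \<psi> x = - (1/2) * (x \<bullet> grad \<psi> x)" for x
      using test_fun_zero_outside(2)[OF \<psi>, of x] by (cases "x \<in> ball 0 1") (auto simp: g_def)
    then show ?thesis by (simp add: integral_position_grad[OF test_fun_C1c[OF \<psi>]])
  qed
  have w: "torsion_witness (ball 0 1) v g disc_approx"
    unfolding torsion_witness_def using vm gm disc_approx_test_fun lv lg weak by blast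
  have ob: "open (ball (0::pt) 1)" "bounded (ball (0::pt) 1)" by auto
  have t: "torsion (ball 0 1) = (\<integral>x. v x \<partial>lborel)"
    using torsion_eq[OF ob] w torsion_fun_iff_witness by blast
  have energy: "(\<integral>x. v x \<partial>lborel) = (\<integral>x. (norm (g x))\<^sup>2 \<partial>lborel)" by (rule torsion_witness_energy[OF ob w])
  have gi: "integrable lborel (\<lambda>x. (norm (g x))\<^sup>2)" by (rule torsion_witness_integrable[OF ob w])
  have bi: "integrable lborel (indicator (ball 0 1) :: pt \<Rightarrow> real)"
    by (intro integrable_real_indicator emeasure_bounded_finite) auto
  \<comment> \<open>Here |g|^2 = |x|^2 / 4 inside the disc. Integrated, T = pi / 4 - E, and with E =
    T this gives T = pi / 8.\<close>
  have "v x = indicator (ball 0 1) x / 4 - (norm (g x))\<^sup>2" for x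
    by (cases "x \<in> ball 0 1") (auto simp: v_def g_def disc_quad_def dot_square_norm power_mult_distrib power2_eq_square field_simps)
  then have "(\<integral>x. v x \<partial>lborel) = (\<integral>x. indicator (ball 0 1) x / 4 - (norm (g x))\<^sup>2 \<partial>lborel)" by simp
  also have "\<dots> = pi / 4 - (\<integral>x. (norm (g x))\<^sup>2 \<partial>lborel)"
    using gi bi by (subst Bochner_Integration.integral_diff) (auto simp: measure_ball_pt)
  finally show ?thesis using energy t by simp
qed

subsubsection \<open>Capacity of the disc\<close>

definition circle_param :: "real \<Rightarrow> pt" where
  "circle_param s = rotv (2 * pi * s) 1 0"

lemma circle_param_measurable [measurable]: "circle_param \<in> borel_measurable borel"
proof -
  have "continuous_on UNIV circle_param" unfolding circle_param_def[abs_def]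
    by (rule continuous_vec_pt) (auto intro!: continuous_intros)
  then show ?thesis by (rule borel_measurable_continuous_onI)
qed

lemma dist_circle_param:
  "(dist (circle_param s) (circle_param t))\<^sup>2 = 2 - 2 * cos (2 * pi * (s - t))"
proof -
  let ?a = "2 * pi * s" and ?b = "2 * pi * t"
  have "(dist (circle_param s) (circle_param t))\<^sup>2 = (cos ?a - cos ?b)\<^sup>2 + (sin ?a - sin ?b)\<^sup>2"
    by (simp add: dist_norm norm_pt circle_param_def)
  also have "\<dots> = ((sin ?a)\<^sup>2 + (cos ?a)\<^sup>2) + ((sin ?b)\<^sup>2 + (cos ?b)\<^sup>2) - 2 * (cos ?a * cos ?b + sin ?a * sin ?b)"
    by algebra
  also have "cos ?a * cos ?b + sin ?a * sin ?b = cos (?a - ?b)" by (simp add: cos_diff)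
  finally show ?thesis by (simp add: right_diff_distrib)
qed

definition unit_uniform :: "real measure" where
  "unit_uniform = density lborel (indicator {0..1})"

lemma sets_unit_uniform [measurable_cong]: "sets unit_uniform = sets borel"
  by (simp add: unit_uniform_def)

lemma prob_space_unit_uniform: "prob_space unit_uniform"
  by (rule prob_spaceI) (simp add: unit_uniform_def emeasure_density)

lemma integral_unit_uniform:
  fixes f :: "real \<Rightarrow> real"
  assumes [measurable]: "f \<in> borel_measurable borel"
  shows "(\<integral>t. f t \<partial>unit_uniform) = (\<integral>t. indicator {0..1} t * f t \<partial>lborel)"
proof -
  have *: "unit_uniform = density lborel (\<lambda>t. ennreal (indicator {0..1} t))"
    by (simp add: unit_uniform_def ennreal_indicator)
  show ?thesis unfolding * by (subst integral_density) auto
qed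

lemma integral_cos_unit_uniform:
  assumes "n > 0"
  shows "(\<integral>t. cos (real n * (2 * pi * (s - t))) \<partial>unit_uniform) = 0"
proof -
  let ?F = "\<lambda>t. - sin (real n * (2 * pi * (s - t))) / (real n * (2 * pi))"
  have d: "(?F has_vector_derivative cos (real n * (2 * pi * (s - t)))) (at t within {0..1})" for t
    using assms unfolding has_real_derivative_iff_has_vector_derivative[symmetric]
    by (auto intro!: derivative_eq_intros simp: field_simps)
  have "(\<integral>t. cos (real n * (2 * pi * (s - t))) \<partial>unit_uniform) = (\<integral>t. indicator {0..1} t *\<^sub>R cos (real n * (2 * pi * (s - t))) \<partial>lborel)"
    by (subst integral_unit_uniform) simp_all
  also have "\<dots> = ?F 1 - ?F 0"
    by (rule integral_FTC_atLeastAtMost[OF _ d]) (auto intro!: continuous_intros)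
  also have "sin (real n * (2 * pi * (s - 1))) = sin (real n * (2 * pi * s) - 2 * real n * pi)"
    by (simp add: algebra_simps)
  also have "\<dots> = sin (real n * (2 * pi * s))"
    by (simp add: sin_diff)
  finally show ?thesis by simp
qed

text \<open>All cosine terms integrate to 0, which is the mean value property of ln |1 - w|. Only
  the sign is recorded, as it is what bounds the energy of the circle from above.\<close>

lemma integral_log_dist_nonneg:
  assumes r: "0 \<le> r" "r < 1"
  shows "integrable (unit_uniform \<Otimes>\<^sub>M unit_uniform) (\<lambda>p. log_dist r (2 * pi * (fst p - snd p)))"
    "0 \<le> (\<integral>p. log_dist r (2 * pi * (fst p - snd p)) \<partial>(unit_uniform \<Otimes>\<^sub>M unit_uniform))"
proof -
  interpret M: prob_space unit_uniform by (rule prob_space_unit_uniform)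
  interpret PP: pair_prob_space unit_uniform unit_uniform ..
  let ?M = "unit_uniform \<Otimes>\<^sub>M unit_uniform"
  let ?\<phi> = "\<lambda>p. 2 * pi * (fst p - snd p)"
  obtain B where B: "\<And>\<phi>. \<bar>log_dist r \<phi>\<bar> \<le> B" using log_dist_bounded[OF r] by blast
  show i: "integrable ?M (\<lambda>p. log_dist r (?\<phi> p))"
    by (rule PP.P.integrable_const_bound[where B=B]) (use B in auto)
  have ic: "integrable ?M (\<lambda>p. cos (real n * ?\<phi> p))" for n
    by (rule PP.P.integrable_const_bound[where B=1]) auto
  have ec: "(\<integral>p. cos (real n * ?\<phi> p) \<partial>?M) = 0" if "n > 0" for n
    using PP.integral_fst'[OF ic[of n]] integral_cos_unit_uniform[OF that] by simp
  have le: "- (r ^ N / (1 - r)) \<le> (\<integral>p. log_dist r (?\<phi> p) \<partial>?M)" for N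
  proof -
    let ?S = "\<lambda>p. \<Sum>n<N. r ^ n / n * cos (real n * ?\<phi> p)"
    have iS: "integrable ?M ?S" by (intro Bochner_Integration.integrable_sum integrable_mult_right ic)
    have "(\<integral>p. ?S p \<partial>?M) = (\<Sum>n<N. r ^ n / n * (\<integral>p. cos (real n * ?\<phi> p) \<partial>?M))"
      by (subst Bochner_Integration.integral_sum) (auto intro!: ic integrable_mult_right)
    also have "\<dots> = 0"
    proof (rule sum.neutral, rule ballI)
      fix n show "r ^ n / n * (\<integral>p. cos (real n * ?\<phi> p) \<partial>?M) = 0"
        using ec[of n] by (cases "n = 0") auto
    qed
    finally have S0: "(\<integral>p. ?S p \<partial>?M) = 0" .
    have "- (r ^ N / (1 - r)) = (\<integral>p. - (r ^ N / (1 - r)) - ?S p \<partial>?M)"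
      by (simp only: Bochner_Integration.integral_diff[OF PP.P.integrable_const iS] S0) (simp add: PP.P.prob_space)
    also have "\<dots> \<le> (\<integral>p. log_dist r (?\<phi> p) \<partial>?M)"
    proof (intro integral_mono i Bochner_Integration.integrable_diff PP.P.integrable_const iS)
      fix p
      have "?S p = (\<Sum>n<N. r ^ n * cos (real n * ?\<phi> p) / n)" by simp
      then show "- (r ^ N / (1 - r)) - ?S p \<le> log_dist r (?\<phi> p)"
        using log_dist_approx[OF r, of "?\<phi> p" N] by linarith
    qed
    finally show ?thesis .
  qed
  have "(\<lambda>N. - (r ^ N / (1 - r))) \<longlonglongrightarrow> - (0 / (1 - r))"
    using r by (intro tendsto_intros LIMSEQ_power_zero) auto
  then have "(\<lambda>N. - (r ^ N / (1 - r))) \<longlonglongrightarrow> 0" by simp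
  then show "0 \<le> (\<integral>p. log_dist r (?\<phi> p) \<partial>?M)" by (rule LIMSEQ_le_const2) (use le in auto)
qed

definition circle_measure :: "pt measure" where
  "circle_measure = distr unit_uniform borel circle_param"

lemma prob_on_circle_measure: "prob_on (closure (ball 0 1)) circle_measure"
proof -
  interpret M: prob_space unit_uniform by (rule prob_space_unit_uniform)
  have c: "circle_param \<in> unit_uniform \<rightarrow>\<^sub>M borel" by measurable
  have "circle_param -` (UNIV - cball 0 1) \<inter> space unit_uniform = {}"
    by (auto simp: circle_param_def norm_rotv)
  then have "emeasure circle_measure (UNIV - cball 0 1) = 0"
    unfolding circle_measure_def by (subst emeasure_distr[OF c]) auto
  then show ?thesis
    unfolding prob_on_def using M.prob_space_distr[OF c] by (simp add: circle_measure_def)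
qed

text \<open>Fatou for the bounded kernels - \<open>log_dist\<close> at radii tending to 1. They tend
  to the true kernel also on the diagonal, where both become infinite, so the diagonal need not be
  shown to be null.\<close>

lemma log_energy_circle_measure: "log_energy circle_measure \<le> 0"
proof -
  interpret M: prob_space unit_uniform by (rule prob_space_unit_uniform)
  interpret PP: pair_prob_space unit_uniform unit_uniform ..
  let ?U = "unit_uniform \<Otimes>\<^sub>M unit_uniform"
  let ?\<phi> = "\<lambda>p. 2 * pi * (fst p - snd p)"
  have c: "circle_param \<in> unit_uniform \<rightarrow>\<^sub>M borel" by measurable
  interpret C: prob_space "distr unit_uniform borel circle_param" by (rule M.prob_space_distr[OF c])
  have cc: "(\<lambda>p. (circle_param (fst p), circle_param (snd p))) \<in> ?U \<rightarrow>\<^sub>M borel \<Otimes>\<^sub>M borel" by measurable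
  have prod: "circle_measure \<Otimes>\<^sub>M circle_measure = distr ?U (borel \<Otimes>\<^sub>M borel) (\<lambda>p. (circle_param (fst p), circle_param (snd p)))"
    unfolding circle_measure_def using pair_measure_distr[OF c c C.sigma_finite_measure]
    by (simp add: split_beta')
  define d where "d p = dist (circle_param (fst p)) (circle_param (snd p))" for p
  have d2: "(d p)\<^sup>2 = 2 - 2 * cos (?\<phi> p)" for p unfolding d_def by (rule dist_circle_param)
  have d0: "0 \<le> d p" for p by (simp add: d_def)
  have dm [measurable]: "d \<in> borel_measurable ?U" unfolding d_def[abs_def] by measurable
  define pos where "pos p = (if d p = 0 then \<infinity> else ennreal (max 0 (- ln (d p))))" for p
  define neg where "neg p = (if d p = 0 then 0 else ennreal (max 0 (ln (d p))))" for p
  have pm [measurable]: "pos \<in> borel_measurable ?U" "neg \<in> borel_measurable ?U"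
    unfolding pos_def[abs_def] neg_def[abs_def] by measurable
  have E: "log_energy circle_measure = enn2ereal (\<integral>\<^sup>+p. pos p \<partial>?U) - enn2ereal (\<integral>\<^sup>+p. neg p \<partial>?U)"
    unfolding log_energy_def prod
    by (subst (1 2) nn_integral_distr[OF cc]) (simp_all add: pos_def[abs_def] neg_def[abs_def] d_def cong: if_cong)
  define r where "r n = 1 - inverse (real (Suc (Suc n)))" for n
  have r: "0 \<le> r n" "r n < 1" for n by (simp_all add: r_def inverse_le_1_iff del: of_nat_Suc)
  have r1: "r \<longlonglongrightarrow> 1"
  proof -
    have "r \<longlonglongrightarrow> 1 - 0" unfolding r_def[abs_def]
      by (intro tendsto_diff tendsto_const LIMSEQ_Suc[OF LIMSEQ_inverse_real_of_nat])
    then show ?thesis by simp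
  qed
  define k where "k n p = - log_dist (r n) (?\<phi> p)" for n p
  have km [measurable]: "k n \<in> borel_measurable ?U" for n unfolding k_def[abs_def] by measurable
  \<comment> \<open>Chords of the unit disc have length at most 2, so adding ln 2 makes the kernels
    nonnegative as Fatou requires.\<close>
  have k_ge: "0 \<le> k n p + ln 2" for n p
  proof -
    have "1 - 2 * r n * cos (?\<phi> p) + (r n)\<^sup>2 \<le> 4"
    proof -
      have "r n * (- cos (?\<phi> p)) \<le> 1 * 1" using r[of n] by (intro order_trans[OF mult_left_mono[of "- cos (?\<phi> p)" 1 "r n"]]) auto
      moreover have "(r n)\<^sup>2 \<le> 1" using r[of n] by (simp add: power_le_one)
      ultimately show ?thesis by simp
    qed
    then have "ln (1 - 2 * r n * cos (?\<phi> p) + (r n)\<^sup>2) \<le> ln (2\<^sup>2)"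
      using log_dist_arg_pos(2)[OF r[of n], of "?\<phi> p"] by (intro ln_mono) auto
    also have "\<dots> = 2 * ln 2" by (subst ln_realpow) auto
    finally show ?thesis by (simp add: k_def log_dist_def)
  qed
  \<comment> \<open>The true kernel is \<open>pos\<close> - \<open>neg\<close>; \<open>neg\<close>
    stands on the right so that the statement stays within \<open>ennreal\<close>.\<close>
  have pw: "pos p + ennreal (ln 2) \<le> liminf (\<lambda>n. ennreal (k n p + ln 2)) + neg p" for p
  proof (cases "d p = 0")
    case True
    then have c1: "cos (?\<phi> p) = 1" using d2[of p] by simp
    have "k n p = ln (real (Suc (Suc n)))" for n
    proof -
      have "1 - 2 * r n * cos (?\<phi> p) + (r n)\<^sup>2 = (inverse (real (Suc (Suc n))))\<^sup>2"
        unfolding c1 r_def by algebra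
      then have "k n p = - (ln ((inverse (real (Suc (Suc n))))\<^sup>2) / 2)" by (simp add: k_def log_dist_def)
      also have "\<dots> = ln (real (Suc (Suc n)))"
        by (simp add: ln_realpow ln_inverse del: of_nat_Suc)
      finally show ?thesis .
    qed
    moreover have "(\<lambda>n. ennreal (ln (real (Suc (Suc n))) + ln 2)) \<longlonglongrightarrow> \<infinity>"
    proof -
      have "filterlim (\<lambda>n. real (Suc (Suc n))) at_top sequentially"
        by (rule filterlim_compose[OF filterlim_real_sequentially]) (rule filterlim_compose[OF filterlim_Suc filterlim_Suc])
      then have "filterlim (\<lambda>n. ln (real (Suc (Suc n)))) at_top sequentially"
        by (rule filterlim_compose[OF ln_at_top])
      then have "filterlim (\<lambda>n. ln 2 + ln (real (Suc (Suc n)))) at_top sequentially"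
        by (rule filterlim_tendsto_add_at_top[OF tendsto_const])
      then show ?thesis
        unfolding infinity_ennreal_def ennreal_tendsto_top_eq_at_top by (simp only: add.commute)
    qed
    ultimately have "liminf (\<lambda>n. ennreal (k n p + ln 2)) = \<infinity>"
      by (intro lim_imp_Liminf) auto
    then show ?thesis by simp
  next
    case False
    then have dp: "d p > 0" using d0[of p] by simp
    then have e: "2 - 2 * cos (?\<phi> p) > 0" unfolding d2[symmetric] by simp
    have "(\<lambda>n. - (ln (1 - 2 * r n * cos (?\<phi> p) + (r n)\<^sup>2) / 2) + ln 2) \<longlonglongrightarrow> - (ln (1 - 2 * 1 * cos (?\<phi> p) + 1\<^sup>2) / 2) + ln 2"
      using e by (intro tendsto_intros r1) auto
    moreover have "1 - 2 * 1 * cos (?\<phi> p) + 1\<^sup>2 = (d p)\<^sup>2" unfolding d2 by simp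
    moreover have "ln ((d p)\<^sup>2) / 2 = ln (d p)" using dp by (simp add: ln_realpow)
    ultimately have "(\<lambda>n. k n p + ln 2) \<longlonglongrightarrow> - ln (d p) + ln 2" by (simp add: k_def log_dist_def)
    then have "(\<lambda>n. ennreal (k n p + ln 2)) \<longlonglongrightarrow> ennreal (- ln (d p) + ln 2)" by (rule tendsto_ennrealI)
    then have lim: "liminf (\<lambda>n. ennreal (k n p + ln 2)) = ennreal (- ln (d p) + ln 2)"
      by (rule lim_imp_Liminf[OF sequentially_bot])
    have "0 \<le> - ln (d p) + ln 2" using \<open>(\<lambda>n. k n p + ln 2) \<longlonglongrightarrow> - ln (d p) + ln 2\<close> k_ge
      by (intro LIMSEQ_le_const[of "\<lambda>n. k n p + ln 2"]) auto
    then show ?thesis unfolding lim using False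
      by (simp add: pos_def neg_def max_def flip: ennreal_plus)
  qed
  have ln2: "0 \<le> ln (2::real)" by simp
  have "(\<integral>\<^sup>+p. pos p \<partial>?U) + ennreal (ln 2) = (\<integral>\<^sup>+p. pos p + ennreal (ln 2) \<partial>?U)"
    by (subst nn_integral_add) (auto simp: PP.P.emeasure_space_1)
  also have "\<dots> \<le> (\<integral>\<^sup>+p. liminf (\<lambda>n. ennreal (k n p + ln 2)) + neg p \<partial>?U)"
    by (intro nn_integral_mono pw)
  also have "\<dots> = (\<integral>\<^sup>+p. liminf (\<lambda>n. ennreal (k n p + ln 2)) \<partial>?U) + (\<integral>\<^sup>+p. neg p \<partial>?U)"
    by (rule nn_integral_add) measurable
  also have "(\<integral>\<^sup>+p. liminf (\<lambda>n. ennreal (k n p + ln 2)) \<partial>?U) \<le> liminf (\<lambda>n. \<integral>\<^sup>+p. ennreal (k n p + ln 2) \<partial>?U)"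
    by (rule nn_integral_liminf) measurable
  also have "\<dots> \<le> limsup (\<lambda>n. \<integral>\<^sup>+p. ennreal (k n p + ln 2) \<partial>?U)" by (rule Liminf_le_Limsup) simp
  also have "\<dots> \<le> ennreal (ln 2)"
  proof (intro Limsup_bounded always_eventually allI)
    fix n
    have ik: "integrable ?U (k n)" unfolding k_def[abs_def] using integral_log_dist_nonneg(1)[OF r[of n]] by simp
    have "(\<integral>\<^sup>+p. ennreal (k n p + ln 2) \<partial>?U) = ennreal (\<integral>p. k n p + ln 2 \<partial>?U)"
      using ik k_ge by (intro nn_integral_eq_integral) auto
    also have "(\<integral>p. k n p + ln 2 \<partial>?U) = (\<integral>p. k n p \<partial>?U) + ln 2"
      using ik by (simp add: PP.P.prob_space)
    also have "(\<integral>p. k n p \<partial>?U) \<le> 0"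
      using integral_log_dist_nonneg(2)[OF r[of n]] by (simp add: k_def)
    finally show "(\<integral>\<^sup>+p. ennreal (k n p + ln 2) \<partial>?U) \<le> ennreal (ln 2)" by (simp add: ennreal_leI)
  qed
  finally have le: "(\<integral>\<^sup>+p. pos p \<partial>?U) + ennreal (ln 2) \<le> ennreal (ln 2) + (\<integral>\<^sup>+p. neg p \<partial>?U)"
    by (simp add: add_right_mono)
  then have PN: "(\<integral>\<^sup>+p. pos p \<partial>?U) \<le> (\<integral>\<^sup>+p. neg p \<partial>?U)"
    by (subst (asm) add.commute) (simp add: ennreal_add_left_cancel_le)
  have "(\<integral>\<^sup>+p. neg p \<partial>?U) \<le> (\<integral>\<^sup>+p. ennreal (ln 2) \<partial>?U)"
  proof (rule nn_integral_mono)
    fix p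
    have "(d p)\<^sup>2 \<le> 4" using d2[of p] cos_ge_minus_one[of "?\<phi> p"] by linarith
    then have "(d p)\<^sup>2 \<le> 2\<^sup>2" by simp
    then have "d p \<le> 2" by (rule power2_le_imp_le) simp
    then have "d p \<noteq> 0 \<Longrightarrow> ln (d p) \<le> ln 2" using d0[of p] by (intro ln_mono) auto
    then show "neg p \<le> ennreal (ln 2)" by (auto simp: neg_def intro!: ennreal_leI)
  qed
  also have "\<dots> < \<infinity>" by (simp add: PP.P.emeasure_space_1)
  finally have Nfin: "(\<integral>\<^sup>+p. neg p \<partial>?U) < \<infinity>" .
  show ?thesis unfolding E
    using PN Nfin by (cases "\<integral>\<^sup>+p. neg p \<partial>?U"; cases "\<integral>\<^sup>+p. pos p \<partial>?U") (auto simp: enn2ereal_ennreal top_unique)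
qed

section \<open>The two bounds on the ratio\<close>

lemma log_cap_nonneg: "0 \<le> log_cap K"
  by (simp add: log_cap_def Let_def)

lemma log_cap_disc_ge: "1 \<le> log_cap (closure (ball 0 1))"
proof -
  define V where "V = (INF \<mu>\<in>{\<mu>. prob_on (closure (ball (0::pt) 1)) \<mu>}. log_energy \<mu>)"
  have "V \<le> log_energy circle_measure" unfolding V_def
    by (rule INF_lower) (simp only: mem_Collect_eq prob_on_circle_measure)
  then have "V \<le> 0" using log_energy_circle_measure by (rule order_trans)
  \<comment> \<open>The case V = -\<infinity> needs no exclusion: \<open>real_of_ereal\<close> is 0
    there and the capacity becomes exp 0 = 1.\<close>
  then show ?thesis unfolding log_cap_def Let_def V_def[symmetric] by (cases V) auto
qed

text \<open>Torsion exactly pi / 8, capacity at least 1 and perimeter at most 2 pi give (pi / 8) /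
  (2 pi)^5, the same constant as the upper bound for all domains.\<close>

lemma ratio_disc_ge: "ereal (1 / (256 * pi ^ 4)) \<le> ratio (ball 0 1)"
proof -
  obtain p where p: "perimeter (ball 0 1) = ereal p" "p \<le> 2 * pi"
    using perimeter_disc_le perimeter_nonneg[of "ball 0 1"] by (cases "perimeter (ball 0 1)") auto
  have p0: "0 < p" using perimeter_pos[OF _ _ _ _ p(1)] by simp
  have "1 / (256 * pi ^ 4) = (pi / 8 * 1) / (2 * pi) ^ 5" by (simp add: field_simps eval_nat_numeral)
  also have "\<dots> \<le> (pi / 8 * log_cap (closure (ball 0 1))) / p ^ 5"
    using p p0 log_cap_disc_ge by (intro frac_le mult_left_mono power_mono) auto
  finally show ?thesis using p0 unfolding ratio_def torsion_disc p(1) by simp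
qed

lemma ratio_le:
  assumes \<Omega>: "\<Omega> \<noteq> {}" "open \<Omega>" "bounded \<Omega>" "connected \<Omega>"
  shows "ratio \<Omega> \<le> ereal (1 / (256 * pi ^ 4))"
proof (cases "perimeter \<Omega>")
  case (real P)
  note cond = \<Omega>(2,3,4,1) real
  have P: "0 < P" by (rule perimeter_pos[OF cond])
  have iso: "measure lborel \<Omega> \<le> P\<^sup>2 / (4 * pi)"
    using isoperimetric[OF \<Omega>(2,3) real] by (simp add: field_simps)
  have "torsion \<Omega> \<le> (measure lborel \<Omega>)\<^sup>2 / (8 * pi)" by (rule torsion_le[OF \<Omega>(2,3)])
  also have "\<dots> \<le> (P\<^sup>2 / (4 * pi))\<^sup>2 / (8 * pi)" by (intro divide_right_mono power_mono iso) auto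
  finally have "torsion \<Omega> * log_cap (closure \<Omega>) \<le> (P\<^sup>2 / (4 * pi))\<^sup>2 / (8 * pi) * (P / (2 * pi))"
    using log_cap_le[OF cond] log_cap_nonneg by (intro mult_mono) auto
  also have "\<dots> = P ^ 5 * (1 / (256 * pi ^ 4))" by (simp add: field_simps eval_nat_numeral)
  finally have "torsion \<Omega> * log_cap (closure \<Omega>) / P ^ 5 \<le> 1 / (256 * pi ^ 4)"
    using P by (simp add: pos_divide_le_eq mult.commute)
  then show ?thesis using P by (simp add: ratio_def real)
next
  \<comment> \<open>Division by \<infinity> gives 0 in \<open>ereal\<close>, so domains of infinite
    perimeter do not compete.\<close>
  case PInf then show ?thesis by (simp add: ratio_def)
next
  case MInf then show ?thesis using perimeter_nonneg[of \<Omega>] by simp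
qed

theorem theorem4:
  shows "(SUP \<Omega>\<in>{\<Omega>::pt set. \<Omega> \<noteq> {} \<and> open \<Omega> \<and> bounded \<Omega> \<and> connected \<Omega>}. ratio \<Omega>)
           = ratio (ball 0 1)
      \<and> (\<forall>\<Omega>::pt set. \<Omega> \<noteq> {} \<and> open \<Omega> \<and> bounded \<Omega> \<and> connected \<Omega> \<longrightarrow>
           ratio \<Omega> \<le> ratio (ball 0 1))"
proof
  have le: "ratio \<Omega> \<le> ratio (ball 0 1)" if "\<Omega> \<noteq> {} \<and> open \<Omega> \<and> bounded \<Omega> \<and> connected \<Omega>" for \<Omega> :: "pt set"
    using that by (intro order_trans[OF ratio_le ratio_disc_ge]) auto
  then show "\<forall>\<Omega>::pt set. \<Omega> \<noteq> {} \<and> open \<Omega> \<and> bounded \<Omega> \<and> connected \<Omega> \<longrightarrow> ratio \<Omega> \<le> ratio (ball 0 1)" by blast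
  have disc: "ball (0::pt) 1 \<in> {\<Omega>. \<Omega> \<noteq> {} \<and> open \<Omega> \<and> bounded \<Omega> \<and> connected \<Omega>}" by simp
  show "(SUP \<Omega>\<in>{\<Omega>::pt set. \<Omega> \<noteq> {} \<and> open \<Omega> \<and> bounded \<Omega> \<and> connected \<Omega>}. ratio \<Omega>) = ratio (ball 0 1)"
    by (intro antisym SUP_least SUP_upper disc) (use le in blast)
qed

end
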